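(* For a Heyting algebra $A$ with prime spectrum $X_A$, the following are equivalent: (i) $A\in\mathsf{DHA}$; (ii) $X_A$ is a diamond system; (iii) for every $x\in X_A$, the subposet ${\uparrow}x$ of $X_A$ is a diamond sequence; (iv) $A$ validates the Jankov formulas $\mathcal{J}(P_1),\mathcal{J}(P_2),\mathcal{J}(P_3),\mathcal{J}(P_4)$.
   Context: $X_A$ is the poset of prime filters of $A$ ordered by inclusion; ${\uparrow}x=\{y:x\le y\}$. For a poset $X$, $\mathrm{Up}(X)$ is the Heyting algebra of upsets of $X$ ($U\to V=\{x:{\uparrow}x\cap U\subseteq V\}$). A poset satisfies the three point rule if for all distinct $x,y,z$, if $x,y$ are incomparable and $x\le z$ then $y\le z$. A poset $X$ is a diamond system if: (D1) each ${\uparrow}x$ satisfies the three point rule; (D2) no ${\uparrow}x$ contains a $3$-element antichain; (D3) for all $x$ and $y,z\in{\uparrow}x$ there is $w$ with $y,z\le w$; (D4) whenever $\bot\le x,y$, $x,y\le z,v$, $z,v\le\top$, there is $w$ with $x,y\le w\le z,v$. A diamond sequence is a diamond system in which any two elements have a common lower bound. $\mathsf{DHA}$ is the variety generated by $\{\mathrm{Up}(X): X$ a finite diamond sequence$\}$. For a finite subdirectly irreducible Heyting algebra $C$, its Jankov formula $\mathcal{J}(C)$ is a formula such that for every Heyting algebra $B$: $B$ validates $\mathcal{J}(C)$ (i.e. $\mathcal{J}(C)\approx 1$ holds in $B$) iff $C$ is not isomorphic to a subalgebra of a homomorphic image of $B$. For a finite rooted poset $P$, $\mathcal{J}(P)=\mathcal{J}(\mathrm{Up}(P))$.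 The posets: $P_1=\{0,a,b,c,1\}$ with $0<a,b,c<1$ and $a,b,c$ pairwise incomparable; $P_2=\{0,a,b,c,1\}$ with $0<a<1$, $0<b<c<1$, $a$ incomparable to $b,c$; $P_3=\{r,a,b\}$ with $r<a$, $r<b$, $a,b$ incomparable; $P_4=\{0,a,b,c,d,1\}$ with $0<a,b$, $a,b<c,d$, $c,d<1$, $a,b$ incomparable and $c,d$ incomparable. *)

theory Defs
  imports "HOL-Algebra.Lattice"
begin

section \<open>Heyting algebras\<close>

text \<open>
  Heyting algebras are bounded lattices in the sense of HOL-Algebra (carrier-based, so that
  subalgebras and algebras of sets can be formed) with relative pseudo-complements. The one-element
  algebra is allowed.
\<close>

locale heyting_algebra = bounded_lattice +
  assumes residual_exists:
    "\<lbrakk>x \<in> carrier L; y \<in> carrier L\<rbrakk> \<Longrightarrow> \<exists>z. greatest L z {z \<in> carrier L. x \<sqinter> z \<sqsubseteq> y}"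

definition heyting_imp :: "[_, 'a, 'a] \<Rightarrow> 'a" (infixr \<open>\<rightarrow>\<index>\<close> 60)
  where "x \<rightarrow>\<^bsub>L\<^esub> y = (SOME z. greatest L z {z \<in> carrier L. x \<sqinter>\<^bsub>L\<^esub> z \<sqsubseteq>\<^bsub>L\<^esub> y})"

definition heyting_hom :: "'a gorder \<Rightarrow> 'b gorder \<Rightarrow> ('a \<Rightarrow> 'b) \<Rightarrow> bool"
  where "heyting_hom A B h \<longleftrightarrow>
    h \<in> carrier A \<rightarrow> carrier B \<and> h \<bottom>\<^bsub>A\<^esub> = \<bottom>\<^bsub>B\<^esub> \<and> h \<top>\<^bsub>A\<^esub> = \<top>\<^bsub>B\<^esub> \<and>
    (\<forall>x\<in>carrier A. \<forall>y\<in>carrier A.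
       h (x \<sqinter>\<^bsub>A\<^esub> y) = h x \<sqinter>\<^bsub>B\<^esub> h y \<and>
       h (x \<squnion>\<^bsub>A\<^esub> y) = h x \<squnion>\<^bsub>B\<^esub> h y \<and>
       h (x \<rightarrow>\<^bsub>A\<^esub> y) = h x \<rightarrow>\<^bsub>B\<^esub> h y)"

definition heyting_iso :: "'a gorder \<Rightarrow> 'b gorder \<Rightarrow> bool"
  where "heyting_iso A B \<longleftrightarrow> (\<exists>h. heyting_hom A B h \<and> bij_betw h (carrier A) (carrier B))"

definition heyting_subalgebra :: "'a set \<Rightarrow> 'a gorder \<Rightarrow> bool"
  where "heyting_subalgebra S A \<longleftrightarrow>
    S \<subseteq> carrier A \<and> \<bottom>\<^bsub>A\<^esub> \<in> S \<and> \<top>\<^bsub>A\<^esub> \<in> S \<and>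
    (\<forall>x\<in>S. \<forall>y\<in>S. x \<sqinter>\<^bsub>A\<^esub> y \<in> S \<and> x \<squnion>\<^bsub>A\<^esub> y \<in> S \<and> x \<rightarrow>\<^bsub>A\<^esub> y \<in> S)"

text \<open>
  A surjective image of \<open>B\<close> is in bijection with a set of representatives in \<open>carrier B\<close>; hence,
  up to isomorphism, every homomorphic image of \<open>B\<close> lives on the type of \<open>B\<close>, and nothing is
  lost by letting \<open>D\<close> range over that type only.
\<close>

definition subalgebra_of_hom_image :: "'c gorder \<Rightarrow> 'b gorder \<Rightarrow> bool"
  where "subalgebra_of_hom_image C B \<longleftrightarrow>
    (\<exists>(D :: 'b gorder) h S. heyting_algebra D \<and> heyting_hom B D h \<and> h ` carrier B = carrier D \<and>
       heyting_subalgebra S D \<and> heyting_iso C (D\<lparr>carrier := S\<rparr>))"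


section \<open>Formulas, equations and varieties\<close>

datatype form = Var nat | Bot | Top | And form form | Or form form | Imp form form

primrec eval :: "'a gorder \<Rightarrow> (nat \<Rightarrow> 'a) \<Rightarrow> form \<Rightarrow> 'a" where
  "eval A v (Var n) = v n"
| "eval A v Bot = \<bottom>\<^bsub>A\<^esub>"
| "eval A v Top = \<top>\<^bsub>A\<^esub>"
| "eval A v (And p q) = eval A v p \<sqinter>\<^bsub>A\<^esub> eval A v q"
| "eval A v (Or p q) = eval A v p \<squnion>\<^bsub>A\<^esub> eval A v q"
| "eval A v (Imp p q) = eval A v p \<rightarrow>\<^bsub>A\<^esub> eval A v q"

text \<open>The pair \<open>(s, t)\<close> stands for the equation \<open>s \<approx> t\<close>.\<close>

definition satisfies :: "'a gorder \<Rightarrow> form \<times> form \<Rightarrow> bool"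
  where "satisfies A e \<longleftrightarrow> (\<forall>v \<in> UNIV \<rightarrow> carrier A. eval A v (fst e) = eval A v (snd e))"

definition validates :: "'a gorder \<Rightarrow> form \<Rightarrow> bool"
  where "validates A p \<longleftrightarrow> satisfies A (p, Top)"

text \<open>
  A variety is an equationally definable class. The variety generated by a class \<open>K\<close> is the
  intersection of all varieties containing \<open>K\<close>. Since a set of equations makes sense over every
  type, the members of the generated variety may live on another type than those of \<open>K\<close>.
\<close>

definition variety :: "(form \<times> form) set \<Rightarrow> 'a gorder set"
  where "variety E = {A. heyting_algebra A \<and> (\<forall>e\<in>E. satisfies A e)}"

definition generated_variety :: "'b gorder set \<Rightarrow> 'a gorder set"
  where "generated_variety K = (\<Inter>E \<in> {E. K \<subseteq> variety E}. variety E)"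

text \<open>
  \<open>p\<close> is a Jankov formula of \<open>C\<close>, as tested by the Heyting algebras on the type \<open>'b\<close>
  (HOL cannot quantify over all types within a formula).
\<close>

definition jankov_formula :: "'b itself \<Rightarrow> 'c gorder \<Rightarrow> form \<Rightarrow> bool"
  where "jankov_formula (_ :: 'b itself) C p \<longleftrightarrow>
    (\<forall>B :: 'b gorder. heyting_algebra B \<longrightarrow>
       (validates B p \<longleftrightarrow> \<not> subalgebra_of_hom_image C B))"


section \<open>Prime spectra and upset algebras\<close>

definition prime_filter :: "'a gorder \<Rightarrow> 'a set \<Rightarrow> bool"
  where "prime_filter A F \<longleftrightarrow>
    F \<subseteq> carrier A \<and> F \<noteq> {} \<and> F \<noteq> carrier A \<and>
    (\<forall>x\<in>F. \<forall>y\<in>carrier A. x \<sqsubseteq>\<^bsub>A\<^esub> y \<longrightarrow> y \<in> F) \<and>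
    (\<forall>x\<in>F. \<forall>y\<in>F. x \<sqinter>\<^bsub>A\<^esub> y \<in> F) \<and>
    (\<forall>x\<in>carrier A. \<forall>y\<in>carrier A. x \<squnion>\<^bsub>A\<^esub> y \<in> F \<longrightarrow> x \<in> F \<or> y \<in> F)"

definition prime_spectrum :: "'a gorder \<Rightarrow> 'a set gorder"
  where "prime_spectrum A = \<lparr>carrier = {F. prime_filter A F}, eq = (=), le = (\<subseteq>)\<rparr>"

definition up :: "'a gorder \<Rightarrow> 'a \<Rightarrow> 'a set"
  where "up X x = {y \<in> carrier X. x \<sqsubseteq>\<^bsub>X\<^esub> y}"

definition subposet :: "'a gorder \<Rightarrow> 'a set \<Rightarrow> 'a gorder"
  where "subposet X S = X\<lparr>carrier := S\<rparr>"

definition Up :: "'a gorder \<Rightarrow> 'a set gorder"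
  where "Up X = \<lparr>carrier = {U. U \<subseteq> carrier X \<and> (\<forall>x\<in>U. up X x \<subseteq> U)}, eq = (=), le = (\<subseteq>)\<rparr>"

lemma carrier_Up: "carrier (Up X) = {U. U \<subseteq> carrier X \<and> (\<forall>x\<in>U. up X x \<subseteq> U)}"
  by (simp add: Up_def)

lemma partial_order_Up: "partial_order (Up X)"
  by unfold_locales (auto simp: Up_def)

lemma
  assumes "U \<in> carrier (Up X)" "V \<in> carrier (Up X)"
  shows meet_Up: "U \<sqinter>\<^bsub>Up X\<^esub> V = U \<inter> V"
    and join_Up: "U \<squnion>\<^bsub>Up X\<^esub> V = U \<union> V"
    and glb_Up: "greatest (Up X) (U \<inter> V) (Lower (Up X) {U, V})"
    and lub_Up: "least (Up X) (U \<union> V) (Upper (Up X) {U, V})"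
proof -
  interpret partial_order "Up X" by (rule partial_order_Up)
  show g: "greatest (Up X) (U \<inter> V) (Lower (Up X) {U, V})"
    using assms by (auto simp: greatest_def Lower_def Up_def)
  show l: "least (Up X) (U \<union> V) (Upper (Up X) {U, V})"
    using assms by (auto simp: least_def Upper_def Up_def)
  show "U \<sqinter>\<^bsub>Up X\<^esub> V = U \<inter> V"
    unfolding meet_def inf_def by (rule some_equality) (use g greatest_unique in blast)+
  show "U \<squnion>\<^bsub>Up X\<^esub> V = U \<union> V"
    unfolding join_def sup_def by (rule some_equality) (use l least_unique in blast)+
qed

lemma residual_Up:
  assumes X: "partial_order X" and U: "U \<in> carrier (Up X)" and V: "V \<in> carrier (Up X)"
  shows "greatest (Up X) {x \<in> carrier X. up X x \<inter> U \<subseteq> V}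
    {W \<in> carrier (Up X). U \<sqinter>\<^bsub>Up X\<^esub> W \<sqsubseteq>\<^bsub>Up X\<^esub> V}"
proof -
  interpret X: partial_order X by (rule X)
  let ?W = "{x \<in> carrier X. up X x \<inter> U \<subseteq> V}"
  have W: "?W \<in> carrier (Up X)"
    by (auto simp: carrier_Up up_def dest: X.le_trans)
  have le: "A \<sqsubseteq>\<^bsub>Up X\<^esub> B \<longleftrightarrow> A \<subseteq> B" for A B
    by (simp add: Up_def)
  have "U \<inter> ?W \<subseteq> V"
    using U by (auto simp: carrier_Up up_def)
  moreover have "W' \<subseteq> ?W" if "W' \<in> carrier (Up X)" "U \<inter> W' \<subseteq> V" for W'
    using that by (auto simp: carrier_Up)
  moreover have "{W \<in> carrier (Up X). U \<sqinter>\<^bsub>Up X\<^esub> W \<sqsubseteq>\<^bsub>Up X\<^esub> V} = {W \<in> carrier (Up X). U \<inter> W \<subseteq> V}"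
    using U by (auto simp: le meet_Up)
  ultimately show ?thesis
    using W unfolding greatest_def le by blast
qed

lemma heyting_algebra_Up:
  assumes "partial_order X"
  shows "heyting_algebra (Up X)"
proof -
  interpret partial_order "Up X" by (rule partial_order_Up)
  show ?thesis
  proof
    show "\<exists>s. least (Up X) s (Upper (Up X) {U, V})"
      if "U \<in> carrier (Up X)" "V \<in> carrier (Up X)" for U V
      using lub_Up that by blast
    show "\<exists>s. greatest (Up X) s (Lower (Up X) {U, V})"
      if "U \<in> carrier (Up X)" "V \<in> carrier (Up X)" for U V
      using glb_Up that by blast
    show "\<exists>U. least (Up X) U (carrier (Up X))"
      by (rule exI[of _ "{}"]) (auto simp: least_def Up_def)
    show "\<exists>U. greatest (Up X) U (carrier (Up X))"
      by (rule exI[of _ "carrier X"]) (auto simp: greatest_def Up_def up_def)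
    show "\<exists>W. greatest (Up X) W {W \<in> carrier (Up X). U \<sqinter>\<^bsub>Up X\<^esub> W \<sqsubseteq>\<^bsub>Up X\<^esub> V}"
      if "U \<in> carrier (Up X)" "V \<in> carrier (Up X)" for U V
      using residual_Up[OF assms] that by blast
  qed
qed

lemma heyting_imp_Up:
  assumes "partial_order X" "U \<in> carrier (Up X)" "V \<in> carrier (Up X)"
  shows "U \<rightarrow>\<^bsub>Up X\<^esub> V = {x \<in> carrier X. up X x \<inter> U \<subseteq> V}"
proof -
  interpret partial_order "Up X" by (rule partial_order_Up)
  show ?thesis
    unfolding heyting_imp_def
    by (rule some_equality) (use residual_Up[OF assms] greatest_unique in blast)+
qed


section \<open>Diamond systems\<close>

definition incomparable :: "'a gorder \<Rightarrow> 'a \<Rightarrow> 'a \<Rightarrow> bool"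
  where "incomparable X x y \<longleftrightarrow> \<not> x \<sqsubseteq>\<^bsub>X\<^esub> y \<and> \<not> y \<sqsubseteq>\<^bsub>X\<^esub> x"

definition three_point_rule :: "'a gorder \<Rightarrow> bool"
  where "three_point_rule X \<longleftrightarrow>
    (\<forall>x\<in>carrier X. \<forall>y\<in>carrier X. \<forall>z\<in>carrier X.
       x \<noteq> y \<and> x \<noteq> z \<and> y \<noteq> z \<longrightarrow> incomparable X x y \<and> x \<sqsubseteq>\<^bsub>X\<^esub> z \<longrightarrow> y \<sqsubseteq>\<^bsub>X\<^esub> z)"

definition antichain :: "'a gorder \<Rightarrow> 'a set \<Rightarrow> bool"
  where "antichain X S \<longleftrightarrow>
    S \<subseteq> carrier X \<and> (\<forall>x\<in>S. \<forall>y\<in>S. x \<noteq> y \<longrightarrow> incomparable X x y)"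

locale diamond_system = partial_order X for X :: "'a gorder" (structure) +
  assumes D1: "x \<in> carrier X \<Longrightarrow> three_point_rule (subposet X (up X x))"
    and D2: "x \<in> carrier X \<Longrightarrow> \<not> (\<exists>S. antichain (subposet X (up X x)) S \<and> card S = 3)"
    and D3: "\<lbrakk>x \<in> carrier X; y \<in> up X x; z \<in> up X x\<rbrakk> \<Longrightarrow> \<exists>w\<in>carrier X. y \<sqsubseteq> w \<and> z \<sqsubseteq> w"
    and D4: "\<lbrakk>b \<in> carrier X; x \<in> carrier X; y \<in> carrier X; z \<in> carrier X; v \<in> carrier X;
        t \<in> carrier X;
        b \<sqsubseteq> x; b \<sqsubseteq> y; x \<sqsubseteq> z; x \<sqsubseteq> v; y \<sqsubseteq> z; y \<sqsubseteq> v; z \<sqsubseteq> t; v \<sqsubseteq> t\<rbrakk>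
      \<Longrightarrow> \<exists>w\<in>carrier X. x \<sqsubseteq> w \<and> y \<sqsubseteq> w \<and> w \<sqsubseteq> z \<and> w \<sqsubseteq> v"

locale diamond_sequence = diamond_system +
  assumes common_lower_bound:
    "\<lbrakk>x \<in> carrier X; y \<in> carrier X\<rbrakk> \<Longrightarrow> \<exists>w\<in>carrier X. w \<sqsubseteq> x \<and> w \<sqsubseteq> y"

text \<open>
  Every finite poset is isomorphic to one on a set of natural numbers, so the generating class may
  be restricted to the latter.
\<close>

definition DHA :: "'a gorder set"
  where "DHA = generated_variety {Up X | X :: nat gorder. finite (carrier X) \<and> diamond_sequence X}"


section \<open>The four forbidden posets\<close>

text \<open>
  Elements are numbered in the order in which they are listed:
  \<open>0,a,b,c,1\<close> as \<open>0,1,2,3,4\<close> in \<open>P1\<close> and \<open>P2\<close>; \<open>r,a,b\<close> as \<open>0,1,2\<close> in \<open>P3\<close>;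
  \<open>0,a,b,c,d,1\<close> as \<open>0,1,2,3,4,5\<close> in \<open>P4\<close>.
\<close>

definition P1 :: "nat gorder"
  where "P1 = \<lparr>carrier = {0,1,2,3,4}, eq = (=), le = (\<lambda>x y. x = y \<or> x = 0 \<or> y = 4)\<rparr>"

definition P2 :: "nat gorder"
  where "P2 = \<lparr>carrier = {0,1,2,3,4}, eq = (=),
    le = (\<lambda>x y. x = y \<or> x = 0 \<or> y = 4 \<or> (x = 2 \<and> y = 3))\<rparr>"

definition P3 :: "nat gorder"
  where "P3 = \<lparr>carrier = {0,1,2}, eq = (=), le = (\<lambda>x y. x = y \<or> x = 0)\<rparr>"

definition P4 :: "nat gorder"
  where "P4 = \<lparr>carrier = {0,1,2,3,4,5}, eq = (=),
    le = (\<lambda>x y. x = y \<or> x = 0 \<or> y = 5 \<or> (x \<in> {1,2} \<and> y \<in> {3,4}))\<rparr>"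

lemma partial_order_P: "partial_order P1" "partial_order P2" "partial_order P3" "partial_order P4"
proof -
  have *: "partial_order \<lparr>carrier = S, eq = (=), le = r\<rparr>"
    if "reflp r" "antisymp r" "transp r" for S and r :: "nat \<Rightarrow> nat \<Rightarrow> bool"
    by unfold_locales (use that in \<open>auto dest: reflpD antisympD transpD\<close>)
  show "partial_order P1" "partial_order P2" "partial_order P3" "partial_order P4"
    unfolding P1_def P2_def P3_def P4_def
    by (rule *; auto simp: reflp_def antisymp_def transp_def)+
qed

end

theory Submission
  imports Defs "HOL-Library.Nat_Bijection"
begin

text \<open>
  All four conditions are compared with the validity of four axioms: the three point axiom, the
  width two axiom, weak excluded middle, and an interpolation axiom for (D4). They hold on every
  diamond system, and, conversely, a Heyting algebra validating them has a diamond system as its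
  prime spectrum, because a failure of (D1)--(D4) there yields a refuting valuation by the prime
  filter theorem. This gives (i) \<open>\<Rightarrow>\<close> (ii). Since each \<open>P\<^sub>i\<close> refutes one of the axioms and validity
  passes to homomorphic images and subalgebras, it also gives (ii) \<open>\<Rightarrow>\<close> (iv).

  For (ii) \<open>\<Rightarrow>\<close> (i), a refuted equation is refuted on some \<open>\<up>x\<close>. By (D1) and (D2), \<open>\<up>x\<close> is a linear
  sum of layers with at most two points, and interchanging the points of each layer is an
  automorphism. Identifying points that agree, together with their partners, on the finitely many
  relevant upsets gives a p-morphism onto a finite diamond sequence.

  For (iv) \<open>\<Rightarrow>\<close> (ii), if the prime spectrum is not a diamond system, then some \<open>\<up>x\<close> maps onto some
  \<open>P\<^sub>i\<close> by a p-morphism with clopen fibres, so \<open>Up P\<^sub>i\<close> embeds into the quotient of the algebra by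
  the filter \<open>x\<close>.
\<close>

section \<open>Homomorphic images and subalgebras\<close>

text \<open>A three-element antichain in a spectrum need not lead to \<open>P1\<close>: the clopen
  upsets separating it may leave points that see exactly two of the three sides, and then
  \<open>P2\<close> or \<open>P4\<close> appears instead. In an infinite spectrum no extremal bad
  configuration need exist that could be chosen to avoid this. What helps is that a point sees less
  and less on the way up, so one move upwards decides whether a given kind of point is seen by all
  relevant points or by none. The conditions are obtained in the order (D3), (D2), (D1), (D4):
  common upper bounds provide the top of the image, (D1) needs that antichains are already excluded,
  and (D4) uses the layered shape given by (D1) and (D2). In the finite quotient, comparing points
  by the relevant upsets alone would not give a p-morphism: a point could lie below its partner in
  the quotient without lying below it in the original poset. Recording the partner's upsets as well
  makes the comparison of two partners symmetric.\<close>

lemma partial_orderI: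
  fixes D :: "'a gorder" (structure)
  assumes "(.=) = (=)"
    and "\<And>x. x \<in> carrier D \<Longrightarrow> x \<sqsubseteq> x"
    and "\<And>x y. \<lbrakk>x \<sqsubseteq> y; y \<sqsubseteq> x; x \<in> carrier D; y \<in> carrier D\<rbrakk> \<Longrightarrow> x = y"
    and "\<And>x y z. \<lbrakk>x \<sqsubseteq> y; y \<sqsubseteq> z; x \<in> carrier D; y \<in> carrier D; z \<in> carrier D\<rbrakk> \<Longrightarrow> x \<sqsubseteq> z"
  shows "partial_order D"
  by unfold_locales (simp_all add: assms)

lemma partial_order_subset:
  fixes D :: "'a gorder" (structure)
  assumes "partial_order D" "S \<subseteq> carrier D"
  shows "partial_order (D\<lparr>carrier := S\<rparr>)"
proof -
  interpret partial_order D by (rule assms)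
  show ?thesis
  proof (rule partial_orderI)
    fix x y z
    assume "x \<sqsubseteq>\<^bsub>D\<lparr>carrier := S\<rparr>\<^esub> y" "y \<sqsubseteq>\<^bsub>D\<lparr>carrier := S\<rparr>\<^esub> z"
      "x \<in> carrier (D\<lparr>carrier := S\<rparr>)" "y \<in> carrier (D\<lparr>carrier := S\<rparr>)"
      "z \<in> carrier (D\<lparr>carrier := S\<rparr>)"
    then show "x \<sqsubseteq>\<^bsub>D\<lparr>carrier := S\<rparr>\<^esub> z"
      using assms(2) le_trans[of x y z] by auto
  qed (use assms(2) in \<open>auto simp: eq_is_equal\<close>)
qed

context heyting_algebra
begin

lemma imp_greatest:
  "\<lbrakk>x \<in> carrier L; y \<in> carrier L\<rbrakk> \<Longrightarrow> greatest L (x \<rightarrow> y) {z \<in> carrier L. x \<sqinter> z \<sqsubseteq> y}"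
  unfolding heyting_imp_def by (rule someI_ex) (rule residual_exists)

lemma imp_closed [simp]: "\<lbrakk>x \<in> carrier L; y \<in> carrier L\<rbrakk> \<Longrightarrow> x \<rightarrow> y \<in> carrier L"
  using imp_greatest by (auto simp: greatest_def)

lemma le_meet_iff:
  "\<lbrakk>x \<in> carrier L; y \<in> carrier L; z \<in> carrier L\<rbrakk> \<Longrightarrow> z \<sqsubseteq> x \<sqinter> y \<longleftrightarrow> z \<sqsubseteq> x \<and> z \<sqsubseteq> y"
  using le_trans[of z "x \<sqinter> y" x] le_trans[of z "x \<sqinter> y" y] meet_le[of z x y]
    meet_left[of x y] meet_right[of x y] by auto

lemma join_le_iff:
  "\<lbrakk>x \<in> carrier L; y \<in> carrier L; z \<in> carrier L\<rbrakk> \<Longrightarrow> x \<squnion> y \<sqsubseteq> z \<longleftrightarrow> x \<sqsubseteq> z \<and> y \<sqsubseteq> z"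
  using le_trans[of x "x \<squnion> y" z] le_trans[of y "x \<squnion> y" z] join_le[of x z y]
    join_left[of x y] join_right[of x y] by auto

lemma le_imp_iff:
  assumes "x \<in> carrier L" "y \<in> carrier L" "z \<in> carrier L"
  shows "z \<sqsubseteq> x \<rightarrow> y \<longleftrightarrow> x \<sqinter> z \<sqsubseteq> y"
proof
  assume "z \<sqsubseteq> x \<rightarrow> y"
  then have "x \<sqinter> z \<sqsubseteq> x \<sqinter> (x \<rightarrow> y)"
    using assms le_trans[of "x \<sqinter> z" z "x \<rightarrow> y"] meet_left[of x z] meet_right[of x z]
    by (simp add: le_meet_iff)
  moreover have "x \<sqinter> (x \<rightarrow> y) \<sqsubseteq> y"
    using imp_greatest[OF assms(1,2)] by (auto simp: greatest_def)
  ultimately show "x \<sqinter> z \<sqsubseteq> y"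
    using assms le_trans[of "x \<sqinter> z" "x \<sqinter> (x \<rightarrow> y)" y] by simp
next
  assume "x \<sqinter> z \<sqsubseteq> y"
  then show "z \<sqsubseteq> x \<rightarrow> y"
    using imp_greatest[OF assms(1,2)] assms(3) by (auto simp: greatest_def)
qed

end

text \<open>Lattice operations of a \<open>gorder\<close> are Hilbert choices of extremal elements
  relative to its carrier, so a new carrier or order changes them a priori. The adjunction laws pin
  them down, and the required bounds exist as a by-product. Used for subalgebras and for the
  quotient by a prime filter.\<close>

lemma heyting_algebra_from_operations:
  fixes D :: "'a gorder" (structure)
  assumes D: "partial_order D"
    and closed: "\<And>x y. \<lbrakk>x \<in> carrier D; y \<in> carrier D\<rbrakk> \<Longrightarrow>
      m x y \<in> carrier D \<and> j x y \<in> carrier D \<and> i x y \<in> carrier D"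
    and bt: "b \<in> carrier D" "t \<in> carrier D"
      "\<And>x. x \<in> carrier D \<Longrightarrow> b \<sqsubseteq> x" "\<And>x. x \<in> carrier D \<Longrightarrow> x \<sqsubseteq> t"
    and m: "\<And>x y z. \<lbrakk>x \<in> carrier D; y \<in> carrier D; z \<in> carrier D\<rbrakk> \<Longrightarrow>
      z \<sqsubseteq> m x y \<longleftrightarrow> z \<sqsubseteq> x \<and> z \<sqsubseteq> y"
    and j: "\<And>x y z. \<lbrakk>x \<in> carrier D; y \<in> carrier D; z \<in> carrier D\<rbrakk> \<Longrightarrow>
      j x y \<sqsubseteq> z \<longleftrightarrow> x \<sqsubseteq> z \<and> y \<sqsubseteq> z"
    and i: "\<And>x y z. \<lbrakk>x \<in> carrier D; y \<in> carrier D; z \<in> carrier D\<rbrakk> \<Longrightarrow>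
      z \<sqsubseteq> i x y \<longleftrightarrow> m x z \<sqsubseteq> y"
  shows "heyting_algebra D" "\<bottom> = b" "\<top> = t"
    "\<lbrakk>x \<in> carrier D; y \<in> carrier D\<rbrakk> \<Longrightarrow> x \<sqinter> y = m x y"
    "\<lbrakk>x \<in> carrier D; y \<in> carrier D\<rbrakk> \<Longrightarrow> x \<squnion> y = j x y"
    "\<lbrakk>x \<in> carrier D; y \<in> carrier D\<rbrakk> \<Longrightarrow> x \<rightarrow> y = i x y"
proof -
  interpret D: partial_order D by (rule D)
  have gm: "greatest D (m x y) (Lower D {x, y})" if "x \<in> carrier D" "y \<in> carrier D" for x y
    using that closed m[of x y] m[of x y "m x y"] by (auto simp: greatest_def Lower_def)
  have lj: "least D (j x y) (Upper D {x, y})" if "x \<in> carrier D" "y \<in> carrier D" for x y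
    using that closed j[of x y] j[of x y "j x y"] by (auto simp: least_def Upper_def)
  show meet: "x \<sqinter> y = m x y" if "x \<in> carrier D" "y \<in> carrier D" for x y
    unfolding meet_def inf_def
    by (rule some_equality) (use gm[OF that] D.greatest_unique in blast)+
  show "x \<squnion> y = j x y" if "x \<in> carrier D" "y \<in> carrier D" for x y
    unfolding join_def sup_def
    by (rule some_equality) (use lj[OF that] D.least_unique in blast)+
  have gi: "greatest D (i x y) {z \<in> carrier D. x \<sqinter> z \<sqsubseteq> y}"
    if "x \<in> carrier D" "y \<in> carrier D" for x y
    using that closed i[of x y] i[of x y "i x y"] meet by (auto simp: greatest_def)
  show "x \<rightarrow> y = i x y" if "x \<in> carrier D" "y \<in> carrier D" for x y
    unfolding heyting_imp_def
    by (rule some_equality) (use gi[OF that] D.greatest_unique in blast)+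
  have lb: "least D b (carrier D)" and gt: "greatest D t (carrier D)"
    using bt by (auto simp: least_def greatest_def)
  show "\<bottom> = b"
    unfolding bottom_def by (rule some_equality) (use lb D.least_unique in blast)+
  show "\<top> = t"
    unfolding top_def by (rule some_equality) (use gt D.greatest_unique in blast)+
  show "heyting_algebra D"
    by unfold_locales (use gm lj gi lb gt in blast)+
qed

text \<open>Operations of the restricted record are computed afresh inside \<open>S\<close>. They
  agree with those of \<open>D\<close> because the extremal element of the larger carrier already
  lies in \<open>S\<close>.\<close>

lemma
  fixes D :: "'a gorder" (structure)
  assumes D: "heyting_algebra D" and S: "heyting_subalgebra S D"
  shows bottom_subalgebra: "\<bottom>\<^bsub>D\<lparr>carrier := S\<rparr>\<^esub> = \<bottom>"
    and top_subalgebra: "\<top>\<^bsub>D\<lparr>carrier := S\<rparr>\<^esub> = \<top>"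
    and meet_subalgebra: "\<lbrakk>x \<in> S; y \<in> S\<rbrakk> \<Longrightarrow> x \<sqinter>\<^bsub>D\<lparr>carrier := S\<rparr>\<^esub> y = x \<sqinter> y"
    and join_subalgebra: "\<lbrakk>x \<in> S; y \<in> S\<rbrakk> \<Longrightarrow> x \<squnion>\<^bsub>D\<lparr>carrier := S\<rparr>\<^esub> y = x \<squnion> y"
    and imp_subalgebra: "\<lbrakk>x \<in> S; y \<in> S\<rbrakk> \<Longrightarrow> x \<rightarrow>\<^bsub>D\<lparr>carrier := S\<rparr>\<^esub> y = x \<rightarrow> y"
proof -
  interpret D: heyting_algebra D by (rule D)
  have sub: "x \<in> carrier D" if "x \<in> S" for x
    using S that by (auto simp: heyting_subalgebra_def)
  have po: "partial_order (D\<lparr>carrier := S\<rparr>)"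
    using sub by (intro partial_order_subset D.partial_order_axioms) blast
  have closed: "x \<sqinter> y \<in> S \<and> x \<squnion> y \<in> S \<and> x \<rightarrow> y \<in> S" if "x \<in> S" "y \<in> S" for x y
    using S that by (auto simp: heyting_subalgebra_def)
  have bt: "\<bottom> \<in> S" "\<top> \<in> S"
    using S by (auto simp: heyting_subalgebra_def)
  note ops = heyting_algebra_from_operations[OF po,
      of "(\<sqinter>)" "(\<squnion>)" "heyting_imp D" "\<bottom>" "\<top>"]
  show "\<bottom>\<^bsub>D\<lparr>carrier := S\<rparr>\<^esub> = \<bottom>"
    by (rule ops(2)) (use sub closed bt D.le_meet_iff D.join_le_iff D.le_imp_iff in simp_all)
  show "\<top>\<^bsub>D\<lparr>carrier := S\<rparr>\<^esub> = \<top>"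
    by (rule ops(3)) (use sub closed bt D.le_meet_iff D.join_le_iff D.le_imp_iff in simp_all)
  show "x \<sqinter>\<^bsub>D\<lparr>carrier := S\<rparr>\<^esub> y = x \<sqinter> y" if "x \<in> S" "y \<in> S" for x y
    by (rule ops(4)) (use sub closed bt D.le_meet_iff D.join_le_iff D.le_imp_iff that in simp_all)
  show "x \<squnion>\<^bsub>D\<lparr>carrier := S\<rparr>\<^esub> y = x \<squnion> y" if "x \<in> S" "y \<in> S" for x y
    by (rule ops(5)) (use sub closed bt D.le_meet_iff D.join_le_iff D.le_imp_iff that in simp_all)
  show "x \<rightarrow>\<^bsub>D\<lparr>carrier := S\<rparr>\<^esub> y = x \<rightarrow> y" if "x \<in> S" "y \<in> S" for x y
    by (rule ops(6)) (use sub closed bt D.le_meet_iff D.join_le_iff D.le_imp_iff that in simp_all)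
qed

section \<open>Validity under homomorphic images and embeddings\<close>

lemma eval_closed:
  assumes "heyting_algebra A" "v \<in> UNIV \<rightarrow> carrier A"
  shows "eval A v p \<in> carrier A"
proof -
  interpret heyting_algebra A by (rule assms)
  show ?thesis
    using assms(2) by (induction p) auto
qed

lemma eval_hom:
  assumes "heyting_algebra A" "heyting_hom A B h" "v \<in> UNIV \<rightarrow> carrier A"
  shows "eval B (h \<circ> v) p = h (eval A v p)"
  using assms(2) eval_closed[OF assms(1,3)] by (induction p) (auto simp: heyting_hom_def)

lemma validates_surj_hom:
  fixes A :: "'a gorder" and B :: "'b gorder"
  assumes A: "heyting_algebra A" and B: "heyting_algebra B"
    and h: "heyting_hom A B h" and surj: "carrier B \<subseteq> h ` carrier A"
    and val: "validates A p"
  shows "validates B p"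
  unfolding validates_def satisfies_def
proof (intro ballI, simp)
  fix w :: "nat \<Rightarrow> 'b"
  assume w: "w \<in> UNIV \<rightarrow> carrier B"
  have "\<forall>n. \<exists>a. a \<in> carrier A \<and> h a = w n"
    using w surj by (auto simp: Pi_iff) (metis imageE subsetD)
  then obtain v where v: "\<And>n. v n \<in> carrier A" "\<And>n. h (v n) = w n"
    by metis
  have "w = h \<circ> v"
    by (simp add: fun_eq_iff v(2))
  then show "eval B w p = \<top>\<^bsub>B\<^esub>"
    using eval_hom[OF A h, of v p] val v(1) h
    by (auto simp: validates_def satisfies_def heyting_hom_def)
qed

lemma validates_inj_hom:
  fixes A :: "'a gorder" and B :: "'b gorder"
  assumes A: "heyting_algebra A" and B: "heyting_algebra B"
    and h: "heyting_hom A B h" and inj: "inj_on h (carrier A)"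
    and val: "validates B p"
  shows "validates A p"
  unfolding validates_def satisfies_def
proof (intro ballI, simp)
  interpret A: heyting_algebra A by (rule A)
  fix v :: "nat \<Rightarrow> 'a"
  assume v: "v \<in> UNIV \<rightarrow> carrier A"
  have "h \<circ> v \<in> UNIV \<rightarrow> carrier B"
    using v h by (auto simp: heyting_hom_def)
  then have "h (eval A v p) = h \<top>\<^bsub>A\<^esub>"
    using eval_hom[OF A h v, of p] val h
    by (auto simp: validates_def satisfies_def heyting_hom_def)
  then show "eval A v p = \<top>\<^bsub>A\<^esub>"
    using eval_closed[OF A v] inj by (auto dest: inj_onD)
qed

lemma validates_subalgebra_of_hom_image:
  fixes C :: "'c gorder" and B :: "'b gorder"
  assumes C: "heyting_algebra C" and B: "heyting_algebra B"
    and CB: "subalgebra_of_hom_image C B" and val: "validates B p"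
  shows "validates C p"
proof -
  obtain D :: "'b gorder" and h S where D: "heyting_algebra D" and h: "heyting_hom B D h" "h ` carrier B = carrier D"
    and S: "heyting_subalgebra S D" and iso: "heyting_iso C (D\<lparr>carrier := S\<rparr>)"
    using CB unfolding subalgebra_of_hom_image_def by blast
  obtain k where k: "heyting_hom C (D\<lparr>carrier := S\<rparr>) k" "bij_betw k (carrier C) S"
    using iso by (auto simp: heyting_iso_def)
  have "validates D p"
    using validates_surj_hom[OF B D h(1) _ val] h(2) by simp
  moreover have "heyting_hom C D k"
    using k S by (auto simp: heyting_hom_def heyting_subalgebra_def Pi_iff subset_iff
        bottom_subalgebra[OF D S] top_subalgebra[OF D S] meet_subalgebra[OF D S]
        join_subalgebra[OF D S] imp_subalgebra[OF D S])
  ultimately show ?thesis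
    using validates_inj_hom[OF C D] k(2) by (auto simp: bij_betw_def)
qed

section \<open>Prime filters\<close>

text \<open>The improper filter is allowed, so that \<open>filter_join\<close> always gives a
  filter; properness comes later from disjointness from a nonempty ideal.\<close>

definition lattice_filter :: "'a gorder \<Rightarrow> 'a set \<Rightarrow> bool"
  where "lattice_filter A F \<longleftrightarrow> F \<subseteq> carrier A \<and> F \<noteq> {} \<and>
    (\<forall>x\<in>F. \<forall>y\<in>carrier A. x \<sqsubseteq>\<^bsub>A\<^esub> y \<longrightarrow> y \<in> F) \<and> (\<forall>x\<in>F. \<forall>y\<in>F. x \<sqinter>\<^bsub>A\<^esub> y \<in> F)"

definition lattice_ideal :: "'a gorder \<Rightarrow> 'a set \<Rightarrow> bool"
  where "lattice_ideal A I \<longleftrightarrow> I \<subseteq> carrier A \<and> I \<noteq> {} \<and>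
    (\<forall>x\<in>I. \<forall>y\<in>carrier A. y \<sqsubseteq>\<^bsub>A\<^esub> x \<longrightarrow> y \<in> I) \<and> (\<forall>x\<in>I. \<forall>y\<in>I. x \<squnion>\<^bsub>A\<^esub> y \<in> I)"

definition filter_join :: "'a gorder \<Rightarrow> 'a set \<Rightarrow> 'a set \<Rightarrow> 'a set"
  where "filter_join A F G = {c \<in> carrier A. \<exists>f\<in>F. \<exists>g\<in>G. f \<sqinter>\<^bsub>A\<^esub> g \<sqsubseteq>\<^bsub>A\<^esub> c}"

definition ideal_join :: "'a gorder \<Rightarrow> 'a set \<Rightarrow> 'a set \<Rightarrow> 'a set"
  where "ideal_join A I J = {c \<in> carrier A. \<exists>i\<in>I. \<exists>j\<in>J. c \<sqsubseteq>\<^bsub>A\<^esub> i \<squnion>\<^bsub>A\<^esub> j}"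

lemma prime_filter_imp_filter: "prime_filter A F \<Longrightarrow> lattice_filter A F"
  by (auto simp: prime_filter_def lattice_filter_def)

text \<open>Prime filters and spectra are stated for plain \<open>gorder\<close> records, whereas
  \<open>heyting_algebra\<close> also admits extended ones; this locale fixes the type.\<close>

locale heyting_gorder = heyting_algebra L for L :: "'a gorder" (structure)
begin

lemma meet_mono:
  assumes "a \<sqsubseteq> a'" "b \<sqsubseteq> b'" "a \<in> carrier L" "a' \<in> carrier L" "b \<in> carrier L" "b' \<in> carrier L"
  shows "a \<sqinter> b \<sqsubseteq> a' \<sqinter> b'"
  using assms meet_left[of a b] meet_right[of a b] le_trans[of "a \<sqinter> b" a a'] le_trans[of "a \<sqinter> b" b b']
  by (simp add: le_meet_iff)

lemma join_mono:
  assumes "a \<sqsubseteq> a'" "b \<sqsubseteq> b'" "a \<in> carrier L" "a' \<in> carrier L" "b \<in> carrier L" "b' \<in> carrier L"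
  shows "a \<squnion> b \<sqsubseteq> a' \<squnion> b'"
  using assms join_left[of a' b'] join_right[of a' b'] le_trans[of a a' "a' \<squnion> b'"] le_trans[of b b' "a' \<squnion> b'"]
  by (simp add: join_le_iff)

lemma principal_filter: "a \<in> carrier L \<Longrightarrow> lattice_filter L {c \<in> carrier L. a \<sqsubseteq> c}"
  unfolding lattice_filter_def using le_trans[of a] le_refl by (blast intro: meet_le meet_closed)

lemma principal_ideal: "a \<in> carrier L \<Longrightarrow> lattice_ideal L {c \<in> carrier L. c \<sqsubseteq> a}"
  unfolding lattice_ideal_def using le_trans[of _ _ a] le_refl by (blast intro: join_le join_closed)

lemma prime_filter_compl_ideal:
  assumes "prime_filter L F"
  shows "lattice_ideal L (carrier L - F)"
  using assms unfolding prime_filter_def lattice_ideal_def by (blast intro: join_closed)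

lemma
  assumes F: "lattice_filter L F" and G: "lattice_filter L G"
  shows filter_filter_join: "lattice_filter L (filter_join L F G)"
    and filter_join_upper: "F \<subseteq> filter_join L F G" "G \<subseteq> filter_join L F G"
proof -
  have FC: "F \<subseteq> carrier L" and GC: "G \<subseteq> carrier L" and ne: "F \<noteq> {}" "G \<noteq> {}"
    using F G by (auto simp: lattice_filter_def)
  show FJ: "F \<subseteq> filter_join L F G"
  proof
    fix f assume f: "f \<in> F"
    obtain g where g: "g \<in> G" using ne by auto
    have "f \<sqinter> g \<sqsubseteq> f" using f g FC GC by (auto intro: meet_left)
    with f g FC show "f \<in> filter_join L F G" by (auto simp: filter_join_def)
  qed
  show "G \<subseteq> filter_join L F G"
  proof
    fix g assume g: "g \<in> G"
    obtain f where f: "f \<in> F" using ne by auto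
    have "f \<sqinter> g \<sqsubseteq> g" using f g FC GC by (auto intro: meet_right)
    with f g GC show "g \<in> filter_join L F G" by (auto simp: filter_join_def)
  qed
  show "lattice_filter L (filter_join L F G)"
    unfolding lattice_filter_def
  proof (intro conjI ballI impI)
    show "filter_join L F G \<subseteq> carrier L" by (auto simp: filter_join_def)
    show "filter_join L F G \<noteq> {}" using FJ ne by auto
  next
    fix x y assume x: "x \<in> filter_join L F G" and y: "y \<in> carrier L" "x \<sqsubseteq> y"
    then obtain f g where fg: "f \<in> F" "g \<in> G" "f \<sqinter> g \<sqsubseteq> x" "x \<in> carrier L"
      by (auto simp: filter_join_def)
    moreover have "f \<in> carrier L" "g \<in> carrier L" using fg FC GC by blast+
    ultimately have "f \<sqinter> g \<sqsubseteq> y"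
      using y le_trans[of "f \<sqinter> g" x y] by simp
    with fg y show "y \<in> filter_join L F G" by (auto simp: filter_join_def)
  next
    fix x y assume x: "x \<in> filter_join L F G" and y: "y \<in> filter_join L F G"
    obtain f g where fg: "f \<in> F" "g \<in> G" "f \<sqinter> g \<sqsubseteq> x" "x \<in> carrier L"
      using x by (auto simp: filter_join_def)
    obtain f' g' where fg': "f' \<in> F" "g' \<in> G" "f' \<sqinter> g' \<sqsubseteq> y" "y \<in> carrier L"
      using y by (auto simp: filter_join_def)
    have C: "f \<in> carrier L" "g \<in> carrier L" "f' \<in> carrier L" "g' \<in> carrier L"
      using fg fg' FC GC by auto
    have m: "f \<sqinter> f' \<in> F" "g \<sqinter> g' \<in> G"
      using F G fg fg' by (auto simp: lattice_filter_def)
    have "(f \<sqinter> f') \<sqinter> (g \<sqinter> g') \<sqsubseteq> f \<sqinter> g" "(f \<sqinter> f') \<sqinter> (g \<sqinter> g') \<sqsubseteq> f' \<sqinter> g'"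
      using C by (auto intro!: meet_mono meet_left meet_right)
    then have "(f \<sqinter> f') \<sqinter> (g \<sqinter> g') \<sqsubseteq> x \<sqinter> y"
      using C fg fg' le_trans[of "(f \<sqinter> f') \<sqinter> (g \<sqinter> g')" "f \<sqinter> g" x]
        le_trans[of "(f \<sqinter> f') \<sqinter> (g \<sqinter> g')" "f' \<sqinter> g'" y]
      by (auto simp: le_meet_iff)
    moreover have "x \<sqinter> y \<in> carrier L" using fg fg' by simp
    ultimately show "x \<sqinter> y \<in> filter_join L F G"
      using m unfolding filter_join_def by blast
  qed
qed

lemma
  assumes F: "lattice_ideal L F" and G: "lattice_ideal L G"
  shows ideal_ideal_join: "lattice_ideal L (ideal_join L F G)"
    and ideal_join_upper: "F \<subseteq> ideal_join L F G" "G \<subseteq> ideal_join L F G"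
proof -
  have FC: "F \<subseteq> carrier L" and GC: "G \<subseteq> carrier L" and ne: "F \<noteq> {}" "G \<noteq> {}"
    using F G by (auto simp: lattice_ideal_def)
  show FJ: "F \<subseteq> ideal_join L F G"
  proof
    fix f assume f: "f \<in> F"
    obtain g where g: "g \<in> G" using ne by auto
    have "f \<sqsubseteq> f \<squnion> g" using f g FC GC by (auto intro: join_left)
    with f g FC show "f \<in> ideal_join L F G" by (auto simp: ideal_join_def)
  qed
  show "G \<subseteq> ideal_join L F G"
  proof
    fix g assume g: "g \<in> G"
    obtain f where f: "f \<in> F" using ne by auto
    have "g \<sqsubseteq> f \<squnion> g" using f g FC GC by (auto intro: join_right)
    with f g GC show "g \<in> ideal_join L F G" by (auto simp: ideal_join_def)
  qed
  show "lattice_ideal L (ideal_join L F G)"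
    unfolding lattice_ideal_def
  proof (intro conjI ballI impI)
    show "ideal_join L F G \<subseteq> carrier L" by (auto simp: ideal_join_def)
    show "ideal_join L F G \<noteq> {}" using FJ ne by auto
  next
    fix x y assume x: "x \<in> ideal_join L F G" and y: "y \<in> carrier L" "y \<sqsubseteq> x"
    then obtain f g where fg: "f \<in> F" "g \<in> G" "x \<sqsubseteq> f \<squnion> g" "x \<in> carrier L"
      by (auto simp: ideal_join_def)
    moreover have "f \<in> carrier L" "g \<in> carrier L" using fg FC GC by blast+
    ultimately have "y \<sqsubseteq> f \<squnion> g"
      using y le_trans[of y x "f \<squnion> g"] by simp
    with fg y show "y \<in> ideal_join L F G" by (auto simp: ideal_join_def)
  next
    fix x y assume x: "x \<in> ideal_join L F G" and y: "y \<in> ideal_join L F G"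
    obtain f g where fg: "f \<in> F" "g \<in> G" "x \<sqsubseteq> f \<squnion> g" "x \<in> carrier L"
      using x by (auto simp: ideal_join_def)
    obtain f' g' where fg': "f' \<in> F" "g' \<in> G" "y \<sqsubseteq> f' \<squnion> g'" "y \<in> carrier L"
      using y by (auto simp: ideal_join_def)
    have C: "f \<in> carrier L" "g \<in> carrier L" "f' \<in> carrier L" "g' \<in> carrier L"
      using fg fg' FC GC by auto
    have m: "f \<squnion> f' \<in> F" "g \<squnion> g' \<in> G"
      using F G fg fg' by (auto simp: lattice_ideal_def)
    have "f \<squnion> g \<sqsubseteq> (f \<squnion> f') \<squnion> (g \<squnion> g')" "f' \<squnion> g' \<sqsubseteq> (f \<squnion> f') \<squnion> (g \<squnion> g')"
      using C by (auto intro!: join_mono join_left join_right)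
    then have "x \<squnion> y \<sqsubseteq> (f \<squnion> f') \<squnion> (g \<squnion> g')"
      using C fg fg' le_trans[of x "f \<squnion> g" "(f \<squnion> f') \<squnion> (g \<squnion> g')"]
        le_trans[of y "f' \<squnion> g'" "(f \<squnion> f') \<squnion> (g \<squnion> g')"]
      by (auto simp: join_le_iff)
    moreover have "x \<squnion> y \<in> carrier L" using fg fg' by simp
    ultimately show "x \<squnion> y \<in> ideal_join L F G"
      using m unfolding ideal_join_def by blast
  qed
qed

text \<open>That adjoining \<open>a\<close> to \<open>F\<close> hits \<open>I\<close> is recorded by
  residuation as an inequality with \<open>a\<close> alone on the left, so that two such
  inequalities can be joined.\<close>

lemma filter_meet_ideal:
  assumes F: "lattice_filter L F" and I: "lattice_ideal L I"
    and a: "a \<in> carrier L" "filter_join L F {c \<in> carrier L. a \<sqsubseteq> c} \<inter> I \<noteq> {}"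
  obtains f i where "f \<in> F" "i \<in> I" "a \<sqsubseteq> f \<rightarrow> i"
proof -
  obtain f c i where fci: "f \<in> F" "c \<in> carrier L" "a \<sqsubseteq> c" "f \<sqinter> c \<sqsubseteq> i" "i \<in> I"
    using a(2) by (auto simp: filter_join_def)
  have C: "f \<in> carrier L" "i \<in> carrier L"
    using fci F I by (auto simp: lattice_filter_def lattice_ideal_def)
  have "c \<sqsubseteq> f \<rightarrow> i"
    using fci C by (simp add: le_imp_iff)
  then have "a \<sqsubseteq> f \<rightarrow> i"
    using fci(2,3) C a(1) le_trans[of a c "f \<rightarrow> i"] by simp
  with fci that show thesis by blast
qed

text \<open>A filter maximal among those containing \<open>F\<close> and avoiding \<open>I\<close>
  is prime: an element outside it, once adjoined, hits \<open>I\<close>, and two such witnesses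
  combine into one for the join.\<close>

lemma prime_filter_exists:
  assumes F: "lattice_filter L F" and I: "lattice_ideal L I" and disj: "F \<inter> I = {}"
  obtains G where "prime_filter L G" "F \<subseteq> G" "G \<inter> I = {}"
proof -
  let ?S = "{G. lattice_filter L G \<and> F \<subseteq> G \<and> G \<inter> I = {}}"
  have "\<exists>G\<in>?S. \<forall>H\<in>?S. G \<subseteq> H \<longrightarrow> H = G"
  proof (rule subset_Zorn_nonempty)
    show "?S \<noteq> {}" using F disj by blast
    fix C assume ne: "C \<noteq> {}" and "subset.chain ?S C"
    then have C: "\<And>G. G \<in> C \<Longrightarrow> G \<in> ?S" and tot: "\<And>G H. \<lbrakk>G \<in> C; H \<in> C\<rbrakk> \<Longrightarrow> G \<subseteq> H \<or> H \<subseteq> G"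
      by (auto simp: subset_chain_def)
    have "lattice_filter L (\<Union>C)"
      unfolding lattice_filter_def
    proof (intro conjI ballI impI)
      have "G \<subseteq> carrier L" if "G \<in> C" for G using C[OF that] by (simp add: lattice_filter_def)
      then show "\<Union>C \<subseteq> carrier L" by blast
      obtain G where "G \<in> C" using ne by auto
      then show "\<Union>C \<noteq> {}" using C[of G] by (auto simp: lattice_filter_def)
    next
      fix x y assume xy: "x \<in> \<Union>C" "y \<in> carrier L" "x \<sqsubseteq> y"
      then obtain G where "G \<in> C" "x \<in> G" by blast
      with xy C[of G] have "y \<in> G" by (simp add: lattice_filter_def)
      with \<open>G \<in> C\<close> show "y \<in> \<Union>C" by blast
    next
      fix x y assume "x \<in> \<Union>C" "y \<in> \<Union>C"
      then obtain G H where "G \<in> C" "x \<in> G" "H \<in> C" "y \<in> H" by blast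
      then obtain K where "K \<in> C" "x \<in> K" "y \<in> K" using tot by blast
      then have "x \<sqinter> y \<in> K" using C[of K] by (simp add: lattice_filter_def)
      with \<open>K \<in> C\<close> show "x \<sqinter> y \<in> \<Union>C" by blast
    qed
    moreover have "F \<subseteq> G" "G \<inter> I = {}" if "G \<in> C" for G
      using C[OF that] by simp_all
    then have "F \<subseteq> \<Union>C" "\<Union>C \<inter> I = {}" using ne by blast+
    ultimately show "\<Union>C \<in> ?S" by simp
  qed
  then obtain G where GS: "G \<in> ?S" and maxS: "\<forall>H\<in>?S. G \<subseteq> H \<longrightarrow> H = G"
    by (rule bexE)
  have G: "lattice_filter L G" "F \<subseteq> G" "G \<inter> I = {}"
    using GS by simp_all
  have max: "H = G" if "lattice_filter L H" "F \<subseteq> H" "H \<inter> I = {}" "G \<subseteq> H" for H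
    using maxS that by simp
  have *: "\<exists>f\<in>G. \<exists>i\<in>I. a \<sqsubseteq> f \<rightarrow> i" if a: "a \<in> carrier L" "a \<notin> G" for a
  proof -
    let ?H = "filter_join L G {c \<in> carrier L. a \<sqsubseteq> c}"
    have H: "a \<in> ?H" "G \<subseteq> ?H" "lattice_filter L ?H"
      using filter_join_upper[OF G(1) principal_filter[OF a(1)]]
        filter_filter_join[OF G(1) principal_filter[OF a(1)]] a(1) by auto
    have "?H \<inter> I \<noteq> {}"
    proof
      assume "?H \<inter> I = {}"
      then have "?H = G" using max[OF H(3) order_trans[OF G(2) H(2)]] H(2) by simp
      then show False using H(1) a(2) by simp
    qed
    from filter_meet_ideal[OF G(1) I a(1) this] show ?thesis by metis
  qed
  have "prime_filter L G"
    unfolding prime_filter_def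
  proof (intro conjI)
    show "G \<noteq> carrier L" using G(3) I by (auto simp: lattice_ideal_def)
    show "\<forall>x\<in>carrier L. \<forall>y\<in>carrier L. x \<squnion> y \<in> G \<longrightarrow> x \<in> G \<or> y \<in> G"
    proof (intro ballI impI, rule ccontr)
      fix x y assume xy: "x \<in> carrier L" "y \<in> carrier L" "x \<squnion> y \<in> G" "\<not> (x \<in> G \<or> y \<in> G)"
      obtain f i g j where f: "f \<in> G" "i \<in> I" "x \<sqsubseteq> f \<rightarrow> i" and g: "g \<in> G" "j \<in> I" "y \<sqsubseteq> g \<rightarrow> j"
        using *[of x] *[of y] xy by blast
      have C: "f \<in> carrier L" "i \<in> carrier L" "g \<in> carrier L" "j \<in> carrier L"
        using f g G(1) I by (auto simp: lattice_filter_def lattice_ideal_def)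
      have k: "f \<sqinter> g \<in> G" "i \<squnion> j \<in> I"
        using f g G(1) I by (auto simp: lattice_filter_def lattice_ideal_def)
      have "f \<sqinter> x \<sqsubseteq> i" "g \<sqinter> y \<sqsubseteq> j"
        using f g C xy by (auto simp: le_imp_iff)
      moreover have "(f \<sqinter> g) \<sqinter> x \<sqsubseteq> f \<sqinter> x" "(f \<sqinter> g) \<sqinter> y \<sqsubseteq> g \<sqinter> y"
        using C xy by (auto intro!: meet_mono meet_left meet_right)
      moreover have "i \<sqsubseteq> i \<squnion> j" "j \<sqsubseteq> i \<squnion> j"
        using C by (auto intro: join_left join_right)
      ultimately have "(f \<sqinter> g) \<sqinter> x \<sqsubseteq> i \<squnion> j" "(f \<sqinter> g) \<sqinter> y \<sqsubseteq> i \<squnion> j"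
        using C xy le_trans[of "(f \<sqinter> g) \<sqinter> x" "f \<sqinter> x" "i \<squnion> j"] le_trans[of "f \<sqinter> x" i "i \<squnion> j"]
          le_trans[of "(f \<sqinter> g) \<sqinter> y" "g \<sqinter> y" "i \<squnion> j"] le_trans[of "g \<sqinter> y" j "i \<squnion> j"]
        by simp_all
      then have "x \<sqsubseteq> (f \<sqinter> g) \<rightarrow> (i \<squnion> j)" "y \<sqsubseteq> (f \<sqinter> g) \<rightarrow> (i \<squnion> j)"
        using C xy by (simp_all add: le_imp_iff)
      \<comment> \<open>Residuation stands in for distributivity: \<open>x\<close> and
        \<open>y\<close> lie below one implication, hence so does their join.\<close>
      then have "x \<squnion> y \<sqsubseteq> (f \<sqinter> g) \<rightarrow> (i \<squnion> j)"
        using C xy by (simp add: join_le)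
      then have "(f \<sqinter> g) \<sqinter> (x \<squnion> y) \<sqsubseteq> i \<squnion> j"
        using C xy by (simp add: le_imp_iff)
      moreover have "(f \<sqinter> g) \<sqinter> (x \<squnion> y) \<in> G"
        using G(1) k xy by (simp add: lattice_filter_def)
      moreover have "i \<squnion> j \<in> carrier L"
        using C by simp
      ultimately have "i \<squnion> j \<in> G"
        using G(1) unfolding lattice_filter_def by blast
      with k G(3) show False by blast
    qed
  qed (use G(1) in \<open>simp_all add: lattice_filter_def\<close>)
  with G that show thesis by blast
qed

lemma prime_filter_separates:
  assumes "a \<in> carrier L" "b \<in> carrier L" "\<not> a \<sqsubseteq> b"
  obtains F where "prime_filter L F" "a \<in> F" "b \<notin> F"
proof -
  have "{c \<in> carrier L. a \<sqsubseteq> c} \<inter> {c \<in> carrier L. c \<sqsubseteq> b} = {}"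
    using assms le_trans[of a _ b] by auto
  from prime_filter_exists[OF principal_filter[OF assms(1)] principal_ideal[OF assms(2)] this]
  obtain G where "prime_filter L G" "{c \<in> carrier L. a \<sqsubseteq> c} \<subseteq> G" "G \<inter> {c \<in> carrier L. c \<sqsubseteq> b} = {}"
    by blast
  with assms that[of G] show thesis by auto
qed

context
  fixes F
  assumes F: "prime_filter L F"
begin

lemma up_prime: "\<lbrakk>a \<in> F; a \<sqsubseteq> b; b \<in> carrier L\<rbrakk> \<Longrightarrow> b \<in> F"
  using F unfolding prime_filter_def by blast

lemma closed_prime: "a \<in> F \<Longrightarrow> a \<in> carrier L"
  using F unfolding prime_filter_def by blast

lemma bottom_prime: "\<bottom> \<notin> F"
proof
  assume "\<bottom> \<in> F"
  then have "F = carrier L" using up_prime bottom_lower closed_prime by blast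
  then show False using F unfolding prime_filter_def by blast
qed

lemma top_prime: "\<top> \<in> F"
proof -
  obtain a where "a \<in> F" using F by (auto simp: prime_filter_def)
  then show ?thesis using up_prime[of a \<top>] closed_prime top_higher top_closed by blast
qed

lemma meet_prime:
  assumes "a \<in> carrier L" "b \<in> carrier L"
  shows "a \<sqinter> b \<in> F \<longleftrightarrow> a \<in> F \<and> b \<in> F"
proof -
  have "\<lbrakk>a \<in> F; b \<in> F\<rbrakk> \<Longrightarrow> a \<sqinter> b \<in> F"
    using F unfolding prime_filter_def by blast
  then show ?thesis
    using assms up_prime[of "a \<sqinter> b"] meet_left[of a b] meet_right[of a b] by blast
qed

lemma join_prime:
  assumes "a \<in> carrier L" "b \<in> carrier L"
  shows "a \<squnion> b \<in> F \<longleftrightarrow> a \<in> F \<or> b \<in> F"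
proof -
  have "a \<squnion> b \<in> F \<Longrightarrow> a \<in> F \<or> b \<in> F"
    using F assms unfolding prime_filter_def by blast
  then show ?thesis
    using assms up_prime[of _ "a \<squnion> b"] join_left[of a b] join_right[of a b] join_closed by blast
qed

end

text \<open>Given \<open>all\<close>, the filter generated by \<open>F\<close> and \<open>a\<close>
  cannot miss the ideal below \<open>b\<close>, since the prime filter theorem would extend it to a
  counterexample. Residuating the resulting inequality puts the implication into
  \<open>F\<close>.\<close>

lemma imp_prime:
  assumes F: "prime_filter L F" and ab: "a \<in> carrier L" "b \<in> carrier L"
  shows "a \<rightarrow> b \<in> F \<longleftrightarrow> (\<forall>G. prime_filter L G \<longrightarrow> F \<subseteq> G \<longrightarrow> a \<in> G \<longrightarrow> b \<in> G)"
proof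
  assume imp: "a \<rightarrow> b \<in> F"
  show "\<forall>G. prime_filter L G \<longrightarrow> F \<subseteq> G \<longrightarrow> a \<in> G \<longrightarrow> b \<in> G"
  proof (intro allI impI)
    fix G assume G: "prime_filter L G" "F \<subseteq> G" "a \<in> G"
    then have "a \<rightarrow> b \<in> G" using imp by blast
    then have "a \<sqinter> (a \<rightarrow> b) \<in> G" using G ab by (simp add: meet_prime)
    moreover have "a \<sqinter> (a \<rightarrow> b) \<sqsubseteq> b" using ab le_imp_iff[of a b "a \<rightarrow> b"] by simp
    ultimately show "b \<in> G" using up_prime[OF G(1)] ab(2) by blast
  qed
next
  assume all: "\<forall>G. prime_filter L G \<longrightarrow> F \<subseteq> G \<longrightarrow> a \<in> G \<longrightarrow> b \<in> G"
  have fF: "lattice_filter L F" using F by (rule prime_filter_imp_filter)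
  let ?H = "filter_join L F {c \<in> carrier L. a \<sqsubseteq> c}"
  have H: "a \<in> ?H" "F \<subseteq> ?H" "lattice_filter L ?H"
    using filter_join_upper[OF fF principal_filter[OF ab(1)]]
      filter_filter_join[OF fF principal_filter[OF ab(1)]] ab(1) by auto
  have "?H \<inter> {c \<in> carrier L. c \<sqsubseteq> b} \<noteq> {}"
  proof
    assume "?H \<inter> {c \<in> carrier L. c \<sqsubseteq> b} = {}"
    from prime_filter_exists[OF H(3) principal_ideal[OF ab(2)] this]
    obtain G where "prime_filter L G" "?H \<subseteq> G" "G \<inter> {c \<in> carrier L. c \<sqsubseteq> b} = {}" by blast
    with all H ab show False by blast
  qed
  from filter_meet_ideal[OF fF principal_ideal[OF ab(2)] ab(1) this]
  obtain f i where f: "f \<in> F" "i \<in> carrier L" "i \<sqsubseteq> b" "a \<sqsubseteq> f \<rightarrow> i" by blast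
  have fC: "f \<in> carrier L" using F f by (auto simp: prime_filter_def)
  have "f \<sqinter> a \<sqsubseteq> b"
    using f fC ab le_trans[of "f \<sqinter> a" i b] by (simp add: le_imp_iff)
  then have "f \<sqsubseteq> a \<rightarrow> b" using ab fC by (simp add: le_imp_iff meet_comm)
  then show "a \<rightarrow> b \<in> F" using F f ab by (auto simp: prime_filter_def)
qed

end

section \<open>Kripke semantics\<close>

primrec forces :: "'b gorder \<Rightarrow> (nat \<Rightarrow> 'b set) \<Rightarrow> form \<Rightarrow> 'b \<Rightarrow> bool" where
  "forces X V (Var n) x \<longleftrightarrow> x \<in> V n"
| "forces X V Bot x \<longleftrightarrow> False"
| "forces X V Top x \<longleftrightarrow> True"
| "forces X V (And p q) x \<longleftrightarrow> forces X V p x \<and> forces X V q x"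
| "forces X V (Or p q) x \<longleftrightarrow> forces X V p x \<or> forces X V q x"
| "forces X V (Imp p q) x \<longleftrightarrow> (\<forall>y\<in>up X x. forces X V p y \<longrightarrow> forces X V q y)"

lemma
  assumes "partial_order X"
  shows bottom_Up: "\<bottom>\<^bsub>Up X\<^esub> = {}" and top_Up: "\<top>\<^bsub>Up X\<^esub> = carrier X"
proof -
  interpret heyting_algebra "Up X" by (rule heyting_algebra_Up[OF assms])
  show "\<bottom>\<^bsub>Up X\<^esub> = {}" by (rule bottom_eq[symmetric]) (auto simp: Up_def)
  show "\<top>\<^bsub>Up X\<^esub> = carrier X" by (rule top_eq[symmetric]) (auto simp: Up_def up_def)
qed

lemma eval_Up:
  assumes X: "partial_order X" and V: "V \<in> UNIV \<rightarrow> carrier (Up X)"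
  shows "eval (Up X) V p = {x \<in> carrier X. forces X V p x}"
proof (induction p)
  case (Var n)
  then show ?case using V by (auto simp: carrier_Up Pi_iff)
next
  note c = eval_closed[OF heyting_algebra_Up[OF X] V]
  case (And p q)
  then show ?case using c[of p] c[of q] by (auto simp: meet_Up)
next
  note c = eval_closed[OF heyting_algebra_Up[OF X] V]
  case (Or p q)
  then show ?case using c[of p] c[of q] by (auto simp: join_Up)
next
  note c = eval_closed[OF heyting_algebra_Up[OF X] V]
  case (Imp p q)
  then show ?case using c[of p] c[of q] by (auto simp: heyting_imp_Up[OF X] up_def)
qed (auto simp: bottom_Up[OF X] top_Up[OF X])

section \<open>The truth lemma for prime spectra\<close>

lemma carrier_prime_spectrum [simp]: "carrier (prime_spectrum A) = {F. prime_filter A F}"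
  and le_prime_spectrum [simp]: "F \<sqsubseteq>\<^bsub>prime_spectrum A\<^esub> G \<longleftrightarrow> F \<subseteq> G"
  by (simp_all add: prime_spectrum_def)

lemma partial_order_prime_spectrum: "partial_order (prime_spectrum A)"
  by (rule partial_orderI) (simp_all add: prime_spectrum_def)

definition prime_extent :: "'a gorder \<Rightarrow> 'a \<Rightarrow> 'a set set"
  where "prime_extent A a = {F. prime_filter A F \<and> a \<in> F}"

lemma eval_mem_prime_filter:
  assumes A: "heyting_algebra A" and v: "v \<in> UNIV \<rightarrow> carrier A" and F: "prime_filter A F"
  shows "eval A v p \<in> F \<longleftrightarrow> forces (prime_spectrum A) (prime_extent A \<circ> v) p F"
proof -
  interpret heyting_gorder A by (rule heyting_gorder.intro[OF A])
  note c = eval_closed[OF A v]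
  show ?thesis
    using F
    by (induction p arbitrary: F)
      (auto simp: prime_extent_def bottom_prime top_prime meet_prime join_prime imp_prime c up_def)
qed

text \<open>By separation, an element that lies in every prime filter is the top. In the one-element
  algebra there are no prime filters and both sides hold.\<close>

lemma validates_iff_forces:
  assumes A: "heyting_algebra A"
  shows "validates A p \<longleftrightarrow>
    (\<forall>v \<in> UNIV \<rightarrow> carrier A. \<forall>F. prime_filter A F \<longrightarrow>
      forces (prime_spectrum A) (prime_extent A \<circ> v) p F)"
proof -
  interpret heyting_gorder A by (rule heyting_gorder.intro[OF A])
  have "eval A v p = \<top>\<^bsub>A\<^esub> \<longleftrightarrow>
      (\<forall>F. prime_filter A F \<longrightarrow> forces (prime_spectrum A) (prime_extent A \<circ> v) p F)"
    if v: "v \<in> UNIV \<rightarrow> carrier A" for v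
  proof -
    note c = eval_closed[OF A v, of p]
    have "eval A v p = \<top>\<^bsub>A\<^esub> \<longleftrightarrow> \<top>\<^bsub>A\<^esub> \<sqsubseteq>\<^bsub>A\<^esub> eval A v p"
      using c by (auto intro: le_antisym)
    also have "\<dots> \<longleftrightarrow> (\<forall>F. prime_filter A F \<longrightarrow> eval A v p \<in> F)"
    proof
      assume "\<top>\<^bsub>A\<^esub> \<sqsubseteq>\<^bsub>A\<^esub> eval A v p"
      then show "\<forall>F. prime_filter A F \<longrightarrow> eval A v p \<in> F"
        using c top_prime by (auto simp: prime_filter_def)
    next
      assume "\<forall>F. prime_filter A F \<longrightarrow> eval A v p \<in> F"
      then show "\<top>\<^bsub>A\<^esub> \<sqsubseteq>\<^bsub>A\<^esub> eval A v p"
        by (metis prime_filter_separates top_closed c)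
    qed
    finally show ?thesis
      using eval_mem_prime_filter[OF A v] by auto
  qed
  then show ?thesis
    by (auto simp: validates_def satisfies_def)
qed

section \<open>Diamond systems\<close>

lemma carrier_subposet [simp]: "carrier (subposet X S) = S"
  and le_subposet [simp]: "x \<sqsubseteq>\<^bsub>subposet X S\<^esub> y \<longleftrightarrow> x \<sqsubseteq>\<^bsub>X\<^esub> y"
  and incomparable_subposet [simp]: "incomparable (subposet X S) x y \<longleftrightarrow> incomparable X x y"
  by (simp_all add: subposet_def incomparable_def)

lemma incomparable_sym: "incomparable X x y \<Longrightarrow> incomparable X y x"
  by (auto simp: incomparable_def)

lemma mem_up_iff: "y \<in> up X x \<longleftrightarrow> y \<in> carrier X \<and> x \<sqsubseteq>\<^bsub>X\<^esub> y"
  by (simp add: up_def)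

locale poset = partial_order X for X :: "'a gorder" (structure)

lemma (in poset) up_trans: "\<lbrakk>y \<in> up X x; z \<in> up X y; x \<in> carrier X\<rbrakk> \<Longrightarrow> z \<in> up X x"
  using le_trans[of x y z] by (simp add: mem_up_iff)

lemma (in poset) three_antichain_iff:
  assumes "U \<subseteq> carrier X"
  shows "(\<exists>S. antichain (subposet X U) S \<and> card S = 3) \<longleftrightarrow>
    (\<exists>x\<in>U. \<exists>y\<in>U. \<exists>z\<in>U. incomparable X x y \<and> incomparable X x z \<and> incomparable X y z)"
    (is "?l \<longleftrightarrow> ?r")
proof
  assume ?l
  then obtain x y z where "antichain (subposet X U) {x, y, z}" "x \<noteq> y" "y \<noteq> z" "x \<noteq> z"
    by (auto simp: card_3_iff)
  then have "x \<in> U" "y \<in> U" "z \<in> U" "incomparable X x y" "incomparable X x z" "incomparable X y z"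
    by (simp_all add: antichain_def)
  then show ?r by blast
next
  assume ?r
  then obtain x y z where xyz: "x \<in> U" "y \<in> U" "z \<in> U"
    "incomparable X x y" "incomparable X x z" "incomparable X y z" by blast
  then have "x \<noteq> y" "x \<noteq> z" "y \<noteq> z"
    using assms by (auto simp: incomparable_def)
  with xyz have "antichain (subposet X U) {x, y, z}" "card {x, y, z} = 3"
    by (auto simp: antichain_def intro: incomparable_sym)
  then show ?l by blast
qed

lemma diamond_systemI:
  assumes X: "partial_order X"
    and D1: "\<And>x y z w. \<lbrakk>x \<in> carrier X; y \<in> up X x; z \<in> up X x; w \<in> up X x;
      incomparable X y z; y \<sqsubseteq>\<^bsub>X\<^esub> w; y \<noteq> w; z \<noteq> w\<rbrakk> \<Longrightarrow> z \<sqsubseteq>\<^bsub>X\<^esub> w"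
    and D2: "\<And>x y z w. \<lbrakk>x \<in> carrier X; y \<in> up X x; z \<in> up X x; w \<in> up X x;
      incomparable X y z; incomparable X y w; incomparable X z w\<rbrakk> \<Longrightarrow> False"
    and D3: "\<And>x y z. \<lbrakk>x \<in> carrier X; y \<in> up X x; z \<in> up X x\<rbrakk> \<Longrightarrow>
      \<exists>w\<in>carrier X. y \<sqsubseteq>\<^bsub>X\<^esub> w \<and> z \<sqsubseteq>\<^bsub>X\<^esub> w"
    and D4: "\<And>b x y z v t. \<lbrakk>b \<in> carrier X; x \<in> up X b; y \<in> up X b; z \<in> up X x; z \<in> up X y;
      v \<in> up X x; v \<in> up X y; t \<in> up X z; t \<in> up X v\<rbrakk> \<Longrightarrow>
      \<exists>w\<in>carrier X. x \<sqsubseteq>\<^bsub>X\<^esub> w \<and> y \<sqsubseteq>\<^bsub>X\<^esub> w \<and> w \<sqsubseteq>\<^bsub>X\<^esub> z \<and> w \<sqsubseteq>\<^bsub>X\<^esub> v"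
  shows "diamond_system X"
proof -
  interpret poset X by (rule poset.intro[OF X])
  show ?thesis
  proof
    fix x assume x: "x \<in> carrier X"
    show "three_point_rule (subposet X (up X x))"
      unfolding three_point_rule_def using D1[OF x] by auto
    have "up X x \<subseteq> carrier X" by (auto simp: up_def)
    then show "\<not> (\<exists>S. antichain (subposet X (up X x)) S \<and> card S = 3)"
      using D2[OF x] by (auto simp: three_antichain_iff)
  next
    fix b x y z v t
    assume "b \<in> carrier X" "x \<in> carrier X" "y \<in> carrier X" "z \<in> carrier X" "v \<in> carrier X"
      "t \<in> carrier X" "b \<sqsubseteq>\<^bsub>X\<^esub> x" "b \<sqsubseteq>\<^bsub>X\<^esub> y" "x \<sqsubseteq>\<^bsub>X\<^esub> z" "x \<sqsubseteq>\<^bsub>X\<^esub> v" "y \<sqsubseteq>\<^bsub>X\<^esub> z" "y \<sqsubseteq>\<^bsub>X\<^esub> v"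
      "z \<sqsubseteq>\<^bsub>X\<^esub> t" "v \<sqsubseteq>\<^bsub>X\<^esub> t"
    then show "\<exists>w\<in>carrier X. x \<sqsubseteq>\<^bsub>X\<^esub> w \<and> y \<sqsubseteq>\<^bsub>X\<^esub> w \<and> w \<sqsubseteq>\<^bsub>X\<^esub> z \<and> w \<sqsubseteq>\<^bsub>X\<^esub> v"
      by (intro D4[of b x y z v t]) (simp_all add: mem_up_iff)
  qed (rule D3)
qed

sublocale diamond_system \<subseteq> poset ..

context diamond_system
begin

lemma three_point:
  assumes "x \<in> carrier X" "y \<in> up X x" "z \<in> up X x" "w \<in> up X x"
    "incomparable X y z" "y \<sqsubseteq> w" "y \<noteq> w" "z \<noteq> w"
  shows "z \<sqsubseteq> w"
proof -
  have "y \<noteq> z" using assms by (auto simp: incomparable_def mem_up_iff)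
  then show ?thesis
    using D1[OF assms(1)] assms unfolding three_point_rule_def by simp
qed

lemma no_three_antichain:
  assumes "x \<in> carrier X" "y \<in> up X x" "z \<in> up X x" "w \<in> up X x"
    "incomparable X y z" "incomparable X y w" "incomparable X z w"
  shows False
proof -
  have "up X x \<subseteq> carrier X" by (auto simp: up_def)
  from D2[OF assms(1), unfolded three_antichain_iff[OF this]] assms show False by blast
qed

text \<open>The witnesses supplied by (D3) and (D4) lie above \<open>r\<close> again, and
  \<open>r\<close> itself is the common lower bound.\<close>

lemma diamond_system_up:
  assumes r: "r \<in> carrier X"
  shows "diamond_sequence (subposet X (up X r))"
proof -
  have sub: "up X r \<subseteq> carrier X" by (auto simp: up_def)
  have up: "up (subposet X (up X r)) x = up X x" if "x \<in> up X r" for x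
    using up_trans[OF that _ r] by (auto simp: up_def)
  have po: "partial_order (subposet X (up X r))"
    unfolding subposet_def by (rule partial_order_subset[OF partial_order_axioms sub])
  have "diamond_system (subposet X (up X r))"
  proof (rule diamond_systemI[OF po]; simp only: carrier_subposet le_subposet incomparable_subposet)
    fix x y z w
    assume "x \<in> up X r" "y \<in> up (subposet X (up X r)) x" "z \<in> up (subposet X (up X r)) x"
      "w \<in> up (subposet X (up X r)) x" "incomparable X y z" "y \<sqsubseteq> w" "y \<noteq> w" "z \<noteq> w"
    then show "z \<sqsubseteq> w" using three_point[of x y z w] by (simp add: up mem_up_iff[of x])
  next
    fix x y z w
    assume "x \<in> up X r" "y \<in> up (subposet X (up X r)) x" "z \<in> up (subposet X (up X r)) x"
      "w \<in> up (subposet X (up X r)) x"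
      "incomparable X y z" "incomparable X y w" "incomparable X z w"
    then show False using no_three_antichain[of x y z w] by (simp add: up mem_up_iff[of x])
  next
    fix x y z
    assume x: "x \<in> up X r" and "y \<in> up (subposet X (up X r)) x" "z \<in> up (subposet X (up X r)) x"
    then have yz: "y \<in> up X x" "z \<in> up X x" by (simp_all add: up)
    then obtain w where w: "w \<in> carrier X" "y \<sqsubseteq> w" "z \<sqsubseteq> w"
      using D3[of x y z] x by (auto simp: mem_up_iff[of x])
    then have "w \<in> up X r"
      using up_trans[of y r w] up_trans[OF x yz(1) r] r by (simp add: mem_up_iff[of w _ y])
    with w show "\<exists>w\<in>up X r. y \<sqsubseteq> w \<and> z \<sqsubseteq> w" by blast
  next
    let ?up = "up (subposet X (up X r))"
    fix b x y z v t
    assume b: "b \<in> up X r" and "x \<in> ?up b" "y \<in> ?up b"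
      and *: "z \<in> ?up x" "z \<in> ?up y" "v \<in> ?up x" "v \<in> ?up y" "t \<in> ?up z" "t \<in> ?up v"
    then have xy: "x \<in> up X b" "y \<in> up X b" by (simp_all add: up)
    then have xy': "x \<in> up X r" "y \<in> up X r" using up_trans[OF b _ r] by simp_all
    then have zv: "z \<in> up X x" "z \<in> up X y" "v \<in> up X x" "v \<in> up X y"
      using * by (simp_all add: up)
    then have "z \<in> up X r" "v \<in> up X r" using up_trans[OF xy'(1) _ r] by simp_all
    then have "t \<in> up X z" "t \<in> up X v"
      using * by (simp_all add: up)
    then obtain w where w: "w \<in> carrier X" "x \<sqsubseteq> w" "y \<sqsubseteq> w" "w \<sqsubseteq> z" "w \<sqsubseteq> v"
      using D4[of b x y z v t] b xy zv by (auto simp: mem_up_iff)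
    then have "w \<in> up X r"
      using up_trans[OF xy'(1) _ r] by (simp add: mem_up_iff[of w _ x])
    with w show "\<exists>w\<in>up X r. x \<sqsubseteq> w \<and> y \<sqsubseteq> w \<and> w \<sqsubseteq> z \<and> w \<sqsubseteq> v" by blast
  qed
  then show ?thesis
    by (rule diamond_sequence.intro) (unfold_locales, use r in \<open>auto simp: mem_up_iff\<close>)
qed

end

text \<open>Each of (D1)--(D4) speaks only about points above a single one, so it can be checked in
  the upset generated by that point.\<close>

lemma diamond_system_iff_up:
  assumes X: "partial_order X"
  shows "diamond_system X \<longleftrightarrow> (\<forall>x\<in>carrier X. diamond_sequence (subposet X (up X x)))"
proof
  assume "diamond_system X"
  then show "\<forall>x\<in>carrier X. diamond_sequence (subposet X (up X x))"
    by (simp add: diamond_system.diamond_system_up)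
next
  assume all: "\<forall>x\<in>carrier X. diamond_sequence (subposet X (up X x))"
  interpret poset X by (rule poset.intro[OF X])
  have root: "x \<in> up X x" if "x \<in> carrier X" for x using that by (simp add: mem_up_iff)
  have up: "up (subposet X (up X r)) x = up X x" if "x \<in> up X r" "r \<in> carrier X" for x r
    using up_trans[OF that(1) _ that(2)] by (auto simp: up_def)
  show "diamond_system X"
  proof (rule diamond_systemI[OF X])
    fix x y z w
    assume x: "x \<in> carrier X" and *: "y \<in> up X x" "z \<in> up X x" "w \<in> up X x"
    interpret S: diamond_sequence "subposet X (up X x)" using all x by blast
    note [simp] = up[OF root[OF x] x] root[OF x]
    { assume "incomparable X y z" "y \<sqsubseteq>\<^bsub>X\<^esub> w" "y \<noteq> w" "z \<noteq> w"
      then show "z \<sqsubseteq>\<^bsub>X\<^esub> w" using S.three_point[of x y z w] * by simp }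
    { assume "incomparable X y z" "incomparable X y w" "incomparable X z w"
      then show False using S.no_three_antichain[of x y z w] * by simp }
  next
    fix x y z
    assume x: "x \<in> carrier X" and *: "y \<in> up X x" "z \<in> up X x"
    interpret S: diamond_sequence "subposet X (up X x)" using all x by blast
    show "\<exists>w\<in>carrier X. y \<sqsubseteq>\<^bsub>X\<^esub> w \<and> z \<sqsubseteq>\<^bsub>X\<^esub> w"
      using S.D3[of x y z] * x by (auto simp: up[OF root[OF x] x] root[OF x] mem_up_iff[of _ _ x])
  next
    fix b x y z v t
    assume b: "b \<in> carrier X" and xy: "x \<in> up X b" "y \<in> up X b" and zv: "z \<in> up X x" "z \<in> up X y"
      "v \<in> up X x" "v \<in> up X y" and t: "t \<in> up X z" "t \<in> up X v"
    interpret S: diamond_sequence "subposet X (up X b)" using all b by blast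
    have "z \<in> up X b" "v \<in> up X b" using up_trans[OF xy(1) _ b] zv by simp_all
    moreover have "t \<in> up X b" using up_trans[OF \<open>z \<in> up X b\<close> _ b] t by simp
    ultimately show "\<exists>w\<in>carrier X. x \<sqsubseteq>\<^bsub>X\<^esub> w \<and> y \<sqsubseteq>\<^bsub>X\<^esub> w \<and> w \<sqsubseteq>\<^bsub>X\<^esub> z \<and> w \<sqsubseteq>\<^bsub>X\<^esub> v"
      using S.D4[of b x y z v t] xy zv t root[OF b] by (auto simp: mem_up_iff)
  qed
qed

section \<open>Formulas whose refutations are failures of (D1)--(D4)\<close>

text \<open>A refutation consists of a point z in 0 but not in 1, a point y in 1 but not in 2, and a
  point w above y in 2 but not in 0. By persistence y < w, z is incomparable to y, and z is not
  below w.\<close>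

definition three_point_axiom :: form where
  "three_point_axiom = Or (Imp (Var 0) (Var 1)) (Imp (Var 1) (Or (Var 2) (Imp (Var 2) (Var 0))))"

text \<open>The usual formula for width at most two: a refutation gives three points, each
  satisfying exactly one of the variables, hence an antichain.\<close>

definition width_axiom :: form where
  "width_axiom = Or (Imp (Var 0) (Or (Var 1) (Var 2)))
    (Or (Imp (Var 1) (Or (Var 0) (Var 2))) (Imp (Var 2) (Or (Var 0) (Var 1))))"

text \<open>A refutation gives a point in 0 and a point with nothing above it in 0, so that the two
  have no common upper bound.\<close>

definition weak_excluded_middle :: form where
  "weak_excluded_middle = Or (Imp (Var 0) Bot) (Imp (Imp (Var 0) Bot) Bot)"

text \<open>
  Variables 0 and 1 separate the two lower points of (D4), variables 2 and 3 the two upper points;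
  the antecedent excludes a point in between.
\<close>

definition interpolation_axiom :: form where
  "interpolation_axiom = Imp (Imp (And (Var 0) (Var 1)) (Or (Var 2) (Var 3)))
    (Or (Imp (Var 0) (Or (Var 1) (Or (Imp (Var 2) (Var 3)) (Imp (Var 3) (Var 2)))))
      (Imp (Var 1) (Var 0)))"

definition diamond_axioms :: "form set" where
  "diamond_axioms = {three_point_axiom, width_axiom, weak_excluded_middle, interpolation_axiom}"

lemma (in diamond_system) forces_diamond_axioms:
  assumes V: "V \<in> UNIV \<rightarrow> carrier (Up X)" and x: "x \<in> carrier X" and p: "p \<in> diamond_axioms"
  shows "forces X V p x"
proof -
  have pers: "z \<in> V n" if "y \<in> V n" "z \<in> carrier X" "y \<sqsubseteq> z" for y z n
  proof -
    have "up X y \<subseteq> V n" using V that(1) unfolding carrier_Up by blast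
    with that(2,3) show ?thesis by (auto simp: mem_up_iff)
  qed
  have C: "y \<in> carrier X" if "y \<in> up X z" for y z using that by (simp add: mem_up_iff)
  have pers': "z \<in> V n" if "y \<in> V n" "z \<in> up X y" for y z n
    using that pers by (simp add: mem_up_iff)
  consider "p = three_point_axiom" | "p = width_axiom" | "p = weak_excluded_middle"
    | "p = interpolation_axiom" using p by (auto simp: diamond_axioms_def)
  then show ?thesis
  proof cases
    case 1
    show ?thesis
    proof (rule ccontr)
      assume "\<not> ?thesis"
      then obtain z y w where z: "z \<in> up X x" "z \<in> V 0" "z \<notin> V 1"
        and y: "y \<in> up X x" "y \<in> V 1" "y \<notin> V 2" and w: "w \<in> up X y" "w \<in> V 2" "w \<notin> V 0"
        unfolding 1 three_point_axiom_def by auto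
      have wx: "w \<in> up X x" using up_trans[OF y(1) w(1) x] .
      have "\<not> y \<sqsubseteq> z" using pers[OF y(2)] z C by blast
      moreover have "\<not> z \<sqsubseteq> w" using pers[OF z(2)] w C by blast
      moreover have "\<not> z \<sqsubseteq> y"
        using le_trans[of z y w] w(1) C[OF w(1)] C[OF z(1)] C[OF y(1)] \<open>\<not> z \<sqsubseteq> w\<close>
        by (auto simp: mem_up_iff)
      ultimately show False
        using three_point[OF x y(1) z(1) wx] w y z by (auto simp: incomparable_def mem_up_iff)
    qed
  next
    case 2
    show ?thesis
    proof (rule ccontr)
      assume "\<not> ?thesis"
      then obtain y z w where y: "y \<in> up X x" "y \<in> V 0" "y \<notin> V 1" "y \<notin> V 2"
        and z: "z \<in> up X x" "z \<in> V 1" "z \<notin> V 0" "z \<notin> V 2"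
        and w: "w \<in> up X x" "w \<in> V 2" "w \<notin> V 0" "w \<notin> V 1"
        unfolding 2 width_axiom_def by auto
      have "incomparable X y z" "incomparable X y w" "incomparable X z w"
        unfolding incomparable_def using pers y z w C by blast+
      then show False using no_three_antichain[OF x y(1) z(1) w(1)] by blast
    qed
  next
    case 3
    show ?thesis
    proof (rule ccontr)
      assume "\<not> ?thesis"
      then obtain y z where y: "y \<in> up X x" "y \<in> V 0"
        and z: "z \<in> up X x" "\<forall>w\<in>up X z. w \<notin> V 0"
        unfolding 3 weak_excluded_middle_def by auto
      obtain w where w: "w \<in> carrier X" "y \<sqsubseteq> w" "z \<sqsubseteq> w" using D3[OF x y(1) z(1)] by blast
      then have "w \<in> V 0" "w \<in> up X z" using pers[OF y(2)] by (simp_all add: mem_up_iff)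
      with z(2) show False by blast
    qed
  next
    case 4
    show ?thesis
    proof (rule ccontr)
      assume "\<not> ?thesis"
      then obtain x' where x': "x' \<in> up X x" and
        *: "\<forall>u\<in>up X x'. u \<in> V 0 \<and> u \<in> V 1 \<longrightarrow> u \<in> V 2 \<or> u \<in> V 3"
        and "\<not> (\<forall>y\<in>up X x'. y \<in> V 0 \<longrightarrow> y \<in> V 1 \<or> (\<forall>w\<in>up X y. w \<in> V 2 \<longrightarrow> w \<in> V 3) \<or>
          (\<forall>w\<in>up X y. w \<in> V 3 \<longrightarrow> w \<in> V 2))"
        and "\<not> (\<forall>z\<in>up X x'. z \<in> V 1 \<longrightarrow> z \<in> V 0)"
        unfolding 4 interpolation_axiom_def by auto
      then obtain y z w v where y: "y \<in> up X x'" "y \<in> V 0" "y \<notin> V 1"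
        and z: "z \<in> up X x'" "z \<in> V 1" "z \<notin> V 0"
        and w: "w \<in> up X y" "w \<in> V 2" "w \<notin> V 3" and v: "v \<in> up X y" "v \<in> V 3" "v \<notin> V 2"
        by blast
      note x'C = C[OF x']
      have inc: "incomparable X y z"
        unfolding incomparable_def using pers y z C by blast
      have wv': "w \<in> up X x'" "v \<in> up X x'" using up_trans[OF y(1) _ x'C] w v by simp_all
      have "y \<notin> V 2" "y \<notin> V 3" using pers'[OF _ v(1)] pers'[OF _ w(1)] w v by blast+
      moreover have "w \<in> V 0" "v \<in> V 0" using pers'[OF y(2)] w v by blast+
      ultimately have ne: "y \<noteq> w" "y \<noteq> v" "z \<noteq> w" "z \<noteq> v" using w v z by blast+
      \<comment> \<open>The axiom puts \<open>w\<close> and \<open>v\<close> above \<open>y\<close>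
        only. Being distinct from \<open>y\<close> and \<open>z\<close>, they are moved above
        \<open>z\<close> by the three point rule; (D3) then supplies the top needed for
        (D4).\<close>
      have z': "z \<sqsubseteq> w" "z \<sqsubseteq> v"
        using three_point[OF x'C y(1) z(1) wv'(1) inc] three_point[OF x'C y(1) z(1) wv'(2) inc] ne w v
        by (simp_all add: mem_up_iff)
      obtain t where t: "t \<in> carrier X" "w \<sqsubseteq> t" "v \<sqsubseteq> t" using D3[OF x'C wv'] by blast
      obtain u where u: "u \<in> carrier X" "y \<sqsubseteq> u" "z \<sqsubseteq> u" "u \<sqsubseteq> w" "u \<sqsubseteq> v"
        using D4[of x' y z w v t] x'C C[OF y(1)] C[OF z(1)] C[OF w(1)] C[OF v(1)] t z' y(1) z(1) w(1) v(1)
        by (auto simp: mem_up_iff)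
      have "u \<in> V 0" "u \<in> V 1" using pers y z u by blast+
      moreover have "u \<in> up X x'" using up_trans[OF y(1) _ x'C] u by (simp add: mem_up_iff)
      ultimately have "u \<in> V 2 \<or> u \<in> V 3" using * by blast
      then show False using pers u w v C by blast
    qed
  qed
qed

section \<open>From the axioms to the conditions on the spectrum\<close>

lemma up_prime_spectrum: "up (prime_spectrum A) F = {G. prime_filter A G \<and> F \<subseteq> G}"
  by (simp add: up_def)

context heyting_gorder
begin

text \<open>The compactness argument: if the join of the two filters missed the ideal of the bottom,
  it would extend to a common prime upper bound.\<close>

lemma prime_filters_common_upper:
  assumes F: "prime_filter L F" and G: "prime_filter L G"
    and no: "\<And>H. \<lbrakk>prime_filter L H; F \<subseteq> H; G \<subseteq> H\<rbrakk> \<Longrightarrow> False"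
  obtains f g where "f \<in> F" "g \<in> G" "\<forall>H. prime_filter L H \<longrightarrow> f \<in> H \<longrightarrow> g \<notin> H"
proof -
  note fF = prime_filter_imp_filter[OF F] and fG = prime_filter_imp_filter[OF G]
  have "filter_join L F G \<inter> {c \<in> carrier L. c \<sqsubseteq> \<bottom>} \<noteq> {}"
  proof
    assume "filter_join L F G \<inter> {c \<in> carrier L. c \<sqsubseteq> \<bottom>} = {}"
    from prime_filter_exists[OF filter_filter_join[OF fF fG] principal_ideal[OF bottom_closed] this]
    obtain H where "prime_filter L H" "filter_join L F G \<subseteq> H" by blast
    then show False using no[of H] filter_join_upper[OF fF fG] by blast
  qed
  then obtain f g c where fg: "f \<in> F" "g \<in> G" "c \<in> carrier L" "f \<sqinter> g \<sqsubseteq> c" "c \<sqsubseteq> \<bottom>"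
    by (auto simp: filter_join_def)
  have C: "f \<in> carrier L" "g \<in> carrier L" using closed_prime F G fg by blast+
  show thesis
  proof (rule that[OF fg(1,2)], intro allI impI notI)
    fix H assume H: "prime_filter L H" "f \<in> H" "g \<in> H"
    then have "f \<sqinter> g \<in> H" using C by (simp add: meet_prime)
    then have "c \<in> H" using up_prime[OF H(1) _ fg(4,3)] by blast
    then have "\<bottom> \<in> H" using up_prime[OF H(1) _ fg(5) bottom_closed] by blast
    then show False using bottom_prime[OF H(1)] by blast
  qed
qed

text \<open>The prime filters between are exactly those that contain \<open>F\<close> and
  \<open>G\<close> and avoid the complements of \<open>H\<close> and \<open>K\<close>. As none
  exists, the join of the filters meets the join of the complementary ideals.\<close>

lemma prime_filters_interpolate:
  assumes F: "prime_filter L F" and G: "prime_filter L G"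
    and H: "prime_filter L H" and K: "prime_filter L K"
    and no: "\<And>M. \<lbrakk>prime_filter L M; F \<subseteq> M; G \<subseteq> M; M \<subseteq> H; M \<subseteq> K\<rbrakk> \<Longrightarrow> False"
  obtains f g h k where "f \<in> F" "g \<in> G" "h \<in> carrier L" "h \<notin> H" "k \<in> carrier L" "k \<notin> K"
    "f \<sqinter> g \<sqsubseteq> h \<squnion> k"
proof -
  note fF = prime_filter_imp_filter[OF F] and fG = prime_filter_imp_filter[OF G]
  note iH = prime_filter_compl_ideal[OF H] and iK = prime_filter_compl_ideal[OF K]
  let ?I = "ideal_join L (carrier L - H) (carrier L - K)"
  have "filter_join L F G \<inter> ?I \<noteq> {}"
  proof
    assume "filter_join L F G \<inter> ?I = {}"
    from prime_filter_exists[OF filter_filter_join[OF fF fG] ideal_ideal_join[OF iH iK] this]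
    obtain M where M: "prime_filter L M" "filter_join L F G \<subseteq> M" "M \<inter> ?I = {}" by blast
    have "M \<subseteq> H" "M \<subseteq> K"
      using ideal_join_upper[OF iH iK] M(3) closed_prime[OF M(1)] by blast+
    then show False using no[OF M(1)] M(2) filter_join_upper[OF fF fG] by blast
  qed
  then obtain c f g h k where c: "c \<in> carrier L" "f \<sqinter> g \<sqsubseteq> c" "c \<sqsubseteq> h \<squnion> k"
    and fg: "f \<in> F" "g \<in> G" "h \<in> carrier L" "h \<notin> H" "k \<in> carrier L" "k \<notin> K"
    by (auto simp: filter_join_def ideal_join_def)
  have "f \<in> carrier L" "g \<in> carrier L" using closed_prime F G fg by blast+
  then have "f \<sqinter> g \<sqsubseteq> h \<squnion> k" using le_trans[OF c(2,3)] c(1) fg by simp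
  with fg that show thesis by blast
qed

lemma prime_filter_diff:
  assumes F: "prime_filter L F" and "\<not> F \<subseteq> G" "\<not> F \<subseteq> H" and G: "prime_filter L G" and H: "prime_filter L H"
  obtains a where "a \<in> F" "a \<notin> G" "a \<notin> H"
proof -
  obtain b c where bc: "b \<in> F" "b \<notin> G" "c \<in> F" "c \<notin> H" using assms by blast
  then have C: "b \<in> carrier L" "c \<in> carrier L" using closed_prime[OF F] by blast+
  show thesis
    using that[of "b \<sqinter> c"] bc C F G H by (simp add: meet_prime)
qed

lemma diamond_system_prime_spectrum:
  assumes val: "\<And>p. p \<in> diamond_axioms \<Longrightarrow> validates L p"
  shows "diamond_system (prime_spectrum L)"
proof (rule diamond_systemI[OF partial_order_prime_spectrum])
  \<comment> \<open>All variables from 3 on receive \<open>d\<close>. For axioms with fewer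
    variables the remaining places are filled with the bottom.\<close>
  define v where "v a b c d n = (if n = 0 then a else if n = 1 then b else if n = 2 then c else d)"
    for a b c d :: 'a and n :: nat
  have v [simp]: "v a b c d 0 = a" "v a b c d (Suc 0) = b" "v a b c d 2 = c" "v a b c d 3 = d"
    for a b c d by (simp_all add: v_def)
  have forces: "forces (prime_spectrum L) (prime_extent L \<circ> v a b c d) p x"
    if "p \<in> diamond_axioms" "prime_filter L x"
      "a \<in> carrier L" "b \<in> carrier L" "c \<in> carrier L" "d \<in> carrier L" for p x a b c d
  proof -
    have "v a b c d \<in> UNIV \<rightarrow> carrier L" using that by (simp add: v_def)
    then show ?thesis
      using val[OF that(1)] that(2) validates_iff_forces[OF heyting_algebra_axioms] by blast
  qed
  note sem = up_prime_spectrum prime_extent_def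
  note bot = bottom_closed
  { fix x y z w
    assume x: "x \<in> carrier (prime_spectrum L)" and "y \<in> up (prime_spectrum L) x"
      "z \<in> up (prime_spectrum L) x" "w \<in> up (prime_spectrum L) x"
      and inc: "incomparable (prime_spectrum L) y z"
    then have p: "prime_filter L x" "prime_filter L y" "prime_filter L z" "prime_filter L w"
      and sub: "x \<subseteq> y" "x \<subseteq> z" "x \<subseteq> w" and yz: "\<not> y \<subseteq> z" "\<not> z \<subseteq> y"
      by (simp_all add: up_prime_spectrum incomparable_def)
    { assume le: "y \<sqsubseteq>\<^bsub>prime_spectrum L\<^esub> w" and ne: "y \<noteq> w" "z \<noteq> w"
      show "z \<sqsubseteq>\<^bsub>prime_spectrum L\<^esub> w"
      proof (rule ccontr)
        assume "\<not> z \<sqsubseteq>\<^bsub>prime_spectrum L\<^esub> w"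
        then obtain a b c where a: "a \<in> z" "a \<notin> w" and b: "b \<in> y" "b \<notin> z" and c: "c \<in> w" "c \<notin> y"
          using le ne yz by auto
        have C: "a \<in> carrier L" "b \<in> carrier L" "c \<in> carrier L"
          using a b c p closed_prime by blast+
        have "three_point_axiom \<in> diamond_axioms" by (simp add: diamond_axioms_def)
        from forces[OF this p(1) C bot] show False
          using p sub a b c le by (auto simp: three_point_axiom_def sem)
      qed }
    { assume inc': "incomparable (prime_spectrum L) y w" "incomparable (prime_spectrum L) z w"
      then have n: "\<not> y \<subseteq> w" "\<not> w \<subseteq> y" "\<not> z \<subseteq> w" "\<not> w \<subseteq> z" by (simp_all add: incomparable_def)
      obtain a where a: "a \<in> y" "a \<notin> z" "a \<notin> w" using prime_filter_diff[of y z w] p yz n by blast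
      obtain b where b: "b \<in> z" "b \<notin> y" "b \<notin> w" using prime_filter_diff[of z y w] p yz n by blast
      obtain c where c: "c \<in> w" "c \<notin> y" "c \<notin> z" using prime_filter_diff[of w y z] p yz n by blast
      have C: "a \<in> carrier L" "b \<in> carrier L" "c \<in> carrier L"
        using a b c p closed_prime by blast+
      have "width_axiom \<in> diamond_axioms" by (simp add: diamond_axioms_def)
      from forces[OF this p(1) C bot] show False
        using p sub a b c by (auto simp: width_axiom_def sem) }
  }
  { fix x y z
    assume "x \<in> carrier (prime_spectrum L)" "y \<in> up (prime_spectrum L) x"
      "z \<in> up (prime_spectrum L) x"
    then have p: "prime_filter L x" "prime_filter L y" "prime_filter L z" and sub: "x \<subseteq> y" "x \<subseteq> z"
      by (simp_all add: up_prime_spectrum)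
    have "\<exists>w. prime_filter L w \<and> y \<subseteq> w \<and> z \<subseteq> w"
    proof (rule ccontr)
      assume no: "\<not> ?thesis"
      obtain f g where fg: "f \<in> y" "g \<in> z"
        and dis: "\<forall>H. prime_filter L H \<longrightarrow> f \<in> H \<longrightarrow> g \<notin> H"
        by (rule prime_filters_common_upper[OF p(2,3)]) (use no in blast)+
      have C: "f \<in> carrier L" using fg p closed_prime by blast
      have "weak_excluded_middle \<in> diamond_axioms" by (simp add: diamond_axioms_def)
      from forces[OF this p(1) C bot bot bot]
      obtain w where "prime_filter L w" "z \<subseteq> w" "f \<in> w"
        using p sub fg by (auto simp: weak_excluded_middle_def sem)
      with dis fg show False by blast
    qed
    then show "\<exists>w\<in>carrier (prime_spectrum L). y \<sqsubseteq>\<^bsub>prime_spectrum L\<^esub> w \<and> z \<sqsubseteq>\<^bsub>prime_spectrum L\<^esub> w"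
      by auto }
  { fix x0 x y z w t
    assume "x0 \<in> carrier (prime_spectrum L)"
      "x \<in> up (prime_spectrum L) x0" "y \<in> up (prime_spectrum L) x0"
      "z \<in> up (prime_spectrum L) x" "z \<in> up (prime_spectrum L) y"
      "w \<in> up (prime_spectrum L) x" "w \<in> up (prime_spectrum L) y"
    then have p: "prime_filter L x0" "prime_filter L x" "prime_filter L y" "prime_filter L z"
      "prime_filter L w"
      and sub: "x0 \<subseteq> x" "x0 \<subseteq> y" "x \<subseteq> z" "y \<subseteq> z" "x \<subseteq> w" "y \<subseteq> w"
      by (simp_all add: up_prime_spectrum)
    have "\<exists>u. prime_filter L u \<and> x \<subseteq> u \<and> y \<subseteq> u \<and> u \<subseteq> z \<and> u \<subseteq> w"
    proof (rule ccontr)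
      assume no: "\<not> ?thesis"
      obtain f g h k where fg: "f \<in> x" "g \<in> y" and hk: "h \<in> carrier L" "h \<notin> z" "k \<in> carrier L" "k \<notin> w"
        and le: "f \<sqinter> g \<sqsubseteq> h \<squnion> k"
        by (rule prime_filters_interpolate[OF p(2-5)]) (use no in blast)+
      have "\<not> x \<subseteq> y" "\<not> y \<subseteq> x" "\<not> z \<subseteq> w" "\<not> w \<subseteq> z" using no p sub by blast+
      then obtain f' g' h' k' where fg': "f' \<in> x" "f' \<notin> y" "g' \<in> y" "g' \<notin> x"
        and hk': "k' \<in> z" "k' \<notin> w" "h' \<in> w" "h' \<notin> z" by blast
      have fC: "f \<in> carrier L" "f' \<in> carrier L" "g \<in> carrier L" "g' \<in> carrier L"
        "h' \<in> carrier L" "k' \<in> carrier L" using fg fg' hk' p closed_prime by blast+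
      \<comment> \<open>The plain letters witness that nothing lies in between, the primed ones that
        the two pairs are incomparable. Meets for the lower pair and joins for the upper pair keep
        both properties; note that \<open>k\<close>, which is missing from \<open>w\<close>, goes
        with the element separating \<open>z\<close> from \<open>w\<close>.\<close>
      define a b c d where "a = f \<sqinter> f'" "b = g \<sqinter> g'" "c = k \<squnion> k'" "d = h \<squnion> h'"
      note abcd = this
      have C: "a \<in> carrier L" "b \<in> carrier L" "c \<in> carrier L" "d \<in> carrier L"
        using fC hk by (simp_all add: abcd)
      have a: "a \<in> x" "a \<notin> y" and b: "b \<in> y" "b \<notin> x" and c: "c \<in> z" "c \<notin> w" and d: "d \<in> w" "d \<notin> z"
        using fg fg' hk hk' fC p by (simp_all add: abcd meet_prime join_prime)
      have cover: "c \<in> u \<or> d \<in> u" if u: "prime_filter L u" "a \<in> u" "b \<in> u" for u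
      proof -
        have "f \<in> u" "g \<in> u" using u fC by (simp_all add: abcd meet_prime)
        then have "h \<squnion> k \<in> u" using up_prime[OF u(1) _ le] u(1) fC hk by (simp add: meet_prime)
        then show ?thesis using u(1) hk fC by (auto simp: abcd join_prime)
      qed
      have "interpolation_axiom \<in> diamond_axioms" by (simp add: diamond_axioms_def)
      from forces[OF this p(1) C]
      have "(\<forall>u. prime_filter L u \<and> x0 \<subseteq> u \<longrightarrow> a \<in> u \<longrightarrow> b \<in> u \<or>
          (\<forall>s. prime_filter L s \<and> u \<subseteq> s \<longrightarrow> c \<in> s \<longrightarrow> d \<in> s) \<or>
          (\<forall>s. prime_filter L s \<and> u \<subseteq> s \<longrightarrow> d \<in> s \<longrightarrow> c \<in> s)) \<or>
        (\<forall>u. prime_filter L u \<and> x0 \<subseteq> u \<longrightarrow> b \<in> u \<longrightarrow> a \<in> u)"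
        using p(1) cover by (simp add: interpolation_axiom_def sem)
      then show False using p sub a b c d by blast
    qed
    then show "\<exists>u\<in>carrier (prime_spectrum L). x \<sqsubseteq>\<^bsub>prime_spectrum L\<^esub> u \<and> y \<sqsubseteq>\<^bsub>prime_spectrum L\<^esub> u \<and>
        u \<sqsubseteq>\<^bsub>prime_spectrum L\<^esub> z \<and> u \<sqsubseteq>\<^bsub>prime_spectrum L\<^esub> w"
      by auto }
qed

end

section \<open>Refuting valuations on the forbidden posets\<close>

lemma validates_Up_forces:
  assumes "partial_order X" "validates (Up X) p" "V \<in> UNIV \<rightarrow> carrier (Up X)" "x \<in> carrier X"
  shows "forces X V p x"
proof -
  have "eval (Up X) V p = carrier X"
    using assms(2,3) by (auto simp: validates_def satisfies_def top_Up[OF assms(1)])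
  then show ?thesis
    using assms(4) eval_Up[OF assms(1,3)] by auto
qed

lemma P1_refutes_width: "\<not> validates (Up P1) width_axiom"
proof
  let ?V = "\<lambda>n::nat. if n = 0 then {1, 4} else if n = 1 then {2, 4} else {3, 4 :: nat}"
  have up_P: "up P1 0 = {0, 1, 2, 3, 4}"
    "up P1 (Suc 0) = {1, 4}"
    "up P1 2 = {2, 4}"
    "up P1 3 = {3, 4}"
    "up P1 4 = {4}"
    by (auto simp: up_def P1_def)
  have carrier_P: "carrier P1 = {0, 1, 2, 3, 4}"
    by (simp add: P1_def)
  have V: "?V \<in> UNIV \<rightarrow> carrier (Up P1)"
    by (rule Pi_I) (simp add: carrier_Up carrier_P up_P)
  assume "validates (Up P1) width_axiom"
  from validates_Up_forces[OF partial_order_P(1) this V, of 0] show False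
    by (simp add: width_axiom_def up_P carrier_P)
qed

lemma P2_refutes_three_point: "\<not> validates (Up P2) three_point_axiom"
proof
  let ?V = "\<lambda>n::nat. if n = 0 then {1, 4} else if n = 1 then {2, 3, 4} else {3, 4 :: nat}"
  have up_P: "up P2 0 = {0, 1, 2, 3, 4}"
    "up P2 (Suc 0) = {1, 4}"
    "up P2 2 = {2, 3, 4}"
    "up P2 3 = {3, 4}"
    "up P2 4 = {4}"
    by (auto simp: up_def P2_def)
  have carrier_P: "carrier P2 = {0, 1, 2, 3, 4}"
    by (simp add: P2_def)
  have V: "?V \<in> UNIV \<rightarrow> carrier (Up P2)"
    by (rule Pi_I) (simp add: carrier_Up carrier_P up_P)
  assume "validates (Up P2) three_point_axiom"
  from validates_Up_forces[OF partial_order_P(2) this V, of 0] show False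
    by (simp add: three_point_axiom_def up_P carrier_P)
qed

lemma P3_refutes_weak_excluded_middle: "\<not> validates (Up P3) weak_excluded_middle"
proof
  let ?V = "\<lambda>n::nat. {1 :: nat}"
  have up_P: "up P3 0 = {0, 1, 2}"
    "up P3 (Suc 0) = {1}"
    "up P3 2 = {2}"
    by (auto simp: up_def P3_def)
  have carrier_P: "carrier P3 = {0, 1, 2}"
    by (simp add: P3_def)
  have V: "?V \<in> UNIV \<rightarrow> carrier (Up P3)"
    by (rule Pi_I) (simp add: carrier_Up carrier_P up_P)
  assume "validates (Up P3) weak_excluded_middle"
  from validates_Up_forces[OF partial_order_P(3) this V, of 0] show False
    by (simp add: weak_excluded_middle_def up_P carrier_P)
qed

lemma P4_refutes_interpolation: "\<not> validates (Up P4) interpolation_axiom"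
proof
  let ?V = "\<lambda>n::nat. if n = 0 then {1, 3, 4, 5} else if n = 1 then {2, 3, 4, 5}
    else if n = 2 then {3, 5} else {4, 5 :: nat}"
  have up_P: "up P4 0 = {0, 1, 2, 3, 4, 5}"
    "up P4 (Suc 0) = {1, 3, 4, 5}"
    "up P4 2 = {2, 3, 4, 5}"
    "up P4 3 = {3, 5}"
    "up P4 4 = {4, 5}"
    "up P4 5 = {5}"
    by (auto simp: up_def P4_def)
  have carrier_P: "carrier P4 = {0, 1, 2, 3, 4, 5}"
    by (simp add: P4_def)
  have V: "?V \<in> UNIV \<rightarrow> carrier (Up P4)"
    by (rule Pi_I) (simp add: carrier_Up carrier_P up_P)
  assume "validates (Up P4) interpolation_axiom"
  from validates_Up_forces[OF partial_order_P(4) this V, of 0] show False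
    by (simp add: interpolation_axiom_def up_P carrier_P)
qed

lemma diamond_system_validates_axioms:
  assumes A: "heyting_algebra A" and d: "diamond_system (prime_spectrum A)" and p: "p \<in> diamond_axioms"
  shows "validates A p"
proof -
  interpret heyting_gorder A by (rule heyting_gorder.intro[OF A])
  interpret d: diamond_system "prime_spectrum A" by (rule d)
  have "prime_extent A \<circ> v \<in> UNIV \<rightarrow> carrier (Up (prime_spectrum A))" for v :: "nat \<Rightarrow> 'a"
    by (auto simp: carrier_Up up_prime_spectrum prime_extent_def)
  then show ?thesis
    using d.forces_diamond_axioms[OF _ _ p] by (auto simp: validates_iff_forces[OF A])
qed

lemma diamond_system_no_forbidden:
  assumes A: "heyting_algebra A" and d: "diamond_system (prime_spectrum A)"
    and P: "P \<in> {P1, P2, P3, P4}"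
  shows "\<not> subalgebra_of_hom_image (Up P) A"
proof
  assume sub: "subalgebra_of_hom_image (Up P) A"
  have "partial_order P" using P partial_order_P by auto
  then have "validates (Up P) p" if "p \<in> diamond_axioms" for p
    using validates_subalgebra_of_hom_image[OF heyting_algebra_Up A sub]
      diamond_system_validates_axioms[OF A d that] by blast
  then show False
    using P P1_refutes_width P2_refutes_three_point P3_refutes_weak_excluded_middle
      P4_refutes_interpolation by (auto simp: diamond_axioms_def)
qed

text \<open>The generated variety lies in every variety containing the generators, so it suffices to
  test it against the equations between the axioms and \<open>Top\<close>.\<close>

lemma DHA_diamond_system:
  assumes A: "A \<in> DHA"
  shows "diamond_system (prime_spectrum A)"
proof -
  let ?E = "{(p, Top) | p. p \<in> diamond_axioms}"
  let ?K = "{Up X | X :: nat gorder. finite (carrier X) \<and> diamond_sequence X}"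
  have "?K \<subseteq> variety ?E"
  proof
    fix B assume "B \<in> ?K"
    then obtain X :: "nat gorder" where B: "B = Up X" and "diamond_sequence X" by blast
    then interpret X: diamond_sequence X by blast
    note po = X.partial_order_axioms
    have "eval (Up X) V p = \<top>\<^bsub>Up X\<^esub>" if "V \<in> UNIV \<rightarrow> carrier (Up X)" "p \<in> diamond_axioms" for V p
      using X.forces_diamond_axioms[OF that(1) _ that(2)] by (auto simp: eval_Up[OF po that(1)] top_Up[OF po])
    then show "B \<in> variety ?E"
      by (auto simp: B variety_def satisfies_def heyting_algebra_Up[OF po])
  qed
  then have "A \<in> variety ?E"
    using A unfolding DHA_def generated_variety_def by blast
  then have "heyting_algebra A" "\<And>p. p \<in> diamond_axioms \<Longrightarrow> validates A p"
    by (auto simp: variety_def validates_def)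
  then show ?thesis
    using heyting_gorder.diamond_system_prime_spectrum[OF heyting_gorder.intro] by blast
qed

section \<open>Finite p-morphic images of diamond sequences\<close>

primrec var_bound :: "form \<Rightarrow> nat" where
  "var_bound (Var n) = Suc n"
| "var_bound Bot = 0"
| "var_bound Top = 0"
| "var_bound (And p q) = max (var_bound p) (var_bound q)"
| "var_bound (Or p q) = max (var_bound p) (var_bound q)"
| "var_bound (Imp p q) = max (var_bound p) (var_bound q)"

definition p_morphism :: "'a gorder \<Rightarrow> 'b gorder \<Rightarrow> ('a \<Rightarrow> 'b) \<Rightarrow> bool"
  where "p_morphism X Q f \<longleftrightarrow> f \<in> carrier X \<rightarrow> carrier Q \<and>
    (\<forall>x\<in>carrier X. \<forall>y\<in>up X x. f x \<sqsubseteq>\<^bsub>Q\<^esub> f y) \<and>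
    (\<forall>x\<in>carrier X. \<forall>q\<in>up Q (f x). \<exists>y\<in>up X x. f y = q)"

text \<open>Agreement is required only for the variables below \<open>var_bound p\<close>; this is
  what permits a finite target.\<close>

lemma forces_p_morphism:
  assumes f: "p_morphism X Q f" and x: "x \<in> carrier X"
    and V: "\<And>n y. \<lbrakk>n < var_bound p; y \<in> carrier X\<rbrakk> \<Longrightarrow> f y \<in> W n \<longleftrightarrow> y \<in> V n"
  shows "forces Q W p (f x) \<longleftrightarrow> forces X V p x"
  using x V
proof (induction p arbitrary: x)
  case (Imp p q)
  have IH: "forces Q W p (f y) \<longleftrightarrow> forces X V p y" "forces Q W q (f y) \<longleftrightarrow> forces X V q y"
    if "y \<in> carrier X" for y
    using Imp that by simp_all
  have up: "up Q (f x) = f ` up X x"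
  proof
    show "up Q (f x) \<subseteq> f ` up X x"
    proof
      fix q assume "q \<in> up Q (f x)"
      then obtain y where "y \<in> up X x" "f y = q"
        using f Imp.prems(1) unfolding p_morphism_def by blast
      then show "q \<in> f ` up X x" by blast
    qed
    show "f ` up X x \<subseteq> up Q (f x)"
      using f Imp.prems(1) by (auto simp: p_morphism_def mem_up_iff Pi_iff)
  qed
  have "y \<in> carrier X" if "y \<in> up X x" for y using that by (simp add: mem_up_iff)
  then show ?case
    by (simp add: up IH)
qed simp_all

text \<open>With a least element, (D1)--(D3) hold globally. Incomparable images have incomparable
  preimages, and a configuration in \<open>Q\<close> is pulled back by lifting its upper points
  above a preimage of a lower one.\<close>

lemma (in diamond_system) diamond_sequence_p_morphic_image:
  assumes Q: "partial_order Q" and f: "p_morphism X Q f" "f ` carrier X = carrier Q"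
    and r: "r \<in> carrier X" "\<And>x. x \<in> carrier X \<Longrightarrow> r \<sqsubseteq> x"
  shows "diamond_sequence Q"
proof -
  interpret Q: poset Q by (rule poset.intro[OF Q])
  have upr: "up X r = carrier X" using r by (auto simp: mem_up_iff)
  have mono: "f x \<sqsubseteq>\<^bsub>Q\<^esub> f y" if "x \<in> carrier X" "y \<in> carrier X" "x \<sqsubseteq> y" for x y
  proof -
    have "y \<in> up X x" using that by (simp add: mem_up_iff)
    then show ?thesis using f(1) that(1) unfolding p_morphism_def by blast
  qed
  have lift: "\<exists>y\<in>carrier X. x \<sqsubseteq> y \<and> f y = q" if "x \<in> carrier X" "q \<in> carrier Q" "f x \<sqsubseteq>\<^bsub>Q\<^esub> q" for x q
  proof -
    have "q \<in> up Q (f x)" using that by (simp add: mem_up_iff)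
    then have "\<exists>y\<in>up X x. f y = q" using f(1) that(1) by (simp add: p_morphism_def)
    then show ?thesis by (auto simp: mem_up_iff)
  qed
  have onto: "\<exists>x\<in>carrier X. f x = q" if "q \<in> carrier Q" for q
  proof -
    have "q \<in> f ` carrier X" using f(2) that by simp
    then show ?thesis by blast
  qed
  have fQ: "f x \<in> carrier Q" if "x \<in> carrier X" for x
    using f(2) that by blast
  have inc: "incomparable X x y" if "incomparable Q (f x) (f y)" "x \<in> carrier X" "y \<in> carrier X" for x y
    using that mono by (auto simp: incomparable_def)
  have Q_three_point: "q2 \<sqsubseteq>\<^bsub>Q\<^esub> q3" if q: "q1 \<in> carrier Q" "q2 \<in> carrier Q" "q3 \<in> carrier Q"
    "incomparable Q q1 q2" "q1 \<sqsubseteq>\<^bsub>Q\<^esub> q3" "q1 \<noteq> q3" "q2 \<noteq> q3" for q1 q2 q3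
  proof -
    obtain x y where x: "x \<in> carrier X" "f x = q1" and y: "y \<in> carrier X" "f y = q2"
      using onto[OF q(1)] onto[OF q(2)] by blast
    obtain z where z: "z \<in> carrier X" "x \<sqsubseteq> z" "f z = q3" using lift[OF x(1)] x(2) q by blast
    have "y \<sqsubseteq> z"
      using three_point[OF r(1), of x y z] inc[of x y] x y z q unfolding upr by blast
    then show ?thesis using mono[OF y(1) z(1)] y z by simp
  qed
  have "diamond_system Q"
  proof (rule diamond_systemI[OF Q])
    fix x y z w
    assume "y \<in> up Q x" "z \<in> up Q x" "w \<in> up Q x"
    then have C: "y \<in> carrier Q" "z \<in> carrier Q" "w \<in> carrier Q" by (simp_all add: mem_up_iff)
    { assume "incomparable Q y z" "y \<sqsubseteq>\<^bsub>Q\<^esub> w" "y \<noteq> w" "z \<noteq> w"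
      then show "z \<sqsubseteq>\<^bsub>Q\<^esub> w" using Q_three_point C by blast }
    { assume i: "incomparable Q y z" "incomparable Q y w" "incomparable Q z w"
      obtain a b c where "a \<in> carrier X" "f a = y" "b \<in> carrier X" "f b = z" "c \<in> carrier X" "f c = w"
        using onto C by metis
      then show False
        using no_three_antichain[OF r(1), of a b c] inc i unfolding upr by blast }
  next
    fix x y z
    assume "y \<in> up Q x" "z \<in> up Q x"
    then have C: "y \<in> carrier Q" "z \<in> carrier Q" by (simp_all add: mem_up_iff)
    obtain a b where a: "a \<in> carrier X" "f a = y" and b: "b \<in> carrier X" "f b = z"
      using onto C by metis
    obtain c where c: "c \<in> carrier X" "a \<sqsubseteq> c" "b \<sqsubseteq> c"
      using D3[OF r(1), of a b] a b unfolding upr by blast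
    then have "f c \<in> carrier Q" "y \<sqsubseteq>\<^bsub>Q\<^esub> f c" "z \<sqsubseteq>\<^bsub>Q\<^esub> f c"
      using mono a b fQ by blast+
    then show "\<exists>w\<in>carrier Q. y \<sqsubseteq>\<^bsub>Q\<^esub> w \<and> z \<sqsubseteq>\<^bsub>Q\<^esub> w" by blast
  next
    fix r' x y z v t
    assume "x \<in> up Q r'" "y \<in> up Q r'" "z \<in> up Q x" "z \<in> up Q y" "v \<in> up Q x" "v \<in> up Q y"
    then have C: "x \<in> carrier Q" "y \<in> carrier Q" "z \<in> carrier Q" "v \<in> carrier Q"
      and le: "x \<sqsubseteq>\<^bsub>Q\<^esub> z" "x \<sqsubseteq>\<^bsub>Q\<^esub> v" "y \<sqsubseteq>\<^bsub>Q\<^esub> z" "y \<sqsubseteq>\<^bsub>Q\<^esub> v" by (simp_all add: mem_up_iff)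
    show "\<exists>w\<in>carrier Q. x \<sqsubseteq>\<^bsub>Q\<^esub> w \<and> y \<sqsubseteq>\<^bsub>Q\<^esub> w \<and> w \<sqsubseteq>\<^bsub>Q\<^esub> z \<and> w \<sqsubseteq>\<^bsub>Q\<^esub> v"
    \<comment> \<open>If one of the two pairs is comparable, one of the four points is itself the
      interpolant.\<close>
    proof (cases "incomparable Q x y \<and> incomparable Q z v")
      case False
      then consider "x \<sqsubseteq>\<^bsub>Q\<^esub> y" | "y \<sqsubseteq>\<^bsub>Q\<^esub> x" | "z \<sqsubseteq>\<^bsub>Q\<^esub> v" | "v \<sqsubseteq>\<^bsub>Q\<^esub> z"
        by (auto simp: incomparable_def)
      then show ?thesis using C le Q.le_refl by cases blast+
    next
      case True
      obtain a b where a: "a \<in> carrier X" "f a = x" and b: "b \<in> carrier X" "f b = y"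
        using onto C by metis
      obtain c where c: "c \<in> carrier X" "a \<sqsubseteq> c" "f c = z" using lift[OF a(1)] a(2) C le by blast
      obtain d where d: "d \<in> carrier X" "a \<sqsubseteq> d" "f d = v" using lift[OF a(1)] a(2) C le by blast
      have iab: "incomparable X a b" using inc True a b by blast
      have ne: "x \<noteq> z" "y \<noteq> z" "x \<noteq> v" "y \<noteq> v"
        using True le by (auto simp: incomparable_def)
      \<comment> \<open>The lifts \<open>c\<close> and \<open>d\<close> were taken above
        \<open>a\<close> only; the three point rule puts \<open>b\<close> below them too.\<close>
      then have bcd: "b \<sqsubseteq> c" "b \<sqsubseteq> d"
        using three_point[OF r(1), of a b c] three_point[OF r(1), of a b d] iab a b c d unfolding upr by blast+
      obtain t where t: "t \<in> carrier X" "c \<sqsubseteq> t" "d \<sqsubseteq> t"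
        using D3[OF r(1), of c d] c d unfolding upr by blast
      obtain w where w: "w \<in> carrier X" "a \<sqsubseteq> w" "b \<sqsubseteq> w" "w \<sqsubseteq> c" "w \<sqsubseteq> d"
        using D4[of r a b c d t] r a b c d t bcd by blast
      then have "f w \<in> carrier Q" "x \<sqsubseteq>\<^bsub>Q\<^esub> f w" "y \<sqsubseteq>\<^bsub>Q\<^esub> f w" "f w \<sqsubseteq>\<^bsub>Q\<^esub> z" "f w \<sqsubseteq>\<^bsub>Q\<^esub> v"
        using mono a b c d fQ by blast+
      then show ?thesis by blast
    qed
  qed
  moreover have "\<exists>w\<in>carrier Q. w \<sqsubseteq>\<^bsub>Q\<^esub> q \<and> w \<sqsubseteq>\<^bsub>Q\<^esub> q'" if "q \<in> carrier Q" "q' \<in> carrier Q" for q q'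
  proof -
    have "f r \<sqsubseteq>\<^bsub>Q\<^esub> p" if "p \<in> carrier Q" for p
      using onto[OF that] mono[OF r(1)] r(2) by blast
    with that fQ[OF r(1)] show ?thesis by blast
  qed
  ultimately show ?thesis
    by (simp add: diamond_sequence_def diamond_sequence_axioms_def)
qed

text \<open>The other point of the layer of \<open>y\<close>. A point comparable to all points forms
  a layer alone and is its own partner; uniqueness of the choice is shown below in the presence of a
  least element.\<close>

definition partner :: "'a gorder \<Rightarrow> 'a \<Rightarrow> 'a"
  where "partner X y = (if \<exists>z\<in>carrier X. incomparable X y z
    then SOME z. z \<in> carrier X \<and> incomparable X y z else y)"

text \<open>The back condition holds for the following reason: if the type of x is included in that
  of z although x is not below z, then z is below x or is the partner of x. In both cases the types
  coincide, so x itself is the required lift.\<close>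

lemma (in diamond_system) finite_diamond_quotient:
  fixes N :: nat
  assumes r: "r \<in> carrier X" "\<And>x. x \<in> carrier X \<Longrightarrow> r \<sqsubseteq> x"
    and V: "V \<in> UNIV \<rightarrow> carrier (Up X)"
  obtains Q :: "nat gorder" and f W where "finite (carrier Q)" "diamond_sequence Q"
    "W \<in> UNIV \<rightarrow> carrier (Up Q)" "p_morphism X Q f"
    "\<And>n y. \<lbrakk>n < N; y \<in> carrier X\<rbrakk> \<Longrightarrow> f y \<in> W n \<longleftrightarrow> y \<in> V n"
proof -
  let ?C = "carrier X" and ?p = "partner X"
  have upr: "up X r = ?C" using r by (auto simp: mem_up_iff)
  note tp = three_point[OF r(1), unfolded upr] and na = no_three_antichain[OF r(1), unfolded upr]
  have pers: "z \<in> V n" if "y \<in> V n" "y \<sqsubseteq> z" "z \<in> ?C" for y z n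
  proof -
    have "up X y \<subseteq> V n" using V that(1) unfolding carrier_Up by blast
    with that(2,3) show ?thesis by (auto simp: mem_up_iff)
  qed
  \<comment> \<open>Two points incomparable to \<open>y\<close> would be incomparable to each other
    by the three point rule, giving a three-element antichain.\<close>
  have uniq: "z = w" if "incomparable X y z" "incomparable X y w" "y \<in> ?C" "z \<in> ?C" "w \<in> ?C" for y z w
  proof (rule ccontr)
    assume "z \<noteq> w"
    have "z \<sqsubseteq> w \<Longrightarrow> y \<sqsubseteq> w" "w \<sqsubseteq> z \<Longrightarrow> y \<sqsubseteq> z"
      using tp[of z y w] tp[of w y z] that \<open>z \<noteq> w\<close> by (auto simp: incomparable_def)
    then have "incomparable X z w" using that by (auto simp: incomparable_def)
    then show False using na[of y z w] that by blast
  qed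
  have pC: "?p y \<in> ?C" and p_cases: "?p y = y \<or> incomparable X y (?p y)" if "y \<in> ?C" for y
    using that someI_ex[of "\<lambda>z. z \<in> ?C \<and> incomparable X y z"] by (auto simp: partner_def)
  have p_inc: "?p y = z" if "incomparable X y z" "y \<in> ?C" "z \<in> ?C" for y z
  proof -
    have "\<exists>z. z \<in> ?C \<and> incomparable X y z" using that by blast
    from someI_ex[OF this] have "incomparable X y (?p y)" using that by (auto simp: partner_def)
    then show ?thesis using uniq[of y "?p y" z] that pC by blast
  qed
  have pp: "?p (?p y) = y" if "y \<in> ?C" for y
    using p_cases[OF that] p_inc[of "?p y" y] pC[OF that] that incomparable_sym[of X y "?p y"] by auto
  have p_below: "?p y \<sqsubseteq> z" if "y \<in> ?C" "z \<in> ?C" "y \<sqsubseteq> z" "y \<noteq> z" for y z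
    using p_cases[OF that(1)] tp[of y "?p y" z] pC[OF that(1)] that by (auto simp: incomparable_def)
  have p_above: "y \<sqsubseteq> ?p z" if "y \<in> ?C" "z \<in> ?C" "y \<sqsubseteq> z" "y \<noteq> z" for y z
  proof (rule ccontr)
    assume no: "\<not> y \<sqsubseteq> ?p z"
    then have inc: "incomparable X z (?p z)" using p_cases[OF that(2)] that by auto
    show False
    proof (cases "?p z \<sqsubseteq> y")
      case True
      then show ?thesis
        using le_trans[of "?p z" y z] that inc pC[OF that(2)] by (auto simp: incomparable_def)
    next
      case False
      then have "incomparable X (?p z) y" using no by (auto simp: incomparable_def)
      then have "z = y"
        using uniq[of "?p z" z y] incomparable_sym[OF inc] pC[OF that(2)] that(1,2) by blast
      then show ?thesis using that by blast
    qed
  qed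
  have p_mono: "?p y \<sqsubseteq> ?p z" if yz: "y \<in> ?C" "z \<in> ?C" "y \<sqsubseteq> z" for y z
  proof (cases "y = z")
    case True
    then show ?thesis using pC[OF yz(1)] by simp
  next
    case False
    have le: "?p y \<sqsubseteq> z" using p_below[OF yz False] .
    show ?thesis
    proof (cases "?p y = z")
      case True
      then show ?thesis using p_cases[OF yz(1)] yz False by (auto simp: incomparable_def)
    next
      case False
      then show ?thesis using p_above[OF pC[OF yz(1)] yz(2) le] by blast
    qed
  qed
  \<comment> \<open>The type of a point as a finite set of bits: bit \<open>2 * n\<close> is for the
    point and the nth upset, bit \<open>2 * n + 1\<close> for its partner.\<close>
  define \<sigma> where "\<sigma> y = {m. m < 2 * N \<and> (if even m then y \<in> V (m div 2) else ?p y \<in> V (m div 2))}" for y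
  have fin: "finite (\<sigma> y)" for y
    by (rule finite_subset[of _ "{..<2 * N}"]) (auto simp: \<sigma>_def)
  have \<sigma>_sub: "\<sigma> y \<subseteq> \<sigma> z \<longleftrightarrow> (\<forall>n<N. (y \<in> V n \<longrightarrow> z \<in> V n) \<and> (?p y \<in> V n \<longrightarrow> ?p z \<in> V n))" for y z
  proof
    assume sub: "\<sigma> y \<subseteq> \<sigma> z"
    show "\<forall>n<N. (y \<in> V n \<longrightarrow> z \<in> V n) \<and> (?p y \<in> V n \<longrightarrow> ?p z \<in> V n)"
    proof (intro allI impI)
      fix n assume "n < N"
      then have "2 * n \<in> \<sigma> u \<longleftrightarrow> u \<in> V n" "2 * n + 1 \<in> \<sigma> u \<longleftrightarrow> ?p u \<in> V n" for u
        by (auto simp: \<sigma>_def)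
      then show "(y \<in> V n \<longrightarrow> z \<in> V n) \<and> (?p y \<in> V n \<longrightarrow> ?p z \<in> V n)" using sub by blast
    qed
  next
    assume all: "\<forall>n<N. (y \<in> V n \<longrightarrow> z \<in> V n) \<and> (?p y \<in> V n \<longrightarrow> ?p z \<in> V n)"
    show "\<sigma> y \<subseteq> \<sigma> z"
    proof
      fix m assume m: "m \<in> \<sigma> y"
      then have "m div 2 < N" by (auto simp: \<sigma>_def)
      then show "m \<in> \<sigma> z" using all m by (auto simp: \<sigma>_def split: if_splits)
    qed
  qed
  \<comment> \<open>Types are coded as numbers because the generators of \<open>DHA\<close> live on
    natural numbers; decoding then gives the order of \<open>Q\<close> as inclusion.\<close>
  define f where "f y = set_encode (\<sigma> y)" for y
  have dec: "set_decode (f y) = \<sigma> y" for y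
    using fin by (simp add: f_def)
  define Q :: "nat gorder" where
    "Q = \<lparr>carrier = f ` ?C, eq = (=), le = (\<lambda>m n. set_decode m \<subseteq> set_decode n)\<rparr>"
  define W where "W n = {q \<in> carrier Q. 2 * n \<in> set_decode q}" for n
  have Q: "partial_order Q"
    by (rule partial_orderI) (auto simp: Q_def dest: arg_cong[of _ _ set_encode])
  have pm: "p_morphism X Q f"
    unfolding p_morphism_def
  proof (intro conjI ballI)
    show "f \<in> ?C \<rightarrow> carrier Q" by (simp add: Q_def)
  next
    fix x y assume x: "x \<in> ?C" and y: "y \<in> up X x"
    then have "y \<in> ?C" "x \<sqsubseteq> y" by (simp_all add: mem_up_iff)
    then show "f x \<sqsubseteq>\<^bsub>Q\<^esub> f y"
      using pers p_mono[OF x] pC x by (auto simp: Q_def dec \<sigma>_sub)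
  next
    fix x q assume x: "x \<in> ?C" and "q \<in> up Q (f x)"
    then obtain z where z: "z \<in> ?C" "q = f z" and sub: "\<sigma> x \<subseteq> \<sigma> z"
      by (auto simp: mem_up_iff Q_def dec)
    show "\<exists>y\<in>up X x. f y = q"
    proof (cases "x \<sqsubseteq> z")
      case True
      then show ?thesis using z by (auto simp: mem_up_iff)
    next
      case False
      have "\<sigma> z \<subseteq> \<sigma> x"
      proof (cases "z \<sqsubseteq> x")
        case True
        then show ?thesis using pers p_mono[OF z(1) x] pC x unfolding \<sigma>_sub by blast
      next
        case nle: False
        then have "?p x = z" using p_inc[of x z] False x z by (simp add: incomparable_def)
        \<comment> \<open>For partners the inclusion \<open>sub\<close> also gives its converse,
          since passing to partners exchanges the two points.\<close>
        then show ?thesis using sub pp[OF x] unfolding \<sigma>_sub by auto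
      qed
      then have "f x = q" using sub z(2) by (simp add: f_def)
      then show ?thesis using x by (auto simp: mem_up_iff)
    qed
  qed
  have img: "f ` ?C = carrier Q" by (simp add: Q_def)
  show thesis
  proof (rule that[OF _ _ _ pm])
    have "f ` ?C \<subseteq> set_encode ` Pow {..<2 * N}"
      by (auto simp: f_def \<sigma>_def)
    then show "finite (carrier Q)" unfolding img[symmetric] by (rule finite_subset) simp
    show "diamond_sequence Q"
      by (rule diamond_sequence_p_morphic_image[OF Q pm img r])
    show "W \<in> UNIV \<rightarrow> carrier (Up Q)"
      by (auto simp: W_def carrier_Up mem_up_iff) (auto simp: Q_def)
    show "f y \<in> W n \<longleftrightarrow> y \<in> V n" if "n < N" "y \<in> ?C" for n y
      using that img by (auto simp: W_def dec \<sigma>_def)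
  qed
qed

section \<open>Transfer of a failing equation to a finite diamond sequence\<close>

lemma diamond_system_DHA:
  fixes A :: "'a gorder"
  assumes A: "heyting_algebra A" and d: "diamond_system (prime_spectrum A)"
  shows "A \<in> DHA"
  unfolding DHA_def generated_variety_def
proof (rule INT_I, simp only: mem_Collect_eq)
  fix E
  assume E: "{Up X | X :: nat gorder. finite (carrier X) \<and> diamond_sequence X} \<subseteq> variety E"
  interpret heyting_gorder A by (rule heyting_gorder.intro[OF A])
  let ?S = "prime_spectrum A"
  interpret S: diamond_system ?S by (rule d)
  \<comment> \<open>Equations are read in both directions, so one inequality suffices; its failure
    is witnessed by a prime filter \<open>r\<close>, the root of the poset to be collapsed.\<close>
  have le: "eval A v s \<sqsubseteq>\<^bsub>A\<^esub> eval A v t"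
    if e: "(s, t) \<in> E \<or> (t, s) \<in> E" and v: "v \<in> UNIV \<rightarrow> carrier A" for s t v
  proof (rule ccontr)
    note c = eval_closed[OF A v]
    assume "\<not> ?thesis"
    then obtain r where r: "prime_filter A r" "eval A v s \<in> r" "eval A v t \<notin> r"
      using prime_filter_separates[OF c c] by blast
    define Y where "Y = subposet ?S (up ?S r)"
    interpret Y: diamond_sequence Y
      unfolding Y_def by (rule S.diamond_system_up) (use r in simp)
    have rY: "r \<in> carrier Y" "\<And>x. x \<in> carrier Y \<Longrightarrow> r \<sqsubseteq>\<^bsub>Y\<^esub> x"
      using r by (auto simp: Y_def up_prime_spectrum)
    have upY: "up Y y = up ?S y" if "y \<in> carrier Y" for y
      using that by (auto simp: Y_def up_def)
    define V where "V n = prime_extent A (v n) \<inter> carrier Y" for n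
    have V: "V \<in> UNIV \<rightarrow> carrier (Up Y)"
    proof (rule Pi_I, simp only: carrier_Up mem_Collect_eq, intro conjI ballI)
      show "V n \<subseteq> carrier Y" for n by (auto simp: V_def)
      show "up Y F \<subseteq> V n" if "F \<in> V n" for n F
      proof
        fix G assume G: "G \<in> up Y F"
        moreover have "G \<in> carrier Y" using G by (simp add: mem_up_iff)
        ultimately show "G \<in> V n"
          using that upY[of F] by (auto simp: V_def prime_extent_def up_prime_spectrum)
      qed
    qed
    \<comment> \<open>Forcing only looks upwards and \<open>Y\<close> is an upset, so restricting to
      it changes no truth value.\<close>
    have fY: "forces Y V p y \<longleftrightarrow> forces ?S (prime_extent A \<circ> v) p y" if "y \<in> carrier Y" for p y
      using that
    proof (induction p arbitrary: y)
      case (Imp p q)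
      have "z \<in> carrier Y" if "z \<in> up ?S y" for z
        using that Imp.prems by (auto simp: Y_def up_prime_spectrum)
      then show ?case using Imp upY by simp
    qed (auto simp: V_def)
    let ?N = "max (var_bound s) (var_bound t)"
    obtain Q :: "nat gorder" and f W where Q: "finite (carrier Q)" "diamond_sequence Q"
      and W: "W \<in> UNIV \<rightarrow> carrier (Up Q)" and f: "p_morphism Y Q f"
      and fW: "\<And>n y. \<lbrakk>n < ?N; y \<in> carrier Y\<rbrakk> \<Longrightarrow> f y \<in> W n \<longleftrightarrow> y \<in> V n"
      by (rule Y.finite_diamond_quotient[OF rY V, where N = ?N], assumption, (rule that; (assumption | simp)))
    interpret Q: diamond_sequence Q by (rule Q(2))
    have "satisfies (Up Q) (s, t) \<or> satisfies (Up Q) (t, s)"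
    proof -
      have "Up Q \<in> variety E" using E Q by blast
      then show ?thesis using e by (auto simp: variety_def)
    qed
    then have "eval (Up Q) W s = eval (Up Q) W t"
      using W by (auto simp: satisfies_def)
    moreover have "f r \<in> carrier Q" using f rY by (auto simp: p_morphism_def)
    ultimately have "forces Q W s (f r) \<longleftrightarrow> forces Q W t (f r)"
      using eval_Up[OF Q.partial_order_axioms W] by blast
    then have "forces Y V s r \<longleftrightarrow> forces Y V t r"
      using forces_p_morphism[OF f rY(1), of s W V] forces_p_morphism[OF f rY(1), of t W V] fW by simp
    then show False
      using r fY[OF rY(1)] eval_mem_prime_filter[OF A v r(1)] by blast
  qed
  have "eval A v s = eval A v t" if "(s, t) \<in> E" "v \<in> UNIV \<rightarrow> carrier A" for s t v
    using le[of s t v] le[of t s v] that eval_closed[OF A that(2)] by (auto intro: le_antisym)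
  then show "A \<in> variety E"
    using A by (auto simp: variety_def satisfies_def)
qed

section \<open>Reductions onto the forbidden posets\<close>

text \<open>
  The members of \<open>R\<close> play the role of the clopen upsets of an Esakia space. The only consequence
  of compactness needed is that points without a common upper bound have disjoint neighbourhoods in \<open>R\<close>.
\<close>

locale descriptive_frame = poset X for X :: "'a gorder" (structure) +
  fixes R :: "'a set set"
  assumes R_carrier: "\<lbrakk>U \<in> R; y \<in> U\<rbrakk> \<Longrightarrow> y \<in> carrier X"
    and R_up: "\<lbrakk>U \<in> R; y \<in> U; z \<in> up X y\<rbrakk> \<Longrightarrow> z \<in> U"
    and R_empty: "{} \<in> R"
    and R_Un: "\<lbrakk>U \<in> R; V \<in> R\<rbrakk> \<Longrightarrow> U \<union> V \<in> R"
    and R_Int: "\<lbrakk>U \<in> R; V \<in> R\<rbrakk> \<Longrightarrow> U \<inter> V \<in> R"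
    and R_imp: "\<lbrakk>U \<in> R; V \<in> R\<rbrakk> \<Longrightarrow> {y \<in> carrier X. up X y \<inter> U \<subseteq> V} \<in> R"
    and separation: "\<lbrakk>y \<in> carrier X; z \<in> carrier X; \<not> y \<sqsubseteq> z\<rbrakk> \<Longrightarrow> \<exists>U\<in>R. y \<in> U \<and> z \<notin> U"
    and disjoint_clopens:
      "\<lbrakk>y \<in> carrier X; z \<in> carrier X; \<And>w. \<lbrakk>w \<in> carrier X; y \<sqsubseteq> w; z \<sqsubseteq> w\<rbrakk> \<Longrightarrow> False\<rbrakk>
        \<Longrightarrow> \<exists>U\<in>R. \<exists>V\<in>R. y \<in> U \<and> z \<in> V \<and> U \<inter> V = {}"
begin

lemma up_self: "y \<in> carrier X \<Longrightarrow> y \<in> up X y"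
  by (simp add: mem_up_iff)

lemma up_carrier: "y \<in> up X x \<Longrightarrow> y \<in> carrier X"
  by (simp add: mem_up_iff)

lemma R_top: "carrier X \<in> R"
  using R_imp[OF R_empty R_empty] by simp

text \<open>The root clause and the back clause together give surjectivity. Only preimages of
  principal upsets are required to be clopen, because in a finite \<open>P\<close> every upset is a
  finite union of these.\<close>

definition reduces_to :: "nat gorder \<Rightarrow> bool"
  where "reduces_to P \<longleftrightarrow> (\<exists>x\<in>carrier X. \<exists>f.
    (\<forall>y\<in>up X x. f y \<in> carrier P) \<and>
    (\<forall>y\<in>up X x. \<forall>z\<in>up X y. f y \<sqsubseteq>\<^bsub>P\<^esub> f z) \<and>
    (\<forall>y\<in>up X x. \<forall>q\<in>carrier P. f y \<sqsubseteq>\<^bsub>P\<^esub> q \<longrightarrow> (\<exists>z\<in>up X y. f z = q)) \<and>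
    (\<forall>q\<in>carrier P. f x \<sqsubseteq>\<^bsub>P\<^esub> q) \<and>
    (\<forall>q\<in>carrier P. \<exists>U\<in>R. \<forall>y\<in>up X x. y \<in> U \<longleftrightarrow> q \<sqsubseteq>\<^bsub>P\<^esub> f y))"

text \<open>
  In the following rules \<open>U\<^sub>i\<close> is to become the preimage of the principal upset of the point
  numbered \<open>i\<close>, and \<open>T\<close> (for \<open>P\<^sub>4\<close>, \<open>U3 \<inter> U4\<close>) that of the top.
\<close>

lemma reduces_to_P1I:
  assumes x: "x \<in> carrier X" and R: "U1 \<in> R" "U2 \<in> R" "U3 \<in> R" "T \<in> R"
    and sub: "\<And>y. \<lbrakk>y \<in> up X x; y \<in> T\<rbrakk> \<Longrightarrow> y \<in> U1 \<and> y \<in> U2 \<and> y \<in> U3"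
    and int: "\<And>y. \<lbrakk>y \<in> up X x; y \<in> U1 \<and> y \<in> U2 \<or> y \<in> U1 \<and> y \<in> U3 \<or> y \<in> U2 \<and> y \<in> U3\<rbrakk> \<Longrightarrow> y \<in> T"
    and root: "x \<notin> U1" "x \<notin> U2" "x \<notin> U3"
    and top: "\<And>y. y \<in> up X x \<Longrightarrow> \<exists>z\<in>up X y. z \<in> T"
    and bot: "\<And>y. \<lbrakk>y \<in> up X x; y \<notin> U1; y \<notin> U2; y \<notin> U3\<rbrakk> \<Longrightarrow>
      (\<exists>z\<in>up X y. z \<in> U1 \<and> z \<notin> T) \<and> (\<exists>z\<in>up X y. z \<in> U2 \<and> z \<notin> T) \<and> (\<exists>z\<in>up X y. z \<in> U3 \<and> z \<notin> T)"
  shows "reduces_to P1"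
proof -
  \<comment> \<open>The tests run from the top downwards, so a fibre is an upset minus the parts
    sent higher; 0 receives what is left.\<close>
  define f :: "'a \<Rightarrow> nat" where
    "f y = (if y \<in> T then 4 else if y \<in> U1 then 1 else if y \<in> U2 then 2 else if y \<in> U3 then 3 else 0)" for y
  have upup: "z \<in> up X x" if "y \<in> up X x" "z \<in> up X y" for y z using up_trans[OF that x] .
  have f4: "f y = 4 \<longleftrightarrow> y \<in> T" and f1: "f y = 1 \<longleftrightarrow> y \<in> U1 \<and> y \<notin> T"
    and f2: "f y = 2 \<longleftrightarrow> y \<in> U2 \<and> y \<notin> T" and f3: "f y = 3 \<longleftrightarrow> y \<in> U3 \<and> y \<notin> T"
    and f0: "f y = 0 \<longleftrightarrow> y \<notin> U1 \<and> y \<notin> U2 \<and> y \<notin> U3" if "y \<in> up X x" for y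
    by (simp_all add: f_def) (use sub[OF that] int[OF that] in blast)+
  have flip: "n = f y \<longleftrightarrow> f y = n" for n y by auto
  have fC: "f y \<in> {0, 1, 2, 3, 4}" for y by (simp add: f_def)
  show ?thesis
    unfolding reduces_to_def
  proof (intro bexI[OF _ x] exI[of _ f] conjI ballI impI)
    show "f y \<in> carrier P1" for y using fC[of y] by (simp add: P1_def)
    show "f x \<sqsubseteq>\<^bsub>P1\<^esub> q" for q using f0[OF up_self[OF x]] root by (simp add: P1_def)
  next
    fix y z assume y: "y \<in> up X x" and z: "z \<in> up X y"
    show "f y \<sqsubseteq>\<^bsub>P1\<^esub> f z"
      using R_up[OF R(1) _ z] R_up[OF R(2) _ z] R_up[OF R(3) _ z] R_up[OF R(4) _ z] int[OF upup[OF y z]]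
      by (auto simp: P1_def f_def)
  next
    fix y q assume y: "y \<in> up X x" and q: "q \<in> carrier P1" "f y \<sqsubseteq>\<^bsub>P1\<^esub> q"
    then consider "f y = q" | "q = 4" | "f y = 0" "q = 1" | "f y = 0" "q = 2" | "f y = 0" "q = 3"
      by (auto simp: P1_def)
    then show "\<exists>z\<in>up X y. f z = q"
    proof cases
      case 1 then show ?thesis using up_self[OF up_carrier[OF y]] by blast
    next
      case 2 then show ?thesis using top[OF y] f4 upup[OF y] by blast
    next
      case 3 then show ?thesis using bot[OF y] f0[OF y] f1 upup[OF y] by blast
    next
      case 4 then show ?thesis using bot[OF y] f0[OF y] f2 upup[OF y] by blast
    next
      case 5 then show ?thesis using bot[OF y] f0[OF y] f3 upup[OF y] by blast
    qed
  next
    fix q assume "q \<in> carrier P1"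
    then consider "q = 0" | "q = 1" | "q = 2" | "q = 3" | "q = 4" by (auto simp: P1_def)
    then show "\<exists>U\<in>R. \<forall>y\<in>up X x. y \<in> U \<longleftrightarrow> q \<sqsubseteq>\<^bsub>P1\<^esub> f y"
    proof cases
      case 1 then show ?thesis using R_top up_carrier by (auto simp: P1_def intro!: bexI[of _ "carrier X"])
    next
      case 2 then show ?thesis using R(1) sub f1 f4 by (auto simp: P1_def flip intro!: bexI[of _ U1])
    next
      case 3 then show ?thesis using R(2) sub f2 f4 by (auto simp: P1_def flip intro!: bexI[of _ U2])
    next
      case 4 then show ?thesis using R(3) sub f3 f4 by (auto simp: P1_def flip intro!: bexI[of _ U3])
    next
      case 5 then show ?thesis using R(4) f4 by (auto simp: P1_def flip intro!: bexI[of _ T])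
    qed
  qed
qed

lemma reduces_to_P2I:
  assumes x: "x \<in> carrier X" and R: "U1 \<in> R" "U2 \<in> R" "U3 \<in> R" "T \<in> R"
    and sub: "\<And>y. \<lbrakk>y \<in> up X x; y \<in> T\<rbrakk> \<Longrightarrow> y \<in> U1 \<and> y \<in> U3"
    and sub': "\<And>y. \<lbrakk>y \<in> up X x; y \<in> U3\<rbrakk> \<Longrightarrow> y \<in> U2"
    and int: "\<And>y. \<lbrakk>y \<in> up X x; y \<in> U1; y \<in> U2\<rbrakk> \<Longrightarrow> y \<in> T"
    and root: "x \<notin> U1" "x \<notin> U2"
    and top: "\<And>y. y \<in> up X x \<Longrightarrow> \<exists>z\<in>up X y. z \<in> T"
    and mid: "\<And>y. \<lbrakk>y \<in> up X x; y \<in> U2; y \<notin> U3\<rbrakk> \<Longrightarrow> \<exists>z\<in>up X y. z \<in> U3 \<and> z \<notin> T"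
    and bot: "\<And>y. \<lbrakk>y \<in> up X x; y \<notin> U1; y \<notin> U2\<rbrakk> \<Longrightarrow>
      (\<exists>z\<in>up X y. z \<in> U1 \<and> z \<notin> T) \<and> (\<exists>z\<in>up X y. z \<in> U2 \<and> z \<notin> U3)"
  shows "reduces_to P2"
proof -
  define f :: "'a \<Rightarrow> nat" where
    "f y = (if y \<in> T then 4 else if y \<in> U1 then 1 else if y \<in> U3 then 3 else if y \<in> U2 then 2 else 0)" for y
  have upup: "z \<in> up X x" if "y \<in> up X x" "z \<in> up X y" for y z using up_trans[OF that x] .
  have f4: "f y = 4 \<longleftrightarrow> y \<in> T" and f1: "f y = 1 \<longleftrightarrow> y \<in> U1 \<and> y \<notin> T"
    and f2: "f y = 2 \<longleftrightarrow> y \<in> U2 \<and> y \<notin> U3" and f3: "f y = 3 \<longleftrightarrow> y \<in> U3 \<and> y \<notin> T"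
    and f0: "f y = 0 \<longleftrightarrow> y \<notin> U1 \<and> y \<notin> U2" if "y \<in> up X x" for y
    by (simp_all add: f_def) (use sub[OF that] sub'[OF that] int[OF that] in blast)+
  have flip: "n = f y \<longleftrightarrow> f y = n" for n y by auto
  have fC: "f y \<in> {0, 1, 2, 3, 4}" for y by (simp add: f_def)
  \<comment> \<open>A point of the root fibre is only known to reach the fibre of 2; from there
    \<open>mid\<close> leads on to the fibre of 3.\<close>
  have mid': "\<exists>z\<in>up X y. z \<in> U3 \<and> z \<notin> T" if y: "y \<in> up X x" "y \<notin> U1" "y \<notin> U3" for y
  proof (cases "y \<in> U2")
    case True then show ?thesis using mid y by blast
  next
    case False
    then obtain z where z: "z \<in> up X y" "z \<in> U2" "z \<notin> U3" using bot y by blast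
    then obtain w where "w \<in> up X z" "w \<in> U3" "w \<notin> T" using mid upup[OF y(1)] by blast
    then show ?thesis using up_trans[OF z(1) _ up_carrier[OF y(1)]] by blast
  qed
  show ?thesis
    unfolding reduces_to_def
  proof (intro bexI[OF _ x] exI[of _ f] conjI ballI impI)
    show "f y \<in> carrier P2" for y using fC[of y] by (simp add: P2_def)
    show "f x \<sqsubseteq>\<^bsub>P2\<^esub> q" for q using f0[OF up_self[OF x]] root by (simp add: P2_def)
  next
    fix y z assume y: "y \<in> up X x" and z: "z \<in> up X y"
    show "f y \<sqsubseteq>\<^bsub>P2\<^esub> f z"
      using R_up[OF R(1) _ z] R_up[OF R(2) _ z] R_up[OF R(3) _ z] R_up[OF R(4) _ z] int[OF upup[OF y z]]
        sub'[OF upup[OF y z]]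
      by (auto simp: P2_def f_def)
  next
    fix y q assume y: "y \<in> up X x" and q: "q \<in> carrier P2" "f y \<sqsubseteq>\<^bsub>P2\<^esub> q"
    then consider "f y = q" | "q = 4" | "f y = 0" "q = 1" | "f y = 0" "q = 2"
      | "f y = 0 \<or> f y = 2" "q = 3"
      by (auto simp: P2_def)
    then show "\<exists>z\<in>up X y. f z = q"
    proof cases
      case 1 then show ?thesis using up_self[OF up_carrier[OF y]] by blast
    next
      case 2 then show ?thesis using top[OF y] f4 upup[OF y] by blast
    next
      case 3 then show ?thesis using bot[OF y] f0[OF y] f1 upup[OF y] by blast
    next
      case 4 then show ?thesis using bot[OF y] f0[OF y] f2 upup[OF y] by blast
    next
      case 5
      then have "y \<notin> U1" "y \<notin> U3" using f0[OF y] f2[OF y] sub'[OF y] int[OF y] sub[OF y] by blast+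
      then show ?thesis using mid'[OF y] f3 upup[OF y] 5 by blast
    qed
  next
    fix q assume "q \<in> carrier P2"
    then consider "q = 0" | "q = 1" | "q = 2" | "q = 3" | "q = 4" by (auto simp: P2_def)
    then show "\<exists>U\<in>R. \<forall>y\<in>up X x. y \<in> U \<longleftrightarrow> q \<sqsubseteq>\<^bsub>P2\<^esub> f y"
    proof cases
      case 1 then show ?thesis using R_top up_carrier by (auto simp: P2_def intro!: bexI[of _ "carrier X"])
    next
      case 2 then show ?thesis using R(1) sub f1 f4 by (auto simp: P2_def flip intro!: bexI[of _ U1])
    next
      case 3 then show ?thesis using R(2) sub sub' f2 f3 f4 by (auto simp: P2_def flip intro!: bexI[of _ U2])
    next
      case 4 then show ?thesis using R(3) sub f3 f4 by (auto simp: P2_def flip intro!: bexI[of _ U3])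
    next
      case 5 then show ?thesis using R(4) f4 by (auto simp: P2_def flip intro!: bexI[of _ T])
    qed
  qed
qed

lemma reduces_to_P3I:
  assumes x: "x \<in> carrier X" and R: "U1 \<in> R" "U2 \<in> R"
    and int: "U1 \<inter> U2 = {}"
    and root: "x \<notin> U1" "x \<notin> U2"
    and bot: "\<And>y. \<lbrakk>y \<in> up X x; y \<notin> U1; y \<notin> U2\<rbrakk> \<Longrightarrow> (\<exists>z\<in>up X y. z \<in> U1) \<and> (\<exists>z\<in>up X y. z \<in> U2)"
  shows "reduces_to P3"
proof -
  define f :: "'a \<Rightarrow> nat" where "f y = (if y \<in> U1 then 1 else if y \<in> U2 then 2 else 0)" for y
  have f1: "f y = 1 \<longleftrightarrow> y \<in> U1" and f2: "f y = 2 \<longleftrightarrow> y \<in> U2" and f0: "f y = 0 \<longleftrightarrow> y \<notin> U1 \<and> y \<notin> U2" for y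
    using int by (auto simp: f_def)
  have flip: "n = f y \<longleftrightarrow> f y = n" for n y by auto
  have fC: "f y \<in> {0, 1, 2}" for y by (simp add: f_def)
  show ?thesis
    unfolding reduces_to_def
  proof (intro bexI[OF _ x] exI[of _ f] conjI ballI impI)
    show "f y \<in> carrier P3" for y using fC[of y] by (simp add: P3_def)
    show "f x \<sqsubseteq>\<^bsub>P3\<^esub> q" for q using f0[of x] root by (simp add: P3_def)
  next
    fix y z assume z: "z \<in> up X y"
    show "f y \<sqsubseteq>\<^bsub>P3\<^esub> f z"
      using R_up[OF R(1) _ z] R_up[OF R(2) _ z] int by (auto simp: P3_def f_def)
  next
    fix y q assume y: "y \<in> up X x" and q: "q \<in> carrier P3" "f y \<sqsubseteq>\<^bsub>P3\<^esub> q"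
    then consider "f y = q" | "f y = 0" "q = 1" | "f y = 0" "q = 2"
      by (auto simp: P3_def)
    then show "\<exists>z\<in>up X y. f z = q"
    proof cases
      case 1 then show ?thesis using up_self[OF up_carrier[OF y]] by blast
    next
      case 2 then show ?thesis using bot[OF y] f0 f1 by blast
    next
      case 3 then show ?thesis using bot[OF y] f0 f2 by blast
    qed
  next
    fix q assume "q \<in> carrier P3"
    then consider "q = 0" | "q = 1" | "q = 2" by (auto simp: P3_def)
    then show "\<exists>U\<in>R. \<forall>y\<in>up X x. y \<in> U \<longleftrightarrow> q \<sqsubseteq>\<^bsub>P3\<^esub> f y"
    proof cases
      case 1 then show ?thesis using R_top up_carrier by (auto simp: P3_def intro!: bexI[of _ "carrier X"])
    next
      case 2 then show ?thesis using R(1) f1 by (intro bexI[of _ U1]) (simp_all add: P3_def flip)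
    next
      case 3 then show ?thesis using R(2) f2 by (intro bexI[of _ U2]) (simp_all add: P3_def flip)
    qed
  qed
qed

lemma reduces_to_P4I:
  assumes x: "x \<in> carrier X" and R: "U1 \<in> R" "U2 \<in> R" "U3 \<in> R" "U4 \<in> R"
    and sub: "\<And>y. \<lbrakk>y \<in> up X x; y \<in> U3 \<or> y \<in> U4\<rbrakk> \<Longrightarrow> y \<in> U1 \<and> y \<in> U2"
    and int: "\<And>y. \<lbrakk>y \<in> up X x; y \<in> U1; y \<in> U2\<rbrakk> \<Longrightarrow> y \<in> U3 \<or> y \<in> U4"
    and root: "x \<notin> U1" "x \<notin> U2"
    and top: "\<And>y. y \<in> up X x \<Longrightarrow> \<exists>z\<in>up X y. z \<in> U3 \<and> z \<in> U4"
    and mid: "\<And>y. \<lbrakk>y \<in> up X x; y \<in> U1 \<or> y \<in> U2; y \<notin> U3; y \<notin> U4\<rbrakk> \<Longrightarrow>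
      (\<exists>z\<in>up X y. z \<in> U3 \<and> z \<notin> U4) \<and> (\<exists>z\<in>up X y. z \<in> U4 \<and> z \<notin> U3)"
    and bot: "\<And>y. \<lbrakk>y \<in> up X x; y \<notin> U1; y \<notin> U2\<rbrakk> \<Longrightarrow>
      (\<exists>z\<in>up X y. z \<in> U1 \<and> z \<notin> U2) \<and> (\<exists>z\<in>up X y. z \<in> U2 \<and> z \<notin> U1)"
  shows "reduces_to P4"
proof -
  define f :: "'a \<Rightarrow> nat" where
    "f y = (if y \<in> U3 \<and> y \<in> U4 then 5 else if y \<in> U4 then 4 else if y \<in> U3 then 3
      else if y \<in> U2 then 2 else if y \<in> U1 then 1 else 0)" for y
  have upup: "z \<in> up X x" if "y \<in> up X x" "z \<in> up X y" for y z using up_trans[OF that x] .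
  have f5: "f y = 5 \<longleftrightarrow> y \<in> U3 \<and> y \<in> U4" and f4: "f y = 4 \<longleftrightarrow> y \<in> U4 \<and> y \<notin> U3"
    and f3: "f y = 3 \<longleftrightarrow> y \<in> U3 \<and> y \<notin> U4" and f2: "f y = 2 \<longleftrightarrow> y \<in> U2 \<and> y \<notin> U1"
    and f1: "f y = 1 \<longleftrightarrow> y \<in> U1 \<and> y \<notin> U2"
    and f0: "f y = 0 \<longleftrightarrow> y \<notin> U1 \<and> y \<notin> U2" if "y \<in> up X x" for y
    by (simp_all add: f_def) (use sub[OF that] int[OF that] in blast)+
  have flip: "n = f y \<longleftrightarrow> f y = n" for n y by auto
  have fC: "f y \<in> {0, 1, 2, 3, 4, 5}" for y by (simp add: f_def)
  \<comment> \<open>As before, a point of the root fibre first reaches the lower layer and from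
    there both points of the upper one.\<close>
  have mid': "(\<exists>z\<in>up X y. z \<in> U3 \<and> z \<notin> U4) \<and> (\<exists>z\<in>up X y. z \<in> U4 \<and> z \<notin> U3)"
    if y: "y \<in> up X x" "y \<notin> U3" "y \<notin> U4" for y
  proof (cases "y \<in> U1 \<or> y \<in> U2")
    case True then show ?thesis using mid y by blast
  next
    case False
    then obtain z where z: "z \<in> up X y" "z \<in> U1" "z \<notin> U2" using bot y by blast
    have "z \<in> up X x" using upup[OF y(1) z(1)] .
    moreover from this have "z \<notin> U3" "z \<notin> U4" using sub z by blast+
    ultimately have "(\<exists>w\<in>up X z. w \<in> U3 \<and> w \<notin> U4) \<and> (\<exists>w\<in>up X z. w \<in> U4 \<and> w \<notin> U3)"
      using mid z by blast
    then show ?thesis using up_trans[OF z(1) _ up_carrier[OF y(1)]] by blast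
  qed
  show ?thesis
    unfolding reduces_to_def
  proof (intro bexI[OF _ x] exI[of _ f] conjI ballI impI)
    show "f y \<in> carrier P4" for y using fC[of y] by (simp add: P4_def)
    show "f x \<sqsubseteq>\<^bsub>P4\<^esub> q" for q using f0[OF up_self[OF x]] root by (simp add: P4_def)
  next
    fix y z assume y: "y \<in> up X x" and z: "z \<in> up X y"
    show "f y \<sqsubseteq>\<^bsub>P4\<^esub> f z"
      using R_up[OF R(1) _ z] R_up[OF R(2) _ z] R_up[OF R(3) _ z] R_up[OF R(4) _ z] int[OF upup[OF y z]]
        sub[OF upup[OF y z]] int[OF y] sub[OF y]
      by (auto simp: P4_def f_def)
  next
    fix y q assume y: "y \<in> up X x" and q: "q \<in> carrier P4" "f y \<sqsubseteq>\<^bsub>P4\<^esub> q"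
    then consider "f y = q" | "q = 5" | "f y = 0" "q = 1" | "f y = 0" "q = 2"
      | "f y \<in> {0, 1, 2}" "q = 3" | "f y \<in> {0, 1, 2}" "q = 4"
      by (auto simp: P4_def)
    then show "\<exists>z\<in>up X y. f z = q"
    proof cases
      case 1 then show ?thesis using up_self[OF up_carrier[OF y]] by blast
    next
      case 2 then show ?thesis using top[OF y] f5 upup[OF y] by blast
    next
      case 3 then show ?thesis using bot[OF y] f0[OF y] f1 upup[OF y] by blast
    next
      case 4 then show ?thesis using bot[OF y] f0[OF y] f2 upup[OF y] by blast
    next
      case 5
      then have "y \<notin> U3" "y \<notin> U4" using f0[OF y] f1[OF y] f2[OF y] sub[OF y] by blast+
      then show ?thesis using mid'[OF y] f3 upup[OF y] 5 by blast
    next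
      case 6
      then have "y \<notin> U3" "y \<notin> U4" using f0[OF y] f1[OF y] f2[OF y] sub[OF y] by blast+
      then show ?thesis using mid'[OF y] f4 upup[OF y] 6 by blast
    qed
  next
    fix q assume "q \<in> carrier P4"
    then consider "q = 0" | "q = 1" | "q = 2" | "q = 3" | "q = 4" | "q = 5" by (auto simp: P4_def)
    then show "\<exists>U\<in>R. \<forall>y\<in>up X x. y \<in> U \<longleftrightarrow> q \<sqsubseteq>\<^bsub>P4\<^esub> f y"
    proof cases
      case 1 then show ?thesis using R_top up_carrier by (auto simp: P4_def intro!: bexI[of _ "carrier X"])
    next
      case 2 then show ?thesis using R(1) sub int by (auto simp: P4_def f_def intro!: bexI[of _ U1])
    next
      case 3 then show ?thesis using R(2) sub int by (auto simp: P4_def f_def intro!: bexI[of _ U2])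
    next
      case 4 then show ?thesis using R(3) by (auto simp: P4_def f_def intro!: bexI[of _ U3])
    next
      case 5 then show ?thesis using R(4) by (auto simp: P4_def f_def intro!: bexI[of _ U4])
    next
      case 6 then show ?thesis using R_Int[OF R(3,4)] by (auto simp: P4_def f_def intro!: bexI[of _ "U3 \<inter> U4"])
    qed
  qed
qed

end

section \<open>Frames without reductions to the forbidden posets\<close>

context descriptive_frame
begin

definition sees :: "'a \<Rightarrow> 'a set \<Rightarrow> bool"
  where "sees y S \<longleftrightarrow> (\<exists>z\<in>up X y. z \<in> S)"

lemma seesI: "\<lbrakk>z \<in> up X y; z \<in> S\<rbrakk> \<Longrightarrow> sees y S"
  by (auto simp: sees_def)

lemma sees_up: "\<lbrakk>sees z S; z \<in> up X y; y \<in> carrier X\<rbrakk> \<Longrightarrow> sees y S"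
  using up_trans unfolding sees_def by blast

text \<open>This is the Heyting implication of upsets. Its complement consists of the points that
  see \<open>U - V\<close>, so conditions on what is seen stay definable by members of
  \<open>R\<close>.\<close>

definition avoiding :: "'a set \<Rightarrow> 'a set \<Rightarrow> 'a set"
  where "avoiding U V = {y \<in> carrier X. up X y \<inter> U \<subseteq> V}"

lemma avoiding_R: "\<lbrakk>U \<in> R; V \<in> R\<rbrakk> \<Longrightarrow> avoiding U V \<in> R"
  unfolding avoiding_def by (rule R_imp)

lemma not_avoiding_iff: "y \<in> carrier X \<Longrightarrow> y \<notin> avoiding U V \<longleftrightarrow> sees y (U - V)"
  by (auto simp: avoiding_def sees_def)

text \<open>Disjoint neighbourhoods alone might leave points seeing only one of them. The
  pseudo-complement \<open>?N\<close> of \<open>U\<close> and its own pseudo-complement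
  \<open>?M\<close> repair this: a point outside both sees \<open>?N\<close> and also
  \<open>U\<close>, which is contained in \<open>?M\<close>.\<close>

lemma common_upper:
  assumes P3: "\<not> reduces_to P3" and x: "x \<in> carrier X" and y: "y \<in> up X x" and z: "z \<in> up X x"
  shows "\<exists>w\<in>carrier X. y \<sqsubseteq> w \<and> z \<sqsubseteq> w"
proof (rule ccontr)
  assume no: "\<not> ?thesis"
  then obtain U V where U: "U \<in> R" "y \<in> U" and V: "V \<in> R" "z \<in> V" and dis: "U \<inter> V = {}"
    using disjoint_clopens[OF up_carrier[OF y] up_carrier[OF z]] by blast
  let ?N = "avoiding U {}"
  let ?M = "avoiding ?N {}"
  have N: "?N \<in> R" "?M \<in> R" using avoiding_R U R_empty by simp_all
  have N_iff: "u \<notin> ?N \<longleftrightarrow> sees u U" if "u \<in> carrier X" for u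
    using not_avoiding_iff[OF that, of U "{}"] by simp
  have M_iff: "u \<notin> ?M \<longleftrightarrow> sees u ?N" if "u \<in> carrier X" for u
    using not_avoiding_iff[OF that, of ?N "{}"] by simp
  have zN: "z \<in> ?N"
  proof (rule ccontr)
    assume "z \<notin> ?N"
    then obtain u where "u \<in> up X z" "u \<in> U" using N_iff[OF up_carrier[OF z]] by (auto simp: sees_def)
    with R_up[OF V] dis show False by blast
  qed
  have UM: "u \<in> ?M" if u: "u \<in> U" for u
  proof (rule ccontr)
    note uC = R_carrier[OF U(1) u]
    assume "u \<notin> ?M"
    then obtain v where v: "v \<in> up X u" "v \<in> ?N" using M_iff[OF uC] by (auto simp: sees_def)
    have "sees v U" using R_up[OF U(1) u v(1)] up_self[OF up_carrier[OF v(1)]] by (rule seesI[rotated])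
    then show False using N_iff[OF up_carrier[OF v(1)]] v by blast
  qed
  have "?M \<inter> ?N = {}"
  proof (rule ccontr)
    assume "?M \<inter> ?N \<noteq> {}"
    then obtain v where v: "v \<in> ?M" "v \<in> ?N" by blast
    then have "v \<in> carrier X" by (simp add: avoiding_def)
    then show False using M_iff seesI[OF up_self v(2)] v(1) by blast
  qed
  then have "reduces_to P3"
  proof (rule reduces_to_P3I[OF x N(2,1)])
    show "x \<notin> ?M" using M_iff[OF x] seesI[OF z zN] by blast
    show "x \<notin> ?N" using N_iff[OF x] seesI[OF y U(2)] by blast
    fix u assume "u \<in> up X x" "u \<notin> ?M" "u \<notin> ?N"
    then have "sees u ?N" "sees u U" using N_iff M_iff up_carrier by blast+
    then show "(\<exists>z\<in>up X u. z \<in> ?M) \<and> (\<exists>z\<in>up X u. z \<in> ?N)"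
      using UM unfolding sees_def by blast
  qed
  with P3 show False by blast
qed

text \<open>
  Think of three colours \<open>1, 2, 3\<close> such that no point sees one colour only through points of mixed
  colour; \<open>N\<^sub>i\<close> is the set of points not seeing colour \<open>i\<close>. Which of the two-coloured types of points
  are seen by all three-coloured ones decides the poset onto which \<open>\<up>x\<close> can be mapped.
\<close>

definition three_coloured :: "'a \<Rightarrow> 'a set \<Rightarrow> 'a set \<Rightarrow> 'a set \<Rightarrow> bool"
  where "three_coloured x N1 N2 N3 \<longleftrightarrow> x \<in> carrier X \<and> N1 \<in> R \<and> N2 \<in> R \<and> N3 \<in> R \<and>
    x \<notin> N1 \<and> x \<notin> N2 \<and> x \<notin> N3 \<and>
    (\<forall>y\<in>up X x. (y \<notin> N1 \<longrightarrow> sees y (N2 \<inter> N3 - N1)) \<and> (y \<notin> N2 \<longrightarrow> sees y (N1 \<inter> N3 - N2)) \<and>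
      (y \<notin> N3 \<longrightarrow> sees y (N1 \<inter> N2 - N3)) \<and> sees y (N1 \<inter> N2 \<inter> N3))"

text \<open>Without two-coloured points, a point above \<open>x\<close> sees all three colours, just
  one, or none; these are the root, the three middle points and the top.\<close>

lemma three_coloured_P1:
  assumes c: "three_coloured x N1 N2 N3"
    and no: "\<not> sees x (N3 - (N1 \<union> N2))" "\<not> sees x (N2 - (N1 \<union> N3))" "\<not> sees x (N1 - (N2 \<union> N3))"
  shows "reduces_to P1"
proof (rule reduces_to_P1I[of x "N2 \<inter> N3" "N1 \<inter> N3" "N1 \<inter> N2" "N1 \<inter> N2 \<inter> N3"])
  show "x \<in> carrier X" "N2 \<inter> N3 \<in> R" "N1 \<inter> N3 \<in> R" "N1 \<inter> N2 \<in> R" "N1 \<inter> N2 \<inter> N3 \<in> R"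
    using c R_Int by (auto simp: three_coloured_def)
  show "x \<notin> N2 \<inter> N3" "x \<notin> N1 \<inter> N3" "x \<notin> N1 \<inter> N2"
    using c by (auto simp: three_coloured_def)
next
  fix y assume y: "y \<in> up X x"
  then show "\<exists>z\<in>up X y. z \<in> N1 \<inter> N2 \<inter> N3"
    using c by (auto simp: three_coloured_def sees_def)
  assume *: "y \<notin> N2 \<inter> N3" "y \<notin> N1 \<inter> N3" "y \<notin> N1 \<inter> N2"
  then have "y \<notin> N1" "y \<notin> N2" "y \<notin> N3"
    using no y unfolding sees_def by blast+
  then have "sees y (N2 \<inter> N3 - N1)" "sees y (N1 \<inter> N3 - N2)" "sees y (N1 \<inter> N2 - N3)"
    using c y unfolding three_coloured_def by blast+
  then show "(\<exists>z\<in>up X y. z \<in> N2 \<inter> N3 \<and> z \<notin> N1 \<inter> N2 \<inter> N3) \<and>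
      (\<exists>z\<in>up X y. z \<in> N1 \<inter> N3 \<and> z \<notin> N1 \<inter> N2 \<inter> N3) \<and>
      (\<exists>z\<in>up X y. z \<in> N1 \<inter> N2 \<and> z \<notin> N1 \<inter> N2 \<inter> N3)"
    unfolding sees_def by blast
qed auto

text \<open>Points seeing exactly the colours 1 and 2 become b, those seeing only 1 or only 2 are
  merged into c, and those seeing only 3 become a.\<close>

lemma three_coloured_P2:
  assumes c: "three_coloured x N1 N2 N3"
    and pair: "\<And>y. \<lbrakk>y \<in> up X x; y \<notin> N1; y \<notin> N2; y \<notin> N3\<rbrakk> \<Longrightarrow> sees y (N3 - (N1 \<union> N2))"
    and no: "\<not> sees x (N2 - (N1 \<union> N3))" "\<not> sees x (N1 - (N2 \<union> N3))"
  shows "reduces_to P2"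
proof (rule reduces_to_P2I[of x "N1 \<inter> N2" N3 "(N1 \<union> N2) \<inter> N3" "N1 \<inter> N2 \<inter> N3"])
  show "x \<in> carrier X" "N1 \<inter> N2 \<in> R" "N3 \<in> R" "(N1 \<union> N2) \<inter> N3 \<in> R" "N1 \<inter> N2 \<inter> N3 \<in> R"
    using c R_Int R_Un by (auto simp: three_coloured_def)
  show "x \<notin> N1 \<inter> N2" "x \<notin> N3"
    using c by (auto simp: three_coloured_def)
next
  fix y assume y: "y \<in> up X x"
  then show "\<exists>z\<in>up X y. z \<in> N1 \<inter> N2 \<inter> N3"
    using c by (auto simp: three_coloured_def sees_def)
  { assume "y \<in> N3" "y \<notin> (N1 \<union> N2) \<inter> N3"
    then have "sees y (N2 \<inter> N3 - N1)" using c y unfolding three_coloured_def by blast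
    then show "\<exists>z\<in>up X y. z \<in> (N1 \<union> N2) \<inter> N3 \<and> z \<notin> N1 \<inter> N2 \<inter> N3"
      unfolding sees_def by blast }
  { assume "y \<notin> N1 \<inter> N2" "y \<notin> N3"
    then have n: "y \<notin> N1" "y \<notin> N2" "y \<notin> N3" using no y unfolding sees_def by blast+
    then have "sees y (N1 \<inter> N2 - N3)" using c y unfolding three_coloured_def by blast
    with pair[OF y n] show "(\<exists>z\<in>up X y. z \<in> N1 \<inter> N2 \<and> z \<notin> N1 \<inter> N2 \<inter> N3) \<and>
        (\<exists>z\<in>up X y. z \<in> N3 \<and> z \<notin> (N1 \<union> N2) \<inter> N3)"
      unfolding sees_def by blast }
qed auto

text \<open>Points with colours 1, 2 and points with colours 1, 3 form the lower layer. In the upper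
  layer, c consists of the points with colour 1 alone and d of all that have lost colour 1 but still
  see a colour; points with colours 2, 3, if any, simply fall into d.\<close>

lemma three_coloured_P4:
  assumes c: "three_coloured x N1 N2 N3"
    and pair: "\<And>y. \<lbrakk>y \<in> up X x; y \<notin> N1; y \<notin> N2; y \<notin> N3\<rbrakk> \<Longrightarrow>
      sees y (N3 - (N1 \<union> N2)) \<and> sees y (N2 - (N1 \<union> N3))"
  shows "reduces_to P4"
proof (rule reduces_to_P4I[of x "N1 \<union> N3" "N1 \<union> N2" "N2 \<inter> N3" N1])
  show "x \<in> carrier X" "N1 \<union> N3 \<in> R" "N1 \<union> N2 \<in> R" "N2 \<inter> N3 \<in> R" "N1 \<in> R"
    using c R_Int R_Un by (auto simp: three_coloured_def)
  show "x \<notin> N1 \<union> N3" "x \<notin> N1 \<union> N2"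
    using c by (auto simp: three_coloured_def)
next
  fix y assume y: "y \<in> up X x"
  then show "\<exists>z\<in>up X y. z \<in> N2 \<inter> N3 \<and> z \<in> N1"
    using c by (auto simp: three_coloured_def sees_def)
  { assume *: "y \<in> N1 \<union> N3 \<or> y \<in> N1 \<union> N2" "y \<notin> N2 \<inter> N3" "y \<notin> N1"
    then have "sees y (N2 \<inter> N3 - N1)" "sees y (N1 \<inter> N3 - N2) \<or> sees y (N1 \<inter> N2 - N3)"
      using c y unfolding three_coloured_def by blast+
    then show "(\<exists>z\<in>up X y. z \<in> N2 \<inter> N3 \<and> z \<notin> N1) \<and> (\<exists>z\<in>up X y. z \<in> N1 \<and> z \<notin> N2 \<inter> N3)"
      unfolding sees_def by blast }
  { assume "y \<notin> N1 \<union> N3" "y \<notin> N1 \<union> N2"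
    then have "sees y (N3 - (N1 \<union> N2)) \<and> sees y (N2 - (N1 \<union> N3))" using pair[OF y] by blast
    then show "(\<exists>z\<in>up X y. z \<in> N1 \<union> N3 \<and> z \<notin> N1 \<union> N2) \<and> (\<exists>z\<in>up X y. z \<in> N1 \<union> N2 \<and> z \<notin> N1 \<union> N3)"
      unfolding sees_def by blast }
qed auto

lemma three_coloured_up:
  assumes "three_coloured x N1 N2 N3" "y \<in> up X x" "y \<notin> N1" "y \<notin> N2" "y \<notin> N3"
  shows "three_coloured y N1 N2 N3"
proof -
  have x: "x \<in> carrier X" using assms(1) by (simp add: three_coloured_def)
  have "z \<in> up X x" if "z \<in> up X y" for z using up_trans[OF assms(2) that x] .
  then show ?thesis using assms up_carrier[OF assms(2)] by (simp add: three_coloured_def)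
qed

text \<open>Seeing \<open>S\<close> can only be lost on the way up. Either every three-coloured
  point above \<open>x\<close> sees \<open>S\<close>, or one moves to a point that does not, above
  which nothing does.\<close>

lemma three_coloured_stable:
  assumes "three_coloured x N1 N2 N3"
  obtains x' where "three_coloured x' N1 N2 N3" "x' \<in> up X x"
    "\<forall>y\<in>up X x'. y \<notin> N1 \<and> y \<notin> N2 \<and> y \<notin> N3 \<longrightarrow> (sees y S \<longleftrightarrow> sees x' S)"
proof (cases "\<exists>y\<in>up X x. y \<notin> N1 \<and> y \<notin> N2 \<and> y \<notin> N3 \<and> \<not> sees y S")
  case True
  then obtain y where y: "y \<in> up X x" "y \<notin> N1" "y \<notin> N2" "y \<notin> N3" "\<not> sees y S" by blast
  show thesis
    by (rule that[OF three_coloured_up[OF assms y(1-4)] y(1)]) (use y sees_up up_carrier in blast)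
next
  case False
  have x: "x \<in> carrier X" "x \<notin> N1" "x \<notin> N2" "x \<notin> N3" using assms by (auto simp: three_coloured_def)
  show thesis
    by (rule that[OF assms up_self[OF x(1)]]) (use False x up_self in blast)
qed

text \<open>Three moves upwards make all three-coloured points agree on each two-coloured type; what
  one move achieves survives the next. Up to permuting colours only the number of types seen
  matters: none gives \<open>P1\<close>, one gives \<open>P2\<close>, at least two give
  \<open>P4\<close>.\<close>

lemma three_coloured_reduces:
  assumes "three_coloured x N1 N2 N3"
  shows "reduces_to P1 \<or> reduces_to P2 \<or> reduces_to P4"
proof -
  let ?p3 = "N3 - (N1 \<union> N2)" and ?p2 = "N2 - (N1 \<union> N3)" and ?p1 = "N1 - (N2 \<union> N3)"
  let ?full = "\<lambda>y. y \<notin> N1 \<and> y \<notin> N2 \<and> y \<notin> N3"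
  obtain a where a: "three_coloured a N1 N2 N3" and "a \<in> up X x"
    and a3: "\<forall>y\<in>up X a. ?full y \<longrightarrow> (sees y ?p3 \<longleftrightarrow> sees a ?p3)"
    by (rule three_coloured_stable[OF assms, of ?p3])
  obtain b where b: "three_coloured b N1 N2 N3" "b \<in> up X a"
    and b2: "\<forall>y\<in>up X b. ?full y \<longrightarrow> (sees y ?p2 \<longleftrightarrow> sees b ?p2)"
    by (rule three_coloured_stable[OF a, of ?p2])
  obtain c where c: "three_coloured c N1 N2 N3" "c \<in> up X b"
    and c1: "\<forall>y\<in>up X c. ?full y \<longrightarrow> (sees y ?p1 \<longleftrightarrow> sees c ?p1)"
    by (rule three_coloured_stable[OF b(1), of ?p1])
  have aC: "a \<in> carrier X" "b \<in> carrier X" using a b by (auto simp: three_coloured_def)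
  have fullc: "c \<notin> N1" "c \<notin> N2" "c \<notin> N3" using c by (auto simp: three_coloured_def)
  have cb: "y \<in> up X b" "y \<in> up X a" if "y \<in> up X c" for y
    using up_trans[OF c(2) that aC(2)] up_trans[OF b(2) _ aC(1)] by blast+
  have ca: "c \<in> up X a" using up_trans[OF b(2) c(2) aC(1)] .
  have c3: "sees y ?p3 \<longleftrightarrow> sees c ?p3" if "y \<in> up X c" "y \<notin> N1" "y \<notin> N2" "y \<notin> N3" for y
    using a3 cb(2)[OF that(1)] that(2-4) ca fullc by blast
  have c2: "sees y ?p2 \<longleftrightarrow> sees c ?p2" if "y \<in> up X c" "y \<notin> N1" "y \<notin> N2" "y \<notin> N3" for y
    using b2 cb(1)[OF that(1)] that(2-4) c(2) fullc by blast
  have perm: "three_coloured c N1 N3 N2" "three_coloured c N2 N3 N1" "three_coloured c N2 N1 N3"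
    "three_coloured c N3 N1 N2"
    using c(1) by (auto simp: three_coloured_def Int_commute Int_left_commute)
  consider "\<not> sees c ?p1" "\<not> sees c ?p2" "\<not> sees c ?p3"
    | "sees c ?p3" "\<not> sees c ?p2" "\<not> sees c ?p1"
    | "sees c ?p2" "\<not> sees c ?p3" "\<not> sees c ?p1"
    | "sees c ?p1" "\<not> sees c ?p2" "\<not> sees c ?p3"
    | "sees c ?p3" "sees c ?p2" | "sees c ?p3" "sees c ?p1" | "sees c ?p2" "sees c ?p1"
    by blast
  then show ?thesis
  proof cases
    case 1 then show ?thesis using three_coloured_P1[OF c(1)] by blast
  next
    case 2 then show ?thesis using three_coloured_P2[OF c(1)] c3 by blast
  next
    case 3 then show ?thesis using three_coloured_P2[OF perm(1)] c2 by (simp add: Un_commute)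
  next
    case 4 then show ?thesis using three_coloured_P2[OF perm(2)] c1 by (simp add: Un_commute)
  next
    case 5 then show ?thesis using three_coloured_P4[OF c(1)] c3 c2 by blast
  next
    case 6 then show ?thesis using three_coloured_P4[OF perm(3)] c3 c1 by (simp add: Un_commute)
  next
    case 7 then show ?thesis using three_coloured_P4[OF perm(4)] c2 c1 by (simp add: Un_commute)
  qed
qed

lemma separation2:
  assumes "y \<in> carrier X" "z \<in> carrier X" "w \<in> carrier X" "\<not> y \<sqsubseteq> z" "\<not> y \<sqsubseteq> w"
  obtains U where "U \<in> R" "y \<in> U" "z \<notin> U" "w \<notin> U"
proof -
  obtain U V where "U \<in> R" "y \<in> U" "z \<notin> U" "V \<in> R" "y \<in> V" "w \<notin> V"
    using separation assms by metis
  then show thesis using that[of "U \<inter> V"] R_Int by blast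
qed

text \<open>Separating neighbourhoods of the three points may overlap. Treating the overlaps
  \<open>T\<close> as the top and the remainders of the neighbourhoods as colours yields a
  three-coloured point.\<close>

lemma no_three_antichain:
  assumes red: "\<not> reduces_to P1" "\<not> reduces_to P2" "\<not> reduces_to P3" "\<not> reduces_to P4"
    and x: "x \<in> carrier X" and up: "y1 \<in> up X x" "y2 \<in> up X x" "y3 \<in> up X x"
    and inc: "incomparable X y1 y2" "incomparable X y1 y3" "incomparable X y2 y3"
  shows False
proof -
  note C = up[THEN up_carrier]
  have n: "\<not> y1 \<sqsubseteq> y2" "\<not> y1 \<sqsubseteq> y3" "\<not> y2 \<sqsubseteq> y1" "\<not> y2 \<sqsubseteq> y3" "\<not> y3 \<sqsubseteq> y1" "\<not> y3 \<sqsubseteq> y2"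
    using inc by (auto simp: incomparable_def)
  obtain U1 where U1: "U1 \<in> R" "y1 \<in> U1" "y2 \<notin> U1" "y3 \<notin> U1"
    by (rule separation2[OF C(1) C(2) C(3) n(1) n(2)])
  obtain U2 where U2: "U2 \<in> R" "y2 \<in> U2" "y1 \<notin> U2" "y3 \<notin> U2"
    by (rule separation2[OF C(2) C(1) C(3) n(3) n(4)])
  obtain U3 where U3: "U3 \<in> R" "y3 \<in> U3" "y1 \<notin> U3" "y2 \<notin> U3"
    by (rule separation2[OF C(3) C(1) C(2) n(5) n(6)])
  define T where "T = U1 \<inter> U2 \<union> U1 \<inter> U3 \<union> U2 \<inter> U3"
  have T: "T \<in> R" unfolding T_def using U1 U2 U3 R_Int R_Un by simp
  have av: "avoiding U1 T \<in> R" "avoiding U2 T \<in> R" "avoiding U3 T \<in> R"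
    using avoiding_R T U1 U2 U3 by simp_all
  \<comment> \<open>A point of \<open>U\<close> outside \<open>T\<close> sees no other colour:
    whatever lies above it is in \<open>U\<close>, hence in \<open>T\<close> as soon as it meets
    another neighbourhood.\<close>
  have colour: "sees y (avoiding V T \<inter> avoiding W T - avoiding U T)"
    if y: "y \<in> up X x" "y \<notin> avoiding U T" and UVW: "U \<in> R" "U \<inter> V \<subseteq> T" "U \<inter> W \<subseteq> T" for y U V W
  proof -
    obtain z where z: "z \<in> up X y" "z \<in> U" "z \<notin> T"
      using y not_avoiding_iff[OF up_carrier[OF y(1)]] by (auto simp: sees_def)
    note zC = up_carrier[OF z(1)]
    have "z \<notin> avoiding U T" using not_avoiding_iff[OF zC] seesI[OF up_self[OF zC]] z by blast
    moreover have "z \<in> avoiding V T" "z \<in> avoiding W T"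
      using R_up[OF UVW(1) z(2)] UVW zC by (auto simp: avoiding_def)
    ultimately show ?thesis using z by (intro seesI) blast+
  qed
  obtain t where t: "t \<in> carrier X" "y1 \<sqsubseteq> t" "y2 \<sqsubseteq> t" using common_upper[OF red(3) x up(1,2)] by blast
  have "t \<in> T" using R_up[OF U1(1,2)] R_up[OF U2(1,2)] t by (simp add: T_def mem_up_iff)
  have tx: "t \<in> up X x" using up_trans[OF up(1) _ x] t by (simp add: mem_up_iff)
  \<comment> \<open>A single point \<open>t\<close> of \<open>T\<close> suffices, because every
    point above \<open>x\<close> has a common upper bound with it.\<close>
  have seesT: "sees y T" if y: "y \<in> up X x" for y
  proof -
    obtain s where s: "s \<in> carrier X" "y \<sqsubseteq> s" "t \<sqsubseteq> s" using common_upper[OF red(3) x y tx] by blast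
    then have "s \<in> T" using R_up[OF T \<open>t \<in> T\<close>] by (simp add: mem_up_iff)
    with s show ?thesis by (auto simp: sees_def mem_up_iff)
  qed
  have Tav: "T \<subseteq> avoiding U T" for U
    using R_up[OF T] R_carrier[OF T] by (auto simp: avoiding_def)
  have root: "x \<notin> avoiding U1 T" "x \<notin> avoiding U2 T" "x \<notin> avoiding U3 T"
    using not_avoiding_iff[OF x] seesI[OF up(1)] seesI[OF up(2)] seesI[OF up(3)] U1 U2 U3
    by (auto simp: T_def)
  have "three_coloured x (avoiding U1 T) (avoiding U2 T) (avoiding U3 T)"
    unfolding three_coloured_def
  proof (intro conjI ballI impI)
    fix y assume y: "y \<in> up X x"
    show "sees y (avoiding U2 T \<inter> avoiding U3 T - avoiding U1 T)" if "y \<notin> avoiding U1 T"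
      by (rule colour[OF y that U1(1)]) (auto simp: T_def)
    show "sees y (avoiding U1 T \<inter> avoiding U3 T - avoiding U2 T)" if "y \<notin> avoiding U2 T"
      by (rule colour[OF y that U2(1)]) (auto simp: T_def)
    show "sees y (avoiding U1 T \<inter> avoiding U2 T - avoiding U3 T)" if "y \<notin> avoiding U3 T"
      by (rule colour[OF y that U3(1)]) (auto simp: T_def)
    show "sees y (avoiding U1 T \<inter> avoiding U2 T \<inter> avoiding U3 T)"
      using seesT[OF y] Tav unfolding sees_def by blast
  qed (use x av root in simp_all)
  from three_coloured_reduces[OF this] red show False by blast
qed

text \<open>
  Suppose \<open>y < w\<close> and \<open>z\<close> is incomparable to both. The points outside \<open>N1\<close> and \<open>N2\<close> are those
  that see both the side of \<open>y\<close> and the side of \<open>z\<close>; those in \<open>N2 - W\<close> are like \<open>y\<close>. If, above some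
  point, every point outside \<open>N1\<close> and \<open>N2\<close> sees \<open>N2 - W\<close>, then \<open>N2 - W\<close> and \<open>W\<close> form the chain of
  \<open>P\<^sub>2\<close>. Otherwise \<open>W\<close> is collapsed to the top, and the points seeing both sides but not \<open>N2 - W\<close> form
  the chain together with those like \<open>z\<close>.
\<close>

lemma three_point:
  assumes red: "\<not> reduces_to P1" "\<not> reduces_to P2" "\<not> reduces_to P3" "\<not> reduces_to P4"
    and x: "x \<in> carrier X" and up: "y \<in> up X x" "z \<in> up X x" "w \<in> up X x"
    and inc: "incomparable X y z" and le: "y \<sqsubseteq> w" and ne: "y \<noteq> w" "z \<noteq> w"
  shows "z \<sqsubseteq> w"
proof (rule ccontr)
  assume nzw: "\<not> z \<sqsubseteq> w"
  note C = up[THEN up_carrier]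
  have nyz: "\<not> y \<sqsubseteq> z" "\<not> z \<sqsubseteq> y" using inc by (auto simp: incomparable_def)
  have nwz: "\<not> w \<sqsubseteq> z" using le_trans[OF le _ C(1,3,2)] nyz by blast
  have nwy: "\<not> w \<sqsubseteq> y" using le le_antisym C ne by blast
  obtain Uz where Uz: "Uz \<in> R" "z \<in> Uz" "w \<notin> Uz" using separation[OF C(2,3) nzw] by blast
  have yUz: "y \<notin> Uz" using R_up[OF Uz(1), of y w] Uz(3) le C by (auto simp: mem_up_iff)
  obtain Uy where Uy: "Uy \<in> R" "y \<in> Uy" "z \<notin> Uy" using separation[OF C(1,2) nyz(1)] by blast
  obtain Uw where Uw: "Uw \<in> R" "w \<in> Uw" "z \<notin> Uw" "y \<notin> Uw"
    by (rule separation2[OF C(3,2,1) nwz nwy])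
  have wUy: "w \<in> Uy" using R_up[OF Uy(1,2)] le C by (simp add: mem_up_iff)
  \<comment> \<open>In \<open>T\<close> the two sides have merged. \<open>N1\<close> consists of the
    points no longer seeing the side of \<open>y\<close>, \<open>N2\<close> of those no longer
    seeing the side of \<open>z\<close>; thus \<open>y\<close> and \<open>w\<close> lie in
    \<open>N2 - N1\<close>, and \<open>z\<close> in \<open>N1 - N2\<close>.\<close>
  define T where "T = Uy \<inter> Uz"
  define N1 where "N1 = avoiding Uy T"
  define N2 where "N2 = avoiding Uz T"
  \<comment> \<open>An upset between \<open>N1 \<inter> N2\<close> and \<open>N2\<close> that
    contains \<open>w\<close> but not \<open>y\<close>: it cuts the side of \<open>y\<close> in
    two.\<close>
  define W where "W = Uw \<inter> N2 \<union> N1 \<inter> N2"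
  have T: "T \<in> R" unfolding T_def using Uy Uz R_Int by simp
  have N: "N1 \<in> R" "N2 \<in> R" unfolding N1_def N2_def using avoiding_R Uy Uz T by simp_all
  have W: "W \<in> R" unfolding W_def using N Uw R_Int R_Un by simp
  have N1_iff: "u \<notin> N1 \<longleftrightarrow> sees u (Uy - T)" and N2_iff: "u \<notin> N2 \<longleftrightarrow> sees u (Uz - T)" if "u \<in> carrier X" for u
    unfolding N1_def N2_def using not_avoiding_iff[OF that] by blast+
  have UyN: "u \<in> N2 - N1" if "u \<in> Uy" "u \<notin> T" for u
  proof -
    have u: "u \<in> carrier X" using R_carrier[OF Uy(1) that(1)] .
    have "u \<notin> N1" using N1_iff[OF u] seesI[OF up_self[OF u]] that by blast
    moreover have "u \<in> N2" unfolding N2_def avoiding_def T_def using u R_up[OF Uy(1) that(1)] by blast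
    ultimately show ?thesis by blast
  qed
  have UzN: "u \<in> N1 - N2" if "u \<in> Uz" "u \<notin> T" for u
  proof -
    have u: "u \<in> carrier X" using R_carrier[OF Uz(1) that(1)] .
    have "u \<notin> N2" using N2_iff[OF u] seesI[OF up_self[OF u]] that by blast
    moreover have "u \<in> N1" unfolding N1_def avoiding_def T_def using u R_up[OF Uz(1) that(1)] by blast
    ultimately show ?thesis by blast
  qed
  have yN: "y \<in> N2 - N1" using UyN Uy(2) yUz by (simp add: T_def)
  have wN: "w \<in> N2 - N1" using UyN wUy Uz(3) by (simp add: T_def)
  have zN: "z \<in> N1 - N2" using UzN Uz(2) Uy(3) by (simp add: T_def)
  have yW: "y \<notin> W" using yN Uw by (auto simp: W_def)
  have seesN1: "sees u (N2 - N1)" if u: "u \<in> carrier X" "u \<notin> N1" for u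
  proof -
    obtain v where "v \<in> up X u" "v \<in> Uy" "v \<notin> T" using N1_iff u by (auto simp: sees_def)
    then show ?thesis using UyN seesI by blast
  qed
  have seesN2: "sees u (N1 - N2)" if u: "u \<in> carrier X" "u \<notin> N2" for u
  proof -
    obtain v where "v \<in> up X u" "v \<in> Uz" "v \<notin> T" using N2_iff u by (auto simp: sees_def)
    then show ?thesis using UzN seesI by blast
  qed
  \<comment> \<open>A point on the side of \<open>y\<close> that does not see the upper piece would
    be incomparable to \<open>w\<close>, and it is incomparable to \<open>z\<close>, so the three
    would be an antichain.\<close>
  have seesW: "sees u (W - N1)" if u: "u \<in> up X x" "u \<in> N2" "u \<notin> N1" for u
  proof (rule ccontr)
    assume no: "\<not> ?thesis"
    note uC = up_carrier[OF u(1)]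
    have "\<not> u \<sqsubseteq> w"
    proof
      assume "u \<sqsubseteq> w"
      moreover have "w \<in> W" using wN Uw by (simp add: W_def)
      ultimately have "sees u (W - N1)" using seesI[of w u "W - N1"] C(3) wN by (simp add: mem_up_iff)
      then show False using no by blast
    qed
    moreover have "\<not> w \<sqsubseteq> u"
    proof
      assume "w \<sqsubseteq> u"
      then have "u \<in> Uw" using R_up[OF Uw(1,2)] uC by (simp add: mem_up_iff)
      then have "sees u (W - N1)" using seesI[OF up_self[OF uC]] u by (simp add: W_def)
      then show False using no by blast
    qed
    moreover have "\<not> u \<sqsubseteq> z"
      using R_up[OF N(2) u(2), of z] zN C(2) by (auto simp: mem_up_iff)
    moreover have "\<not> z \<sqsubseteq> u"
      using R_up[OF N(1), of z u] zN u(3) uC by (auto simp: mem_up_iff)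
    ultimately have "incomparable X u w" "incomparable X u z" "incomparable X w z"
      using nwz nzw by (auto simp: incomparable_def)
    then show False using no_three_antichain[OF red x u(1) up(3,2)] by blast
  qed
  obtain t where t: "t \<in> carrier X" "y \<sqsubseteq> t" "z \<sqsubseteq> t" using common_upper[OF red(3) x up(1,2)] by blast
  have tN: "t \<in> N1 \<inter> N2" using R_up[OF N(1), of z t] R_up[OF N(2), of y t] yN zN t by (simp add: mem_up_iff)
  have tx: "t \<in> up X x" using up_trans[OF up(1) _ x] t by (simp add: mem_up_iff)
  have seesT: "sees u (N1 \<inter> N2)" if u: "u \<in> up X x" for u
  proof -
    obtain s where s: "s \<in> carrier X" "u \<sqsubseteq> s" "t \<sqsubseteq> s" using common_upper[OF red(3) x u tx] by blast
    then have "s \<in> N1 \<inter> N2" using R_up[OF N(1), of t s] R_up[OF N(2), of t s] tN by (simp add: mem_up_iff)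
    with s show ?thesis by (auto simp: sees_def mem_up_iff)
  qed
  have subW: "N1 \<inter> N2 \<subseteq> W" "W \<subseteq> N2" by (auto simp: W_def)
  have xN: "x \<notin> N1" "x \<notin> N2" "sees x (N2 - W)"
    using R_up[OF N(1), of x y] R_up[OF N(2), of x z] up yN zN seesI[OF up(1), of "N2 - W"] yW by auto
  have upup: "v \<in> up X x" if "u \<in> up X x" "v \<in> up X u" for u v using up_trans[OF that x] .
  show False
  proof (cases "\<exists>x'\<in>up X x. x' \<notin> N1 \<and> x' \<notin> N2 \<and>
      (\<forall>u\<in>up X x'. u \<notin> N1 \<and> u \<notin> N2 \<longrightarrow> sees u (N2 - W))")
    case True
    then obtain x' where x': "x' \<in> up X x" "x' \<notin> N1" "x' \<notin> N2"
      and all: "\<forall>u\<in>up X x'. u \<notin> N1 \<and> u \<notin> N2 \<longrightarrow> sees u (N2 - W)" by blast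
    have "reduces_to P2"
    proof (rule reduces_to_P2I[of x' N1 N2 W "N1 \<inter> N2"])
      show "x' \<in> carrier X" using up_carrier[OF x'(1)] .
      show "N1 \<in> R" "N2 \<in> R" "W \<in> R" "N1 \<inter> N2 \<in> R" using N W R_Int by simp_all
      show "x' \<notin> N1" "x' \<notin> N2" using x' by simp_all
    next
      fix u assume u: "u \<in> up X x'"
      note ux = upup[OF x'(1) u]
      show "\<exists>v\<in>up X u. v \<in> N1 \<inter> N2" using seesT[OF ux] by (simp add: sees_def)
      show "\<exists>v\<in>up X u. v \<in> W \<and> v \<notin> N1 \<inter> N2" if "u \<in> N2" "u \<notin> W"
        using seesW[OF ux that(1)] that subW unfolding sees_def by blast
      show "(\<exists>v\<in>up X u. v \<in> N1 \<and> v \<notin> N1 \<inter> N2) \<and> (\<exists>v\<in>up X u. v \<in> N2 \<and> v \<notin> W)"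
        if "u \<notin> N1" "u \<notin> N2"
        using seesN2[OF up_carrier[OF u] that(2)] all u that unfolding sees_def by blast
    qed (use subW in blast)+
    with red show False by blast
  next
    case False
    \<comment> \<open>With \<open>W\<close> as top, a is \<open>N2 - W\<close>, c is
      \<open>N1 - W\<close>, and b consists of the points outside \<open>N1\<close> and
      \<open>N2\<close> that do not see \<open>N2 - W\<close>. Failure of the case assumption
      provides such a point above every point of the root fibre.\<close>
    let ?A = "avoiding N2 W"
    have A: "?A \<in> R" using avoiding_R N W by simp
    have A_iff: "u \<notin> ?A \<longleftrightarrow> sees u (N2 - W)" if "u \<in> carrier X" for u
      using not_avoiding_iff[OF that] .
    have N1A: "N1 \<union> W \<subseteq> ?A"
      using R_up[OF N(1)] R_up[OF W] R_carrier[OF N(1)] R_carrier[OF W] subW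
      unfolding avoiding_def by blast
    have "reduces_to P2"
    proof (rule reduces_to_P2I[of x N2 ?A "N1 \<union> W" W])
      show "x \<in> carrier X" by (rule x)
      show "N2 \<in> R" "?A \<in> R" "N1 \<union> W \<in> R" "W \<in> R" using N W A R_Un by simp_all
      show "x \<notin> N2" "x \<notin> ?A" using xN A_iff[OF x] by simp_all
    next
      fix u assume u: "u \<in> up X x"
      note uC = up_carrier[OF u]
      show "\<exists>v\<in>up X u. v \<in> W" using seesT[OF u] subW unfolding sees_def by blast
      show "u \<in> W" if "u \<in> N2" "u \<in> ?A" using that up_self[OF uC] by (auto simp: avoiding_def)
      show "\<exists>v\<in>up X u. v \<in> N1 \<union> W \<and> v \<notin> W" if "u \<in> ?A" "u \<notin> N1 \<union> W"
      proof -
        have "u \<notin> N2" using that up_self[OF uC] by (auto simp: avoiding_def)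
        then show ?thesis using seesN2[OF uC] subW unfolding sees_def by blast
      qed
      show "(\<exists>v\<in>up X u. v \<in> N2 \<and> v \<notin> W) \<and> (\<exists>v\<in>up X u. v \<in> ?A \<and> v \<notin> N1 \<union> W)"
        if un: "u \<notin> N2" "u \<notin> ?A"
      proof
        show "\<exists>v\<in>up X u. v \<in> N2 \<and> v \<notin> W" using A_iff[OF uC] un unfolding sees_def by blast
        have "u \<notin> N1" using N1A un by blast
        then obtain v where v: "v \<in> up X u" "v \<notin> N1" "v \<notin> N2" "\<not> sees v (N2 - W)"
          using False u un by blast
        then have "v \<in> ?A" "v \<notin> W" using A_iff[OF up_carrier[OF v(1)]] subW by blast+
        with v show "\<exists>v\<in>up X u. v \<in> ?A \<and> v \<notin> N1 \<union> W" by blast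
      qed
    qed (use subW N1A in blast)+
    with red show False by blast
  qed
qed

text \<open>
  If nothing lies between the layers \<open>{x, y}\<close> and \<open>{z, v}\<close>, every other point is above both or below
  both, so any separating clopen upsets already have the shape required by \<open>P\<^sub>4\<close>.
\<close>

lemma interpolation:
  assumes red: "\<not> reduces_to P1" "\<not> reduces_to P2" "\<not> reduces_to P3" "\<not> reduces_to P4"
    and r: "r \<in> carrier X" and xr: "x \<in> up X r" and yr: "y \<in> up X r"
    and z: "z \<in> up X x" "z \<in> up X y" and v: "v \<in> up X x" "v \<in> up X y"
  shows "\<exists>w\<in>carrier X. x \<sqsubseteq> w \<and> y \<sqsubseteq> w \<and> w \<sqsubseteq> z \<and> w \<sqsubseteq> v"
proof (rule ccontr)
  assume no: "\<not> ?thesis"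
  note C = up_carrier[OF xr] up_carrier[OF yr] up_carrier[OF z(1)] up_carrier[OF v(1)]
  have le: "x \<sqsubseteq> z" "y \<sqsubseteq> z" "x \<sqsubseteq> v" "y \<sqsubseteq> v" using z v by (simp_all add: mem_up_iff)
  have nxy: "\<not> x \<sqsubseteq> y" "\<not> y \<sqsubseteq> x" "\<not> z \<sqsubseteq> v" "\<not> v \<sqsubseteq> z" using no le C le_refl by blast+
  then have ixy: "incomparable X x y" and izv: "incomparable X z v" by (simp_all add: incomparable_def)
  have zr: "z \<in> up X r" and vr: "v \<in> up X r" using up_trans[OF xr _ r] z v by simp_all
  \<comment> \<open>By the three point rule and the bound on antichains, a point outside a
    two-element layer lies above both its points or below both.\<close>
  have tri: "u = a \<or> u = b \<or> (a \<sqsubseteq> u \<and> b \<sqsubseteq> u) \<or> (u \<sqsubseteq> a \<and> u \<sqsubseteq> b)"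
    if u: "u \<in> up X r" and ab: "a \<in> up X r" "b \<in> up X r" "incomparable X a b" for u a b
  proof (rule ccontr)
    assume n: "\<not> ?thesis"
    have ba: "incomparable X b a" using incomparable_sym[OF ab(3)] .
    have up_a: "a \<sqsubseteq> u \<longleftrightarrow> b \<sqsubseteq> u"
      using three_point[OF red r ab(1,2) u ab(3)] three_point[OF red r ab(2,1) u ba] n by blast
    have "u \<sqsubseteq> b" if "u \<sqsubseteq> a"
    proof (rule ccontr)
      assume nub: "\<not> u \<sqsubseteq> b"
      have "\<not> b \<sqsubseteq> u" using n nub that up_a by blast
      with nub have "incomparable X u b" by (simp add: incomparable_def)
      then have "b \<sqsubseteq> a" using three_point[OF red r u ab(2,1)] that n ab(3) by (auto simp: incomparable_def)
      with ab(3) show False by (simp add: incomparable_def)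
    qed
    moreover have "u \<sqsubseteq> a" if "u \<sqsubseteq> b"
    proof (rule ccontr)
      assume nub: "\<not> u \<sqsubseteq> a"
      have "\<not> a \<sqsubseteq> u" using n nub that up_a by blast
      with nub have "incomparable X u a" by (simp add: incomparable_def)
      then have "a \<sqsubseteq> b" using three_point[OF red r u ab(1,2)] that n ab(3) by (auto simp: incomparable_def)
      with ab(3) show False by (simp add: incomparable_def)
    qed
    ultimately have "incomparable X u a" "incomparable X u b" using n up_a by (auto simp: incomparable_def)
    then show False using no_three_antichain[OF red r u ab(1,2)] ab(3) by blast
  qed
  obtain Uz where Uz: "Uz \<in> R" "z \<in> Uz" "v \<notin> Uz" using separation[OF C(3,4) nxy(3)] by blast
  obtain Uv where Uv: "Uv \<in> R" "v \<in> Uv" "z \<notin> Uv" using separation[OF C(4,3) nxy(4)] by blast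
  obtain Ux where Ux: "Ux \<in> R" "x \<in> Ux" "y \<notin> Ux" using separation[OF C(1,2) nxy(1)] by blast
  obtain Uy where Uy: "Uy \<in> R" "y \<in> Uy" "x \<notin> Uy" using separation[OF C(2,1) nxy(2)] by blast
  obtain t where t: "t \<in> carrier X" "z \<sqsubseteq> t" "v \<sqsubseteq> t" using common_upper[OF red(3) r zr vr] by blast
  have tr: "t \<in> up X r" using up_trans[OF zr _ r] t by (simp add: mem_up_iff)
  have mem: "u \<in> U" if "U \<in> R" "a \<in> U" "a \<sqsubseteq> u" "u \<in> carrier X" for u U a
    using R_up[OF that(1,2)] that by (simp add: mem_up_iff)
  have mem': "u \<notin> U" if "U \<in> R" "a \<notin> U" "u \<sqsubseteq> a" "a \<in> carrier X" for u U a
    using mem[OF that(1) _ that(3,4)] that(2) by blast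
  have xz: "\<not> z \<sqsubseteq> x" "\<not> z \<sqsubseteq> y" "\<not> v \<sqsubseteq> x" "\<not> v \<sqsubseteq> y"
    using le_trans[OF _ le(3)] le_trans[OF _ le(4)] le_trans[OF _ le(1)] le_trans[OF _ le(2)] nxy C by blast+
  \<comment> \<open>Apply \<open>tri\<close> to both layers; the remaining combination, above the
    lower layer and below the upper one, is excluded by \<open>no\<close>.\<close>
  have pos: "(z \<sqsubseteq> u \<and> v \<sqsubseteq> u) \<or> u = z \<or> u = v \<or> u = x \<or> u = y \<or> (u \<sqsubseteq> x \<and> u \<sqsubseteq> y)"
    if u: "u \<in> up X r" for u
    using tri[OF u xr yr ixy] tri[OF u zr vr izv] no up_carrier[OF u] by blast
  \<comment> \<open>A point of \<open>Uz\<close> in any other position would be below or equal to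
    \<open>v\<close> and would force \<open>v\<close> into \<open>Uz\<close>.\<close>
  have z_iff: "u \<in> Uz \<longleftrightarrow> (z \<sqsubseteq> u \<and> v \<sqsubseteq> u) \<or> u = z" if u: "u \<in> up X r" for u
    using pos[OF u] mem[OF Uz(1,2) _ up_carrier[OF u]] mem'[OF Uz(1,3) _ C(4)] le le_trans[OF _ le(3) up_carrier[OF u] C(1,4)] Uz
    by blast
  have v_iff: "u \<in> Uv \<longleftrightarrow> (z \<sqsubseteq> u \<and> v \<sqsubseteq> u) \<or> u = v" if u: "u \<in> up X r" for u
    using pos[OF u] mem[OF Uv(1,2) _ up_carrier[OF u]] mem'[OF Uv(1,3) _ C(3)] le le_trans[OF _ le(1) up_carrier[OF u] C(1,3)] Uv
    by blast
  have abv: "x \<sqsubseteq> u \<and> y \<sqsubseteq> u" if u: "u \<in> carrier X" "z \<sqsubseteq> u \<and> v \<sqsubseteq> u \<or> u = z \<or> u = v" for u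
    using le_trans[OF le(1) _ C(1,3) u(1)] le_trans[OF le(2) _ C(2,3) u(1)] le u by blast
  have x_iff: "u \<in> Ux \<longleftrightarrow> (z \<sqsubseteq> u \<and> v \<sqsubseteq> u) \<or> u = z \<or> u = v \<or> u = x" if u: "u \<in> up X r" for u
    using pos[OF u] mem[OF Ux(1,2) _ up_carrier[OF u]] mem'[OF Ux(1,3) _ C(2)] abv[OF up_carrier[OF u]] Ux
    by blast
  have y_iff: "u \<in> Uy \<longleftrightarrow> (z \<sqsubseteq> u \<and> v \<sqsubseteq> u) \<or> u = z \<or> u = v \<or> u = y" if u: "u \<in> up X r" for u
    using pos[OF u] mem[OF Uy(1,2) _ up_carrier[OF u]] mem'[OF Uy(1,3) _ C(1)] abv[OF up_carrier[OF u]] Uy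
    by blast
  have upup: "s \<in> up X r" if "u \<in> up X r" "s \<in> up X u" for u s using up_trans[OF that r] .
  have rC: "r \<in> up X r" using up_self[OF r] .
  have "reduces_to P4"
  proof (rule reduces_to_P4I[of r Ux Uy Uz Uv])
    show "r \<in> carrier X" "Ux \<in> R" "Uy \<in> R" "Uz \<in> R" "Uv \<in> R" using r Ux Uy Uz Uv by simp_all
    have "r \<sqsubseteq> x" "r \<sqsubseteq> y" using xr yr by (simp_all add: mem_up_iff)
    then show "r \<notin> Ux" "r \<notin> Uy" using mem'[OF Ux(1,3) _ C(2)] mem'[OF Uy(1,3) _ C(1)] by blast+
  next
    fix u assume u: "u \<in> up X r"
    note uC = up_carrier[OF u]
    show "u \<in> Ux \<and> u \<in> Uy" if "u \<in> Uz \<or> u \<in> Uv"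
      using that z_iff[OF u] v_iff[OF u] x_iff[OF u] y_iff[OF u] by blast
    show "u \<in> Uz \<or> u \<in> Uv" if "u \<in> Ux" "u \<in> Uy"
      using that z_iff[OF u] v_iff[OF u] x_iff[OF u] y_iff[OF u] Ux Uy by blast
    obtain s where s: "s \<in> carrier X" "u \<sqsubseteq> s" "t \<sqsubseteq> s" using common_upper[OF red(3) r u tr] by blast
    have "t \<in> Uz" "t \<in> Uv" using mem[OF Uz(1,2)] mem[OF Uv(1,2)] t by simp_all
    then have "s \<in> Uz" "s \<in> Uv" using mem[OF Uz(1) _ s(3,1)] mem[OF Uv(1) _ s(3,1)] by blast+
    with s show "\<exists>s\<in>up X u. s \<in> Uz \<and> s \<in> Uv" by (auto simp: mem_up_iff)
    show "(\<exists>s\<in>up X u. s \<in> Uz \<and> s \<notin> Uv) \<and> (\<exists>s\<in>up X u. s \<in> Uv \<and> s \<notin> Uz)"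
      if "u \<in> Ux \<or> u \<in> Uy" "u \<notin> Uz" "u \<notin> Uv"
    proof -
      have "u = x \<or> u = y"
        using that z_iff[OF u] v_iff[OF u] x_iff[OF u] y_iff[OF u] by blast
      then show ?thesis using z v Uz Uv by blast
    qed
    show "(\<exists>s\<in>up X u. s \<in> Ux \<and> s \<notin> Uy) \<and> (\<exists>s\<in>up X u. s \<in> Uy \<and> s \<notin> Ux)"
      if "u \<notin> Ux" "u \<notin> Uy"
    proof -
      have "u \<sqsubseteq> x" "u \<sqsubseteq> y" using pos[OF u] that x_iff[OF u] y_iff[OF u] by blast+
      then show ?thesis using Ux Uy C by (auto simp: mem_up_iff)
    qed
  qed
  with red show False by blast
qed

lemma diamond_system_if_irreducible:
  assumes "\<not> reduces_to P1" "\<not> reduces_to P2" "\<not> reduces_to P3" "\<not> reduces_to P4"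
  shows "diamond_system X"
proof (rule diamond_systemI[OF partial_order_axioms])
  show "z \<sqsubseteq> w" if "x \<in> carrier X" "y \<in> up X x" "z \<in> up X x" "w \<in> up X x"
    "incomparable X y z" "y \<sqsubseteq> w" "y \<noteq> w" "z \<noteq> w" for x y z w
    by (rule three_point[OF assms that])
  show False if "x \<in> carrier X" "y \<in> up X x" "z \<in> up X x" "w \<in> up X x"
    "incomparable X y z" "incomparable X y w" "incomparable X z w" for x y z w
    by (rule no_three_antichain[OF assms that])
  show "\<exists>w\<in>carrier X. y \<sqsubseteq> w \<and> z \<sqsubseteq> w" if "x \<in> carrier X" "y \<in> up X x" "z \<in> up X x" for x y z
    by (rule common_upper[OF assms(3) that])
  show "\<exists>w\<in>carrier X. x \<sqsubseteq> w \<and> y \<sqsubseteq> w \<and> w \<sqsubseteq> z \<and> w \<sqsubseteq> v"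
    if "b \<in> carrier X" "x \<in> up X b" "y \<in> up X b" "z \<in> up X x" "z \<in> up X y"
      "v \<in> up X x" "v \<in> up X y" "t \<in> up X z" "t \<in> up X v" for b x y z v t
    by (rule interpolation[OF assms that(1-7)])
qed

end

section \<open>Embedding the algebra of a forbidden poset\<close>

context heyting_gorder
begin

lemma descriptive_frame_prime_spectrum:
  "descriptive_frame (prime_spectrum L) (prime_extent L ` carrier L)"
proof -
  interpret poset "prime_spectrum L" by (rule poset.intro[OF partial_order_prime_spectrum])
  show ?thesis
  proof
    fix U y assume "U \<in> prime_extent L ` carrier L" "y \<in> U"
    then show "y \<in> carrier (prime_spectrum L)" by (auto simp: prime_extent_def)
  next
    fix U y z assume "U \<in> prime_extent L ` carrier L" "y \<in> U" "z \<in> up (prime_spectrum L) y"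
    then show "z \<in> U" by (auto simp: prime_extent_def up_prime_spectrum)
  next
    have "prime_extent L \<bottom> = {}" using bottom_prime by (auto simp: prime_extent_def)
    then show "{} \<in> prime_extent L ` carrier L" using bottom_closed by blast
  next
    fix U V assume "U \<in> prime_extent L ` carrier L" "V \<in> prime_extent L ` carrier L"
    then obtain a b where ab: "a \<in> carrier L" "b \<in> carrier L" and UV: "U = prime_extent L a" "V = prime_extent L b"
      by blast
    have eqs: "prime_extent L (a \<squnion> b) = U \<union> V" "prime_extent L (a \<sqinter> b) = U \<inter> V"
      "prime_extent L (a \<rightarrow> b) = {y \<in> carrier (prime_spectrum L). up (prime_spectrum L) y \<inter> U \<subseteq> V}"
      using ab by (auto simp: UV prime_extent_def join_prime meet_prime imp_prime up_prime_spectrum)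
    show "U \<union> V \<in> prime_extent L ` carrier L" unfolding eqs(1)[symmetric] using ab by simp
    show "U \<inter> V \<in> prime_extent L ` carrier L" unfolding eqs(2)[symmetric] using ab by simp
    show "{y \<in> carrier (prime_spectrum L). up (prime_spectrum L) y \<inter> U \<subseteq> V} \<in> prime_extent L ` carrier L"
      unfolding eqs(3)[symmetric] using ab by simp
  next
    fix y z assume "y \<in> carrier (prime_spectrum L)" "z \<in> carrier (prime_spectrum L)"
      "\<not> y \<sqsubseteq>\<^bsub>prime_spectrum L\<^esub> z"
    then obtain a where "prime_filter L y" "a \<in> y" "a \<notin> z" by auto
    then show "\<exists>U\<in>prime_extent L ` carrier L. y \<in> U \<and> z \<notin> U"
      using closed_prime[of y a] by (auto simp: prime_extent_def)
  next
    fix y z assume p: "y \<in> carrier (prime_spectrum L)" "z \<in> carrier (prime_spectrum L)"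
      and no: "\<And>w. \<lbrakk>w \<in> carrier (prime_spectrum L); y \<sqsubseteq>\<^bsub>prime_spectrum L\<^esub> w; z \<sqsubseteq>\<^bsub>prime_spectrum L\<^esub> w\<rbrakk> \<Longrightarrow> False"
    then have p: "prime_filter L y" "prime_filter L z" by simp_all
    have no': False if "prime_filter L H" "y \<subseteq> H" "z \<subseteq> H" for H
      by (rule no[of H]) (use that in simp_all)
    obtain f g where fg: "f \<in> y" "g \<in> z" "\<forall>H. prime_filter L H \<longrightarrow> f \<in> H \<longrightarrow> g \<notin> H"
      by (rule prime_filters_common_upper[OF p no'])
    then have "y \<in> prime_extent L f" "z \<in> prime_extent L g" "prime_extent L f \<inter> prime_extent L g = {}"
      using p by (auto simp: prime_extent_def)
    moreover have "f \<in> carrier L" "g \<in> carrier L" using closed_prime p fg by blast+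
    ultimately show "\<exists>U\<in>prime_extent L ` carrier L. \<exists>V\<in>prime_extent L ` carrier L. y \<in> U \<and> z \<in> V \<and> U \<inter> V = {}"
      by blast
  qed
qed

text \<open>Duality: inverse images under the p-morphism \<open>f\<close> embed \<open>Up P\<close>
  into the upsets of the prime filters above \<open>x\<close>. By \<open>rep\<close> these inverse
  images are traces \<open>E a\<close> of elements, and the traces form a homomorphic image of
  \<open>L\<close>.\<close>

lemma subalgebra_of_hom_image_if_reduces:
  fixes f :: "'a set \<Rightarrow> 'b" and P :: "'b gorder"
  assumes P: "partial_order P" "finite (carrier P)" and x: "prime_filter L x"
    and fC: "\<And>y. \<lbrakk>prime_filter L y; x \<subseteq> y\<rbrakk> \<Longrightarrow> f y \<in> carrier P"
    and mono: "\<And>y z. \<lbrakk>prime_filter L y; x \<subseteq> y; prime_filter L z; y \<subseteq> z\<rbrakk> \<Longrightarrow> f y \<sqsubseteq>\<^bsub>P\<^esub> f z"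
    and lift: "\<And>y q. \<lbrakk>prime_filter L y; x \<subseteq> y; q \<in> carrier P; f y \<sqsubseteq>\<^bsub>P\<^esub> q\<rbrakk> \<Longrightarrow>
      \<exists>z. prime_filter L z \<and> y \<subseteq> z \<and> f z = q"
    and root: "\<And>q. q \<in> carrier P \<Longrightarrow> f x \<sqsubseteq>\<^bsub>P\<^esub> q"
    and rep: "\<And>q. q \<in> carrier P \<Longrightarrow>
      \<exists>a\<in>carrier L. \<forall>y. prime_filter L y \<and> x \<subseteq> y \<longrightarrow> (a \<in> y \<longleftrightarrow> q \<sqsubseteq>\<^bsub>P\<^esub> f y)"
  shows "subalgebra_of_hom_image (Up P) L"
proof -
  interpret P: partial_order P by (rule P)
  define E where "E a = {y. prime_filter L y \<and> x \<subseteq> y \<and> a \<in> y}" for a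
  have E_meet: "E (a \<sqinter> b) = E a \<inter> E b" and E_join: "E (a \<squnion> b) = E a \<union> E b"
    and E_imp: "E (a \<rightarrow> b) = {y. prime_filter L y \<and> x \<subseteq> y \<and>
      (\<forall>z. prime_filter L z \<longrightarrow> y \<subseteq> z \<longrightarrow> a \<in> z \<longrightarrow> b \<in> z)}"
    if "a \<in> carrier L" "b \<in> carrier L" for a b
    using that by (auto simp: E_def meet_prime join_prime imp_prime)
  have E_bot: "E \<bottom> = {}" and E_top: "E \<top> = {y. prime_filter L y \<and> x \<subseteq> y}"
    using bottom_prime top_prime by (auto simp: E_def)
  \<comment> \<open>The choice depends on \<open>a\<close> only through \<open>E a\<close>, so
    elements with equal traces get the same representative.\<close>
  define h where "h a = (SOME b. b \<in> carrier L \<and> E b = E a)" for a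
  have h: "h a \<in> carrier L" "E (h a) = E a" if "a \<in> carrier L" for a
    using someI_ex[of "\<lambda>b. b \<in> carrier L \<and> E b = E a"] that unfolding h_def by blast+
  have h_cong: "h a = h b" if "E a = E b" for a b
    using that by (simp add: h_def)
  \<comment> \<open>the quotient by the filter \<open>x\<close>, realised on a set of representatives\<close>
  define D :: "'a gorder" where
    "D = \<lparr>carrier = h ` carrier L, eq = (=), le = (\<lambda>a b. E a \<subseteq> E b)\<rparr>"
  have D_carrier: "a \<in> carrier L \<and> h a = a" if a: "a \<in> carrier D" for a
  proof -
    obtain b where b: "b \<in> carrier L" "a = h b" using a by (auto simp: D_def)
    then show ?thesis using h[OF b(1)] h_cong[of "h b" b] by simp
  qed
  have hD: "h a \<in> carrier D" if "a \<in> carrier L" for a using that by (simp add: D_def)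
  have D_le: "a \<sqsubseteq>\<^bsub>D\<^esub> b \<longleftrightarrow> E a \<subseteq> E b" for a b by (simp add: D_def)
  have D_eqI: "a = b" if "a \<in> carrier D" "b \<in> carrier D" "E a = E b" for a b
    using D_carrier[OF that(1)] D_carrier[OF that(2)] h_cong[OF that(3)] by metis
  have poD: "partial_order D"
  proof (rule partial_orderI)
    show "a = b" if "a \<sqsubseteq>\<^bsub>D\<^esub> b" "b \<sqsubseteq>\<^bsub>D\<^esub> a" "a \<in> carrier D" "b \<in> carrier D" for a b
      using D_eqI that by (simp add: D_le)
  qed (auto simp: D_def)
  have D_imp: "E c \<subseteq> E (a \<rightarrow> b) \<longleftrightarrow> E a \<inter> E c \<subseteq> E b"
    if "a \<in> carrier L" "b \<in> carrier L" "c \<in> carrier L" for a b c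
  proof
    assume "E c \<subseteq> E (a \<rightarrow> b)"
    then show "E a \<inter> E c \<subseteq> E b" unfolding E_imp[OF that(1,2)] by (auto simp: E_def)
  next
    assume *: "E a \<inter> E c \<subseteq> E b"
    show "E c \<subseteq> E (a \<rightarrow> b)"
      unfolding E_imp[OF that(1,2)]
    proof (intro subsetI CollectI conjI allI impI)
      fix y z assume y: "y \<in> E c" and z: "prime_filter L z" "y \<subseteq> z" "a \<in> z"
      then have "z \<in> E a \<inter> E c" by (auto simp: E_def)
      then show "b \<in> z" using * by (auto simp: E_def)
    qed (auto simp: E_def)
  qed
  note ops = heyting_algebra_from_operations[OF poD, of "\<lambda>a b. h (a \<sqinter> b)" "\<lambda>a b. h (a \<squnion> b)"
      "\<lambda>a b. h (a \<rightarrow> b)" "h \<bottom>" "h \<top>"]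
  note D_ops = ops[unfolded D_le]
  have c: "h (a \<sqinter> b) \<in> carrier D \<and> h (a \<squnion> b) \<in> carrier D \<and> h (a \<rightarrow> b) \<in> carrier D"
    if "a \<in> carrier D" "b \<in> carrier D" for a b
    using that D_carrier hD by simp
  have bt: "h \<bottom> \<in> carrier D" "h \<top> \<in> carrier D" using hD by simp_all
  have bt': "E (h \<bottom>) \<subseteq> E a" "E a \<subseteq> E (h \<top>)" for a
    using h(2)[OF bottom_closed] h(2)[OF top_closed] E_bot E_top by (auto simp: E_def)
  have m: "E z \<subseteq> E (h (a \<sqinter> b)) \<longleftrightarrow> E z \<subseteq> E a \<and> E z \<subseteq> E b"
    and j: "E (h (a \<squnion> b)) \<subseteq> E z \<longleftrightarrow> E a \<subseteq> E z \<and> E b \<subseteq> E z"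
    and i: "E z \<subseteq> E (h (a \<rightarrow> b)) \<longleftrightarrow> E (h (a \<sqinter> z)) \<subseteq> E b"
    if "a \<in> carrier D" "b \<in> carrier D" "z \<in> carrier D" for a b z
    using that D_carrier D_imp[of a b z] by (simp_all add: h E_meet E_join)
  note D_ops' = D_ops[OF c bt bt' m j i]
  have DH: "heyting_algebra D" by (rule D_ops'(1))
  have Dbot: "\<bottom>\<^bsub>D\<^esub> = h \<bottom>" by (rule D_ops'(2))
  have Dtop: "\<top>\<^bsub>D\<^esub> = h \<top>" by (rule D_ops'(3))
  have Dmeet: "a \<sqinter>\<^bsub>D\<^esub> b = h (a \<sqinter> b)" if "a \<in> carrier D" "b \<in> carrier D" for a b
    using D_ops'(4) that by blast
  have Djoin: "a \<squnion>\<^bsub>D\<^esub> b = h (a \<squnion> b)" if "a \<in> carrier D" "b \<in> carrier D" for a b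
    using D_ops'(5) that by blast
  have Dimp: "a \<rightarrow>\<^bsub>D\<^esub> b = h (a \<rightarrow> b)" if "a \<in> carrier D" "b \<in> carrier D" for a b
    using D_ops'(6) that by blast
  have hom: "heyting_hom L D h"
    unfolding heyting_hom_def
  proof (intro conjI ballI)
    show "h \<in> carrier L \<rightarrow> carrier D" using hD by simp
    show "h \<bottom> = \<bottom>\<^bsub>D\<^esub>" "h \<top> = \<top>\<^bsub>D\<^esub>" using Dbot Dtop by simp_all
    fix a b assume ab: "a \<in> carrier L" "b \<in> carrier L"
    show "h (a \<sqinter> b) = h a \<sqinter>\<^bsub>D\<^esub> h b" "h (a \<squnion> b) = h a \<squnion>\<^bsub>D\<^esub> h b"
      unfolding Dmeet[OF hD[OF ab(1)] hD[OF ab(2)]] Djoin[OF hD[OF ab(1)] hD[OF ab(2)]]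
      by (rule h_cong, simp add: E_meet E_join h ab)+
    show "h (a \<rightarrow> b) = h a \<rightarrow>\<^bsub>D\<^esub> h b"
    proof -
      \<comment> \<open>\<open>E\<close> of an implication involves only prime filters above
        \<open>x\<close>, and these do not distinguish an element from its representative.\<close>
      have mem: "h a \<in> z \<longleftrightarrow> a \<in> z" "h b \<in> z \<longleftrightarrow> b \<in> z" if "prime_filter L z" "x \<subseteq> z" for z
        using h(2)[OF ab(1)] h(2)[OF ab(2)] that by (auto simp: E_def)
      have "(\<forall>z. prime_filter L z \<longrightarrow> y \<subseteq> z \<longrightarrow> a \<in> z \<longrightarrow> b \<in> z) \<longleftrightarrow>
          (\<forall>z. prime_filter L z \<longrightarrow> y \<subseteq> z \<longrightarrow> h a \<in> z \<longrightarrow> h b \<in> z)" if "x \<subseteq> y" for y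
      proof (rule iff_allI)
        fix z
        show "(prime_filter L z \<longrightarrow> y \<subseteq> z \<longrightarrow> a \<in> z \<longrightarrow> b \<in> z) \<longleftrightarrow>
            (prime_filter L z \<longrightarrow> y \<subseteq> z \<longrightarrow> h a \<in> z \<longrightarrow> h b \<in> z)"
          using mem[of z] order_trans[OF that, of z] by argo
      qed
      then have "E (a \<rightarrow> b) = E (h a \<rightarrow> h b)"
        unfolding E_imp[OF ab] E_imp[OF h(1)[OF ab(1)] h(1)[OF ab(2)]] by blast
      then show ?thesis
        unfolding Dimp[OF hD[OF ab(1)] hD[OF ab(2)]] by (rule h_cong)
    qed
  qed
  define F where "F U = {y. prime_filter L y \<and> x \<subseteq> y \<and> f y \<in> U}" for U
  \<comment> \<open>Finite joins extend \<open>rep\<close> from principal upsets to all upsets; here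
    finiteness of \<open>P\<close> enters.\<close>
  have rep_finite: "\<exists>a\<in>carrier L. E a = {y. prime_filter L y \<and> x \<subseteq> y \<and> (\<exists>q\<in>S. q \<sqsubseteq>\<^bsub>P\<^esub> f y)}"
    if "finite S" "S \<subseteq> carrier P" for S
    using that
  proof (induction S)
    case empty
    then show ?case using E_bot bottom_closed by auto
  next
    case (insert q S)
    then obtain a where a: "a \<in> carrier L" "E a = {y. prime_filter L y \<and> x \<subseteq> y \<and> (\<exists>q\<in>S. q \<sqsubseteq>\<^bsub>P\<^esub> f y)}"
      by auto
    obtain b where b: "b \<in> carrier L" "\<forall>y. prime_filter L y \<and> x \<subseteq> y \<longrightarrow> (b \<in> y \<longleftrightarrow> q \<sqsubseteq>\<^bsub>P\<^esub> f y)"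
      using rep[of q] insert.prems by auto
    have "E b = {y. prime_filter L y \<and> x \<subseteq> y \<and> q \<sqsubseteq>\<^bsub>P\<^esub> f y}" using b(2) by (auto simp: E_def)
    then have "E (b \<squnion> a) = {y. prime_filter L y \<and> x \<subseteq> y \<and> (\<exists>q'\<in>insert q S. q' \<sqsubseteq>\<^bsub>P\<^esub> f y)}"
      using a b(1) by (auto simp: E_join)
    then show ?case using a(1) b(1) by (intro bexI[of _ "b \<squnion> a"]) simp_all
  qed
  have "\<exists>a\<in>carrier L. E a = F U" if U: "U \<in> carrier (Up P)" for U
  proof -
    have sub: "U \<subseteq> carrier P" and up: "\<And>q. q \<in> U \<Longrightarrow> up P q \<subseteq> U" using U by (auto simp: carrier_Up)
    obtain a where a: "a \<in> carrier L" "E a = {y. prime_filter L y \<and> x \<subseteq> y \<and> (\<exists>q\<in>U. q \<sqsubseteq>\<^bsub>P\<^esub> f y)}"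
      using rep_finite[OF finite_subset[OF sub P(2)] sub] by blast
    have "(\<exists>q\<in>U. q \<sqsubseteq>\<^bsub>P\<^esub> f y) \<longleftrightarrow> f y \<in> U" if "prime_filter L y" "x \<subseteq> y" for y
      using up fC[OF that] P.le_refl[OF fC[OF that]] by (auto simp: mem_up_iff subset_iff)
    then have "E a = F U" using a(2) by (auto simp: F_def)
    with a(1) show ?thesis by blast
  qed
  then obtain g0 where g0: "\<And>U. U \<in> carrier (Up P) \<Longrightarrow> g0 U \<in> carrier L \<and> E (g0 U) = F U" by metis
  define g where "g U = h (g0 U)" for U
  have gD: "g U \<in> carrier D" and Eg: "E (g U) = F U" if "U \<in> carrier (Up P)" for U
    using g0[OF that] hD h by (simp_all add: g_def)
  have gL: "g U \<in> carrier L" if "U \<in> carrier (Up P)" for U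
    using D_carrier[OF gD[OF that]] by simp
  have g_eqI: "a = g U" if "a \<in> carrier D" "U \<in> carrier (Up P)" "E a = F U" for a U
    using D_eqI[OF that(1) gD[OF that(2)]] Eg[OF that(2)] that(3) by simp
  interpret UpP: heyting_algebra "Up P" by (rule heyting_algebra_Up[OF P(1)])
  have g_bot: "\<bottom>\<^bsub>D\<^esub> = g \<bottom>\<^bsub>Up P\<^esub>"
  proof (rule g_eqI)
    show "E \<bottom>\<^bsub>D\<^esub> = F \<bottom>\<^bsub>Up P\<^esub>"
      unfolding Dbot bottom_Up[OF P(1)] using h E_bot by (simp add: F_def)
  qed (use bt Dbot in simp_all)
  have g_top: "\<top>\<^bsub>D\<^esub> = g \<top>\<^bsub>Up P\<^esub>"
  proof (rule g_eqI)
    show "E \<top>\<^bsub>D\<^esub> = F \<top>\<^bsub>Up P\<^esub>"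
      unfolding Dtop top_Up[OF P(1)] using h E_top fC by (auto simp: F_def)
  qed (use bt Dtop in simp_all)
  have g_meet: "g U \<sqinter>\<^bsub>D\<^esub> g V = g (U \<sqinter>\<^bsub>Up P\<^esub> V)"
    and g_join: "g U \<squnion>\<^bsub>D\<^esub> g V = g (U \<squnion>\<^bsub>Up P\<^esub> V)"
    and g_imp: "g U \<rightarrow>\<^bsub>D\<^esub> g V = g (U \<rightarrow>\<^bsub>Up P\<^esub> V)"
    if UV: "U \<in> carrier (Up P)" "V \<in> carrier (Up P)" for U V
  proof -
    note G = gD[OF UV(1)] gD[OF UV(2)] and GL = gL[OF UV(1)] gL[OF UV(2)]
    show "g U \<sqinter>\<^bsub>D\<^esub> g V = g (U \<sqinter>\<^bsub>Up P\<^esub> V)"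
    proof (rule g_eqI)
      have "E (g U \<sqinter>\<^bsub>D\<^esub> g V) = F U \<inter> F V"
        using G GL UV by (simp add: Dmeet h E_meet Eg)
      also have "\<dots> = F (U \<sqinter>\<^bsub>Up P\<^esub> V)" using UV by (auto simp: F_def meet_Up)
      finally show "E (g U \<sqinter>\<^bsub>D\<^esub> g V) = F (U \<sqinter>\<^bsub>Up P\<^esub> V)" .
    qed (use G GL UV hD in \<open>simp_all add: Dmeet\<close>)
    show "g U \<squnion>\<^bsub>D\<^esub> g V = g (U \<squnion>\<^bsub>Up P\<^esub> V)"
    proof (rule g_eqI)
      have "E (g U \<squnion>\<^bsub>D\<^esub> g V) = F U \<union> F V"
        using G GL UV by (simp add: Djoin h E_join Eg)
      also have "\<dots> = F (U \<squnion>\<^bsub>Up P\<^esub> V)" using UV by (auto simp: F_def join_Up)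
      finally show "E (g U \<squnion>\<^bsub>D\<^esub> g V) = F (U \<squnion>\<^bsub>Up P\<^esub> V)" .
    qed (use G GL UV hD in \<open>simp_all add: Djoin\<close>)
    show "g U \<rightarrow>\<^bsub>D\<^esub> g V = g (U \<rightarrow>\<^bsub>Up P\<^esub> V)"
    proof (rule g_eqI)
      have gm: "g U \<in> z \<longleftrightarrow> f z \<in> U" "g V \<in> z \<longleftrightarrow> f z \<in> V" if "prime_filter L z" "x \<subseteq> z" for z
        using Eg[OF UV(1)] Eg[OF UV(2)] that by (auto simp: E_def F_def)
      \<comment> \<open>The back condition \<open>lift\<close> gives one direction, monotonicity of
        \<open>f\<close> the other.\<close>
      have "(\<forall>z. prime_filter L z \<longrightarrow> y \<subseteq> z \<longrightarrow> g U \<in> z \<longrightarrow> g V \<in> z) \<longleftrightarrow> up P (f y) \<inter> U \<subseteq> V"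
        if y: "prime_filter L y" "x \<subseteq> y" for y
      proof
        assume all: "\<forall>z. prime_filter L z \<longrightarrow> y \<subseteq> z \<longrightarrow> g U \<in> z \<longrightarrow> g V \<in> z"
        show "up P (f y) \<inter> U \<subseteq> V"
        proof
          fix q assume q: "q \<in> up P (f y) \<inter> U"
          then obtain z where z: "prime_filter L z" "y \<subseteq> z" "f z = q"
            using lift[OF y, of q] by (auto simp: mem_up_iff)
          then show "q \<in> V" using all gm[OF z(1)] q y by auto
        qed
      next
        assume sub: "up P (f y) \<inter> U \<subseteq> V"
        show "\<forall>z. prime_filter L z \<longrightarrow> y \<subseteq> z \<longrightarrow> g U \<in> z \<longrightarrow> g V \<in> z"
        proof (intro allI impI)
          fix z assume z: "prime_filter L z" "y \<subseteq> z" "g U \<in> z"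
          have xz: "x \<subseteq> z" using y z by blast
          have "f z \<in> up P (f y)" using mono[OF y z(1,2)] fC[OF z(1) xz] by (simp add: mem_up_iff)
          then show "g V \<in> z" using sub gm[OF z(1) xz] z by blast
        qed
      qed
      then have "E (g U \<rightarrow> g V) = F (U \<rightarrow>\<^bsub>Up P\<^esub> V)"
        using fC by (auto simp: E_imp[OF GL] F_def heyting_imp_Up[OF P(1) UV])
      then show "E (g U \<rightarrow>\<^bsub>D\<^esub> g V) = F (U \<rightarrow>\<^bsub>Up P\<^esub> V)"
        using G GL by (simp add: Dimp h)
    qed (use G GL UV hD in \<open>simp_all add: Dimp\<close>)
  qed
  let ?S = "g ` carrier (Up P)"
  have S: "heyting_subalgebra ?S D"
    unfolding heyting_subalgebra_def
  proof (intro conjI ballI)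
    show "?S \<subseteq> carrier D" using gD by blast
    show "\<bottom>\<^bsub>D\<^esub> \<in> ?S" "\<top>\<^bsub>D\<^esub> \<in> ?S" unfolding g_bot g_top by simp_all
    fix a b assume "a \<in> ?S" "b \<in> ?S"
    then obtain U V where UV: "U \<in> carrier (Up P)" "V \<in> carrier (Up P)" "a = g U" "b = g V" by blast
    then show "a \<sqinter>\<^bsub>D\<^esub> b \<in> ?S" "a \<squnion>\<^bsub>D\<^esub> b \<in> ?S" "a \<rightarrow>\<^bsub>D\<^esub> b \<in> ?S"
      by (simp_all add: g_meet g_join g_imp)
  qed
  have inj: "inj_on g (carrier (Up P))"
  proof (rule inj_onI)
    fix U V assume U: "U \<in> carrier (Up P)" and V: "V \<in> carrier (Up P)" and eq: "g U = g V"
    have F_eq: "F U = F V" using Eg[OF U] Eg[OF V] eq by simp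
    \<comment> \<open>Since \<open>f x\<close> is least in \<open>P\<close>, \<open>lift\<close>
      makes \<open>f\<close> onto, so an upset is recovered from its inverse image.\<close>
    have "q \<in> U \<longleftrightarrow> q \<in> V" if q: "q \<in> carrier P" for q
    proof -
      obtain y where "prime_filter L y" "x \<subseteq> y" "f y = q"
        using lift[OF x subset_refl q root[OF q]] by blast
      then show ?thesis using F_eq by (auto simp: F_def)
    qed
    moreover have "U \<subseteq> carrier P" "V \<subseteq> carrier P" using U V by (simp_all add: carrier_Up)
    ultimately show "U = V" by blast
  qed
  have "heyting_hom (Up P) (D\<lparr>carrier := ?S\<rparr>) g"
    unfolding heyting_hom_def
    by (simp add: bottom_subalgebra[OF DH S] top_subalgebra[OF DH S] meet_subalgebra[OF DH S]
        join_subalgebra[OF DH S] imp_subalgebra[OF DH S] g_bot g_top g_meet g_join g_imp)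
  then have "heyting_iso (Up P) (D\<lparr>carrier := ?S\<rparr>)"
    using inj by (auto simp: heyting_iso_def bij_betw_def)
  moreover have "h ` carrier L = carrier D" by (simp add: D_def)
  ultimately show ?thesis
    unfolding subalgebra_of_hom_image_def using DH hom S by blast
qed

lemma diamond_system_if_no_forbidden:
  assumes "\<And>P. P \<in> {P1, P2, P3, P4} \<Longrightarrow> \<not> subalgebra_of_hom_image (Up P) L"
  shows "diamond_system (prime_spectrum L)"
proof -
  interpret F: descriptive_frame "prime_spectrum L" "prime_extent L ` carrier L"
    by (rule descriptive_frame_prime_spectrum)
  have "\<not> F.reduces_to P" if P: "P \<in> {P1, P2, P3, P4}" for P
  proof
    assume "F.reduces_to P"
    then obtain x f where x: "prime_filter L x"
      and fC: "\<forall>y\<in>up (prime_spectrum L) x. f y \<in> carrier P"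
      and mono: "\<forall>y\<in>up (prime_spectrum L) x. \<forall>z\<in>up (prime_spectrum L) y. f y \<sqsubseteq>\<^bsub>P\<^esub> f z"
      and lift: "\<forall>y\<in>up (prime_spectrum L) x. \<forall>q\<in>carrier P. f y \<sqsubseteq>\<^bsub>P\<^esub> q \<longrightarrow>
        (\<exists>z\<in>up (prime_spectrum L) y. f z = q)"
      and root: "\<forall>q\<in>carrier P. f x \<sqsubseteq>\<^bsub>P\<^esub> q"
      and rep: "\<forall>q\<in>carrier P. \<exists>U\<in>prime_extent L ` carrier L. \<forall>y\<in>up (prime_spectrum L) x.
        y \<in> U \<longleftrightarrow> q \<sqsubseteq>\<^bsub>P\<^esub> f y"
      unfolding F.reduces_to_def carrier_prime_spectrum by blast
    have fin: "finite (carrier P)" and po: "partial_order P"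
      using P partial_order_P by (auto simp: P1_def P2_def P3_def P4_def)
    have "subalgebra_of_hom_image (Up P) L"
    proof (rule subalgebra_of_hom_image_if_reduces[OF po fin x, of f])
      fix q assume "q \<in> carrier P"
      with rep obtain a where "a \<in> carrier L"
        "\<forall>y\<in>up (prime_spectrum L) x. y \<in> prime_extent L a \<longleftrightarrow> q \<sqsubseteq>\<^bsub>P\<^esub> f y" by blast
      then show "\<exists>a\<in>carrier L. \<forall>y. prime_filter L y \<and> x \<subseteq> y \<longrightarrow> (a \<in> y \<longleftrightarrow> q \<sqsubseteq>\<^bsub>P\<^esub> f y)"
        by (intro bexI[of _ a]) (simp_all add: up_prime_spectrum prime_extent_def)
    next
      fix y q assume y: "prime_filter L y" "x \<subseteq> y" and q: "q \<in> carrier P" "f y \<sqsubseteq>\<^bsub>P\<^esub> q"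
      then have "y \<in> up (prime_spectrum L) x" by (simp add: up_prime_spectrum)
      then have "\<exists>z\<in>up (prime_spectrum L) y. f z = q" using lift q by blast
      then show "\<exists>z. prime_filter L z \<and> y \<subseteq> z \<and> f z = q" by (auto simp: up_prime_spectrum)
    qed (use fC mono root in \<open>simp_all add: up_prime_spectrum\<close>)
    with assms[OF P] show False by blast
  qed
  then show ?thesis by (intro F.diamond_system_if_irreducible) simp_all
qed

end

theorem theorem4p4:
  fixes A :: "'a gorder" and J1 J2 J3 J4 :: form
  assumes "heyting_algebra A"
    and "jankov_formula TYPE('a) (Up P1) J1"
    and "jankov_formula TYPE('a) (Up P2) J2"
    and "jankov_formula TYPE('a) (Up P3) J3"
    and "jankov_formula TYPE('a) (Up P4) J4"
  shows "(A \<in> DHA \<longleftrightarrow> diamond_system (prime_spectrum A)) \<and>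
    (diamond_system (prime_spectrum A) \<longleftrightarrow>
      (\<forall>x \<in> carrier (prime_spectrum A).
        diamond_sequence (subposet (prime_spectrum A) (up (prime_spectrum A) x)))) \<and>
    ((\<forall>x \<in> carrier (prime_spectrum A).
        diamond_sequence (subposet (prime_spectrum A) (up (prime_spectrum A) x))) \<longleftrightarrow>
      validates A J1 \<and> validates A J2 \<and> validates A J3 \<and> validates A J4)"
proof -
  interpret heyting_gorder A by (rule heyting_gorder.intro[OF assms(1)])
  have "validates A J1 \<and> validates A J2 \<and> validates A J3 \<and> validates A J4 \<longleftrightarrow>
      (\<forall>P\<in>{P1, P2, P3, P4}. \<not> subalgebra_of_hom_image (Up P) A)"
    using assms by (simp add: jankov_formula_def)
  also have "\<dots> \<longleftrightarrow> diamond_system (prime_spectrum A)"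
    using diamond_system_if_no_forbidden diamond_system_no_forbidden[OF assms(1)] by blast
  finally show ?thesis
    using DHA_diamond_system[of A] diamond_system_DHA[OF assms(1)]
      diamond_system_iff_up[OF partial_order_prime_spectrum, of A] by blast
qed

end
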